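(* For all $n$, $c_0(M_{\infty,n}\oplus M_{n,\infty})$ has the $(2+\varepsilon)$-CSEP for all $\varepsilon>0$.
   Context: $\mathbf K$ denotes the compact operators on $\ell^2$, viewed as infinite matrices. $M_{\infty,n}$ (respectively $M_{n,\infty}$) is the operator space of all $\infty\times n$ (respectively $n\times\infty$) matrices in $\mathbf K$, i.e. those whose entries vanish outside the first $n$ columns (respectively the first $n$ rows). Direct sums of operator spaces are in the $\ell^\infty$-sense. For an operator space $Z$, $c_0(Z)$ is the space of sequences in $Z$ tending to $0$ in norm, with sup norm and matrix norms given by suprema over coordinates. An operator space $Z$ has the $\lambda$-CSEP ($\lambda$-Complete Separable Extension Property) if for all separable operator spaces $Y$, all closed linear subspaces $X\subset Y$, and all completely bounded operators $T:X\to Z$, there exists a completely bounded $\tilde T:Y\to Z$ extending $T$ with $\|\tilde T\|_{cb}\le\lambda\|T\|_{cb}$. *)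

theory Defs
  imports "HOL-Analysis.Analysis" "HOL-Library.Function_Algebras"
begin

section \<open>Abstract operator spaces\<close>

text \<open>
  An operator space is a complete complex normed space together with norms on the spaces of
  \<open>k \<times> k\<close> matrices over it, satisfying Ruan's axioms. A \<open>k \<times> k\<close> matrix is a function
  \<open>nat \<Rightarrow> nat \<Rightarrow> 'a\<close> which is zero outside \<open>{..<k} \<times> {..<k}\<close>. The carrier is a subspace of an ambient
  complex vector space, which is the whole type.
\<close>

record 'a opspace =
  os_carrier :: "'a set"
  os_scale :: "complex \<Rightarrow> 'a \<Rightarrow> 'a"
  os_norm :: "nat \<Rightarrow> (nat \<Rightarrow> nat \<Rightarrow> 'a) \<Rightarrow> real"

definition os_mat :: "('a::zero) opspace \<Rightarrow> nat \<Rightarrow> (nat \<Rightarrow> nat \<Rightarrow> 'a) set" where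
  "os_mat E k = {x. \<forall>i j. if i < k \<and> j < k then x i j \<in> os_carrier E else x i j = 0}"

definition single_entry :: "'a::zero \<Rightarrow> nat \<Rightarrow> nat \<Rightarrow> 'a" where
  "single_entry v = (\<lambda>i j. if i = 0 \<and> j = 0 then v else 0)"

definition os_norm1 :: "('a::zero) opspace \<Rightarrow> 'a \<Rightarrow> real" where
  "os_norm1 E v = os_norm E 1 (single_entry v)"

text \<open>
  The value outside the carrier is irrelevant, but the locale \<^locale>\<open>Metric_space\<close> requires the
  distance function to be nonnegative and symmetric everywhere.
\<close>

definition os_dist :: "('a::ab_group_add) opspace \<Rightarrow> 'a \<Rightarrow> 'a \<Rightarrow> real" where
  "os_dist E v w = (if v \<in> os_carrier E \<and> w \<in> os_carrier E then os_norm1 E (v - w) else 0)"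

abbreviation os_topology :: "('a::ab_group_add) opspace \<Rightarrow> 'a topology" where
  "os_topology E \<equiv> Metric_space.mtopology (os_carrier E) (os_dist E)"

subsection \<open>Scalar matrices as operators between \<open>\<ell>\<^sup>2\<close>-spaces\<close>

definition ell2 :: "('i \<Rightarrow> complex) set" where
  "ell2 = {v. (\<lambda>i. (cmod (v i))\<^sup>2) summable_on UNIV}"

definition ell2_norm :: "('i \<Rightarrow> complex) \<Rightarrow> real" where
  "ell2_norm v = sqrt (\<Sum>\<^sub>\<infinity>i. (cmod (v i))\<^sup>2)"

definition mat_apply :: "('i \<Rightarrow> 'j \<Rightarrow> complex) \<Rightarrow> ('j \<Rightarrow> complex) \<Rightarrow> 'i \<Rightarrow> complex" where
  "mat_apply A v = (\<lambda>i. \<Sum>\<^sub>\<infinity>j. A i j * v j)"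

text \<open>The following is only meaningful if \<open>A\<close> is the matrix of a bounded operator.\<close>

definition mat_op_norm :: "('i \<Rightarrow> 'j \<Rightarrow> complex) \<Rightarrow> real" where
  "mat_op_norm A = (SUP v\<in>{v \<in> ell2. ell2_norm v \<le> 1}. ell2_norm (mat_apply A v))"

definition bounded_mat :: "('i \<Rightarrow> 'j \<Rightarrow> complex) \<Rightarrow> bool" where
  "bounded_mat A \<longleftrightarrow>
     (\<forall>v\<in>ell2. (\<forall>i. (\<lambda>j. A i j * v j) summable_on UNIV) \<and> mat_apply A v \<in> ell2) \<and>
     (\<exists>C. \<forall>v\<in>ell2. ell2_norm (mat_apply A v) \<le> C * ell2_norm v)"

definition compact_mat :: "('i \<Rightarrow> 'j \<Rightarrow> complex) \<Rightarrow> bool" where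
  "compact_mat A \<longleftrightarrow> bounded_mat A \<and>
     (\<forall>u :: nat \<Rightarrow> 'j \<Rightarrow> complex. (\<forall>m. u m \<in> ell2 \<and> ell2_norm (u m) \<le> 1) \<longrightarrow>
        (\<exists>r w. strict_mono (r :: nat \<Rightarrow> nat) \<and> w \<in> ell2 \<and>
           (\<lambda>m. ell2_norm (\<lambda>i. mat_apply A (u (r m)) i - w i)) \<longlonglongrightarrow> 0))"

subsection \<open>Ruan's axioms\<close>

text \<open>
  Since matrices are padded with zeros, an \<open>l \<times> k\<close> matrix, regarded as an operator on
  \<open>\<ell>\<^sup>2(\<nat>)\<close>, has the norm of the operator from \<open>\<complex>\<^sup>k\<close> to \<open>\<complex>\<^sup>l\<close> it represents.
\<close>

definition scalar_mat :: "nat \<Rightarrow> nat \<Rightarrow> (nat \<Rightarrow> nat \<Rightarrow> complex) set" where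
  "scalar_mat l k = {a. \<forall>i j. i \<ge> l \<or> j \<ge> k \<longrightarrow> a i j = 0}"

definition mat_direct_sum ::
  "nat \<Rightarrow> (nat \<Rightarrow> nat \<Rightarrow> 'a::zero) \<Rightarrow> (nat \<Rightarrow> nat \<Rightarrow> 'a) \<Rightarrow> nat \<Rightarrow> nat \<Rightarrow> 'a" where
  "mat_direct_sum k x y = (\<lambda>i j. if i < k \<and> j < k then x i j
                                 else if k \<le> i \<and> k \<le> j then y (i - k) (j - k) else 0)"

text \<open>The product \<open>a \<cdot> x \<cdot> b\<close> for \<open>x\<close> of size \<open>k \<times> k\<close>.\<close>

definition mat_sandwich ::
  "('a::ab_group_add) opspace \<Rightarrow> nat \<Rightarrow> (nat \<Rightarrow> nat \<Rightarrow> complex) \<Rightarrow> (nat \<Rightarrow> nat \<Rightarrow> 'a) \<Rightarrow>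
    (nat \<Rightarrow> nat \<Rightarrow> complex) \<Rightarrow> nat \<Rightarrow> nat \<Rightarrow> 'a" where
  "mat_sandwich E k a x b = (\<lambda>i j. \<Sum>p<k. \<Sum>q<k. os_scale E (a i p * b q j) (x p q))"

definition operator_space :: "('a::ab_group_add) opspace \<Rightarrow> bool" where
  "operator_space E \<longleftrightarrow>
     vector_space (os_scale E) \<and>
     module.subspace (os_scale E) (os_carrier E) \<and>
     (\<forall>k\<ge>1. \<forall>x\<in>os_mat E k.
        0 \<le> os_norm E k x \<and>
        (os_norm E k x = 0 \<longrightarrow> x = (\<lambda>i j. 0)) \<and>
        (\<forall>c. os_norm E k (\<lambda>i j. os_scale E c (x i j)) = cmod c * os_norm E k x) \<and>
        (\<forall>y\<in>os_mat E k. os_norm E k (\<lambda>i j. x i j + y i j) \<le> os_norm E k x + os_norm E k y)) \<and>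
     (\<forall>k\<ge>1. \<forall>l\<ge>1. \<forall>x\<in>os_mat E k. \<forall>y\<in>os_mat E l.
        os_norm E (k + l) (mat_direct_sum k x y) = max (os_norm E k x) (os_norm E l y)) \<and>
     (\<forall>k\<ge>1. \<forall>l\<ge>1. \<forall>x\<in>os_mat E k. \<forall>a\<in>scalar_mat l k. \<forall>b\<in>scalar_mat k l.
        os_norm E l (mat_sandwich E k a x b) \<le> mat_op_norm a * os_norm E k x * mat_op_norm b) \<and>
     Metric_space.mcomplete (os_carrier E) (os_dist E)"

section \<open>Completely bounded maps and the CSEP\<close>

text \<open>Maps are total functions of which only the values on the carrier of the domain matter.\<close>

definition os_linear :: "('a::ab_group_add) opspace \<Rightarrow> ('b::ab_group_add) opspace \<Rightarrow> ('a \<Rightarrow> 'b) \<Rightarrow> bool" where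
  "os_linear E F T \<longleftrightarrow>
     (\<forall>v\<in>os_carrier E. T v \<in> os_carrier F) \<and>
     (\<forall>v\<in>os_carrier E. \<forall>w\<in>os_carrier E. T (v + w) = T v + T w) \<and>
     (\<forall>c. \<forall>v\<in>os_carrier E. T (os_scale E c v) = os_scale F c (T v))"

definition completely_bounded ::
  "('a::ab_group_add) opspace \<Rightarrow> ('b::ab_group_add) opspace \<Rightarrow> ('a \<Rightarrow> 'b) \<Rightarrow> bool" where
  "completely_bounded E F T \<longleftrightarrow> os_linear E F T \<and>
     (\<exists>C. \<forall>k\<ge>1. \<forall>x\<in>os_mat E k. os_norm F k (\<lambda>i j. T (x i j)) \<le> C * os_norm E k x)"

definition cb_norm ::
  "('a::ab_group_add) opspace \<Rightarrow> ('b::ab_group_add) opspace \<Rightarrow> ('a \<Rightarrow> 'b) \<Rightarrow> real" where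
  "cb_norm E F T =
     Sup {os_norm F k (\<lambda>i j. T (x i j)) | k x. 1 \<le> k \<and> x \<in> os_mat E k \<and> os_norm E k x \<le> 1}"

text \<open>
  The separable operator spaces \<open>Y\<close> quantified over have their elements in the type \<open>'y\<close>. A definition
  cannot quantify over types, so \<open>'y\<close> is a parameter; a statement with a free
  type variable \<open>'y\<close> is about all separable operator spaces.
\<close>

definition has_CSEP :: "'y::ab_group_add itself \<Rightarrow> real \<Rightarrow> ('z::ab_group_add) opspace \<Rightarrow> bool" where
  "has_CSEP _ lam Z \<longleftrightarrow> operator_space Z \<and>
     (\<forall>(Y :: 'y opspace) X T.
        operator_space Y \<and> separable_space (os_topology Y) \<and>
        module.subspace (os_scale Y) X \<and> closedin (os_topology Y) X \<and>
        completely_bounded (Y\<lparr>os_carrier := X\<rparr>) Z T \<longrightarrow>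
        (\<exists>T'. completely_bounded Y Z T' \<and> (\<forall>v\<in>X. T' v = T v) \<and>
              cb_norm Y Z T' \<le> lam * cb_norm (Y\<lparr>os_carrier := X\<rparr>) Z T))"

section \<open>The operator spaces of the statement\<close>

text \<open>
  A \<open>k \<times> k\<close> matrix over \<open>\<^bold>K\<close> acts on \<open>(\<ell>\<^sup>2)\<^sup>k\<close>; as it is padded with zeros, it is a block matrix
  indexed by \<open>nat \<times> nat\<close>, where the first components are the block indices.
\<close>

definition compact_ops :: "(nat \<Rightarrow> nat \<Rightarrow> complex) opspace" where
  "compact_ops = \<lparr>os_carrier = {A. compact_mat A},
                  os_scale = (\<lambda>c A i j. c * A i j),
                  os_norm = (\<lambda>k x. mat_op_norm (\<lambda>(p, i) (q, j). x p q i j))\<rparr>"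

definition M_inf_fin :: "nat \<Rightarrow> (nat \<Rightarrow> nat \<Rightarrow> complex) opspace" where
  "M_inf_fin n = compact_ops
     \<lparr>os_carrier := {A \<in> os_carrier compact_ops. \<forall>i j. n \<le> j \<longrightarrow> A i j = 0}\<rparr>"

definition M_fin_inf :: "nat \<Rightarrow> (nat \<Rightarrow> nat \<Rightarrow> complex) opspace" where
  "M_fin_inf n = compact_ops
     \<lparr>os_carrier := {A \<in> os_carrier compact_ops. \<forall>i j. n \<le> i \<longrightarrow> A i j = 0}\<rparr>"

definition os_sum :: "'a opspace \<Rightarrow> 'b opspace \<Rightarrow> ('a \<times> 'b) opspace" (infixr "\<oplus>\<^sub>\<infinity>" 65) where
  "E \<oplus>\<^sub>\<infinity> F = \<lparr>os_carrier = os_carrier E \<times> os_carrier F,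
             os_scale = (\<lambda>c (v, w). (os_scale E c v, os_scale F c w)),
             os_norm = (\<lambda>k x. max (os_norm E k (\<lambda>i j. fst (x i j)))
                                  (os_norm F k (\<lambda>i j. snd (x i j))))\<rparr>"

definition os_c0 :: "('a::zero) opspace \<Rightarrow> (nat \<Rightarrow> 'a) opspace" where
  "os_c0 Z = \<lparr>os_carrier = {f. (\<forall>m. f m \<in> os_carrier Z) \<and> (\<lambda>m. os_norm1 Z (f m)) \<longlonglongrightarrow> 0},
              os_scale = (\<lambda>c f m. os_scale Z c (f m)),
              os_norm = (\<lambda>k x. SUP m. os_norm Z k (\<lambda>i j. x i j m))\<rparr>"

end

theory Submission
  imports Defs
begin

text \<open>
  Matrices with finitely many columns or rows are compact as soon as they are bounded, so
  \<open>W = M\<^bsub>\<infinity>,n\<^esub> \<oplus> M\<^bsub>n,\<infinity>\<^esub>\<close> consists of all bounded operators \<open>\<complex>\<^sup>n \<rightarrow> \<ell>\<^sup>2\<close> and \<open>\<ell>\<^sup>2 \<rightarrow> \<complex>\<^sup>n\<close>, and a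
  completely bounded map \<open>T\<close> from \<open>X\<close> into \<open>c\<^sub>0(W)\<close> is a sequence of matrices of functionals on \<open>X\<close>
  that tends to zero at every point of \<open>X\<close>. The proof is Sobczyk's argument for \<open>c\<^sub>0\<close>, carried out
  with matrices of functionals.

  First, each coordinate of \<open>T\<close> extends from \<open>X\<close> to \<open>Y\<close> with the same completely bounded norm \<open>C\<close>
  (\<open>cb_form_extension\<close>, Wittstock's theorem). A matrix of functionals with completely bounded norm at
  most \<open>C\<close> is the same as one functional on the finite matrices over \<open>Y\<close>, dominated by \<open>C\<close> times the
  norm \<open>factor_norm\<close>; so the theorem follows from the Hahn-Banach theorem once it is known that the
  norm computed in \<open>Y\<close> dominates the functional given on \<open>X\<close> (\<open>pairing_le_factor_cost\<close>). The
  extensions \<open>a\<^sub>m\<close> form a bounded sequence, but off \<open>X\<close> it has no reason to tend to zero.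

  Second, one subtracts maps \<open>g\<^sub>m\<close> with norm at most \<open>C\<close> that vanish on \<open>X\<close>, such that \<open>a\<^sub>m - g\<^sub>m\<close>
  tends to zero at every point of \<open>Y\<close>; then \<open>a\<^sub>m - g\<^sub>m\<close> is the required extension, of norm at most
  \<open>2C\<close>. For scalar functionals \<open>g\<^sub>m\<close> is found near the cluster points of the sequence \<open>a\<^sub>m\<close>, which
  vanish on \<open>X\<close>. The values of row maps lie in an infinite dimensional space, so such cluster
  points need not exist for the norm topology. But to approximate \<open>a\<^sub>m\<close> on a finite set \<open>S\<close>, one
  can rotate: the rows of the matrices \<open>a\<^sub>m v\<close>, \<open>v \<in> S\<close>, span a space whose dimension is at most
  \<open>n |S|\<close>, independently of \<open>m\<close>. After a partial isometry \<open>u\<^sub>m\<close> one has maps into matrices of a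
  fixed finite size; a cluster point \<open>g\<close> of these exists by compactness, and \<open>g u\<^sub>m\<close> is close to
  \<open>a\<^sub>m\<close> on \<open>S\<close> for suitable \<open>m\<close> (\<open>correctable_rows\<close>). Columns are rows over the opposite operator
  space. Separability of \<open>Y\<close> allows \<open>S\<close> to grow along a dense sequence.

  That \<open>c\<^sub>0(W)\<close> is an operator space at all is checked with the same tool that carries the rest:
  \<open>form_bound A C\<close>, the estimate of the bilinear form of a matrix on finitely supported vectors,
  which holds if and only if \<open>A\<close> is bounded with norm at most \<open>C\<close>.
\<close>

section \<open>Bounds of infinite matrices tested on finite vectors\<close>

abbreviation fin_norm :: "'i set \<Rightarrow> ('i \<Rightarrow> complex) \<Rightarrow> real" where
  "fin_norm I v \<equiv> L2_set (\<lambda>i. cmod (v i)) I"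

abbreviation bilin ::
  "'i set \<Rightarrow> 'j set \<Rightarrow> ('i \<Rightarrow> complex) \<Rightarrow> ('i \<Rightarrow> 'j \<Rightarrow> complex) \<Rightarrow> ('j \<Rightarrow> complex) \<Rightarrow> complex" where
  "bilin I J \<eta> A \<xi> \<equiv> (\<Sum>i\<in>I. \<Sum>j\<in>J. \<eta> i * A i j * \<xi> j)"

text \<open>Testing a matrix against finite index sets only keeps all questions of convergence out of the
  algebra with matrices; the connection with operators on \<open>\<ell>\<^sup>2\<close> is made once, in
  \<open>bounded_mat_iff\<close> and \<open>mat_op_norm_le_iff\<close>. The index types are arbitrary because block matrices
  are matrices indexed by pairs.\<close>

definition form_bound :: "('i \<Rightarrow> 'j \<Rightarrow> complex) \<Rightarrow> real \<Rightarrow> bool" where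
  "form_bound A C \<longleftrightarrow> (\<forall>I J \<eta> \<xi>. finite I \<longrightarrow> finite J \<longrightarrow>
     cmod (bilin I J \<eta> A \<xi>)
       \<le> C * fin_norm I \<eta> * fin_norm J \<xi>)"

lemma form_boundD:
  assumes "form_bound A C" "finite I" "finite J"
  shows "cmod (bilin I J \<eta> A \<xi>)
           \<le> C * fin_norm I \<eta> * fin_norm J \<xi>"
  using assms unfolding form_bound_def by blast

lemma form_bound_entry:
  assumes "form_bound A C" shows "cmod (A i j) \<le> C"
  using form_boundD[OF assms, of "{i}" "{j}" "\<lambda>_. 1" "\<lambda>_. 1"] by simp

lemma form_bound_nonneg: "form_bound A C \<Longrightarrow> 0 \<le> C"
  using form_bound_entry[of A C undefined undefined] norm_ge_zero order_trans by blast

lemma form_bound_mono: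
  assumes "form_bound A C" "C \<le> D" shows "form_bound A D"
  unfolding form_bound_def
proof (intro allI impI)
  fix I :: "'a set" and J :: "'b set" and \<eta> :: "'a \<Rightarrow> complex" and \<xi> :: "'b \<Rightarrow> complex" assume "finite I" "finite J"
  have "cmod (bilin I J \<eta> A \<xi>)
       \<le> C * (fin_norm I \<eta> * fin_norm J \<xi>)"
    using form_boundD[OF assms(1) \<open>finite I\<close> \<open>finite J\<close>] by (simp add: mult.assoc)
  also have "\<dots> \<le> D * (fin_norm I \<eta> * fin_norm J \<xi>)"
    by (intro mult_right_mono assms mult_nonneg_nonneg L2_set_nonneg)
  finally show "cmod (bilin I J \<eta> A \<xi>)
       \<le> D * fin_norm I \<eta> * fin_norm J \<xi>" by (simp add: mult.assoc)
qed

lemma form_bound_0: "form_bound (\<lambda>i j. 0) 0"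
  by (simp add: form_bound_def)

lemma form_bound_0_iff: "form_bound A 0 \<longleftrightarrow> A = (\<lambda>i j. 0)"
proof
  assume "form_bound A 0" then show "A = (\<lambda>i j. 0)"
    using form_bound_entry[of A 0] by (auto simp: fun_eq_iff)
qed (simp add: form_bound_0)

lemma form_bound_add:
  assumes "form_bound A C" "form_bound B D" shows "form_bound (\<lambda>i j. A i j + B i j) (C + D)"
  unfolding form_bound_def
proof (intro allI impI)
  fix I :: "'a set" and J :: "'b set" and \<eta> :: "'a \<Rightarrow> complex" and \<xi> :: "'b \<Rightarrow> complex" assume *: "finite I" "finite J"
  have "(\<Sum>i\<in>I. \<Sum>j\<in>J. \<eta> i * (A i j + B i j) * \<xi> j) =
    bilin I J \<eta> A \<xi> + bilin I J \<eta> B \<xi>"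
    by (simp add: algebra_simps sum.distrib)
  then show "cmod (\<Sum>i\<in>I. \<Sum>j\<in>J. \<eta> i * (A i j + B i j) * \<xi> j)
       \<le> (C + D) * fin_norm I \<eta> * fin_norm J \<xi>"
    using norm_triangle_mono[OF form_boundD[OF assms(1) *] form_boundD[OF assms(2) *]]
    by (simp add: algebra_simps)
qed

lemma form_bound_scale:
  assumes "form_bound A C" shows "form_bound (\<lambda>i j. c * A i j) (cmod c * C)"
  unfolding form_bound_def
proof (intro allI impI)
  fix I :: "'a set" and J :: "'b set" and \<eta> :: "'a \<Rightarrow> complex" and \<xi> :: "'b \<Rightarrow> complex" assume *: "finite I" "finite J"
  have "(\<Sum>i\<in>I. \<Sum>j\<in>J. \<eta> i * (c * A i j) * \<xi> j) = c * bilin I J \<eta> A \<xi>"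
    by (simp add: sum_distrib_left algebra_simps)
  then show "cmod (\<Sum>i\<in>I. \<Sum>j\<in>J. \<eta> i * (c * A i j) * \<xi> j)
       \<le> cmod c * C * fin_norm I \<eta> * fin_norm J \<xi>"
    using mult_left_mono[OF form_boundD[OF assms *], of "cmod c" \<eta> \<xi>]
    by (simp add: norm_mult algebra_simps)
qed

lemma form_bound_diff:
  assumes "form_bound A C" "form_bound B D" shows "form_bound (\<lambda>i j. A i j - B i j) (C + D)"
  using form_bound_add[OF assms(1) form_bound_scale[OF assms(2), of "-1"]] by simp

lemma form_bound_sum:
  assumes "finite S" "\<And>s. s \<in> S \<Longrightarrow> form_bound (A s) (C s)"
  shows "form_bound (\<lambda>i j. \<Sum>s\<in>S. A s i j) (\<Sum>s\<in>S. C s)"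
  using assms by (induction S) (auto intro: form_bound_0 form_bound_add)

text \<open>Vectors on finite index sets can be extended by zero to any larger ones.\<close>

lemma form_boundI_cofinal:
  assumes "\<And>I J. finite I \<Longrightarrow> finite J \<Longrightarrow> \<exists>I' J'. finite I' \<and> finite J' \<and> I \<subseteq> I' \<and> J \<subseteq> J' \<and>
     (\<forall>\<eta> \<xi>. cmod (bilin I' J' \<eta> A \<xi>)
        \<le> C * fin_norm I' \<eta> * fin_norm J' \<xi>)"
  shows "form_bound A C"
  unfolding form_bound_def
proof (intro allI impI)
  fix I :: "'a set" and J :: "'b set" and \<eta> :: "'a \<Rightarrow> complex" and \<xi> :: "'b \<Rightarrow> complex" assume *: "finite I" "finite J"
  obtain I' J' where I': "finite I'" "finite J'" "I \<subseteq> I'" "J \<subseteq> J'"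
    and b: "\<And>\<eta> \<xi>. cmod (bilin I' J' \<eta> A \<xi>)
        \<le> C * fin_norm I' \<eta> * fin_norm J' \<xi>"
    using assms[OF *] by blast
  let ?e = "\<lambda>i. if i \<in> I then \<eta> i else 0" and ?x = "\<lambda>j. if j \<in> J then \<xi> j else 0"
  have 1: "bilin I' J' ?e A ?x = bilin I J \<eta> A \<xi>"
  proof -
    have "bilin I' J' ?e A ?x = bilin I J' ?e A ?x"
      by (rule sum.mono_neutral_right) (use I' in auto)
    also have "\<dots> = bilin I J ?e A ?x"
      by (intro sum.cong refl sum.mono_neutral_right) (use I' in auto)
    finally show ?thesis by simp
  qed
  have 2: "fin_norm I' ?e = fin_norm I \<eta>"
    unfolding L2_set_def by (rule arg_cong[where f = sqrt], rule sum.mono_neutral_cong_right) (use I' in auto)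
  have 3: "fin_norm J' ?x = fin_norm J \<xi>"
    unfolding L2_set_def by (rule arg_cong[where f = sqrt], rule sum.mono_neutral_cong_right) (use I' in auto)
  show "cmod (bilin I J \<eta> A \<xi>)
        \<le> C * fin_norm I \<eta> * fin_norm J \<xi>"
    using b[of ?e ?x] unfolding 1 2 3 .
qed

lemma form_bound_transpose: "form_bound (\<lambda>j i. A i j) C \<longleftrightarrow> form_bound A C"
proof -
  have "form_bound (\<lambda>j i. A i j) C" if "form_bound A C" for A :: "'x \<Rightarrow> 'y \<Rightarrow> complex"
    unfolding form_bound_def
  proof (intro allI impI)
    fix I :: "'y set" and J :: "'x set" and \<eta> :: "'y \<Rightarrow> complex" and \<xi> :: "'x \<Rightarrow> complex" assume *: "finite I" "finite J"
    have "(\<Sum>i\<in>I. \<Sum>j\<in>J. \<eta> i * A j i * \<xi> j) = bilin J I \<xi> A \<eta>"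
      by (subst sum.swap) (simp add: mult_ac)
    then show "cmod (\<Sum>i\<in>I. \<Sum>j\<in>J. \<eta> i * A j i * \<xi> j)
        \<le> C * fin_norm I \<eta> * fin_norm J \<xi>"
      using form_boundD[OF that *(2,1), of \<xi> \<eta>] by (simp add: mult_ac)
  qed
  from this[of A] this[of "\<lambda>j i. A i j"] show ?thesis by auto
qed

lemma form_boundI_local:
  assumes "\<And>I J. finite I \<Longrightarrow> finite J \<Longrightarrow> \<exists>A'. form_bound A' C \<and> (\<forall>i\<in>I. \<forall>j\<in>J. A' i j = A i j)"
  shows "form_bound A C"
  unfolding form_bound_def
proof (intro allI impI)
  fix I :: "'a set" and J :: "'b set" and \<eta> :: "'a \<Rightarrow> complex" and \<xi> :: "'b \<Rightarrow> complex" assume *: "finite I" "finite J"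
  obtain A' where A': "form_bound A' C" "\<And>i j. i \<in> I \<Longrightarrow> j \<in> J \<Longrightarrow> A' i j = A i j" using assms[OF *] by blast
  have "bilin I J \<eta> A \<xi> = bilin I J \<eta> A' \<xi>"
    by (intro sum.cong refl) (simp add: A')
  then show "cmod (bilin I J \<eta> A \<xi>)
        \<le> C * fin_norm I \<eta> * fin_norm J \<xi>"
    using form_boundD[OF A'(1) *] by simp
qed

text \<open>The reindexing needs to be injective only on the rows \<open>P\<close> and columns \<open>Q\<close> that are kept. This
  moves bounds from a matrix to a block inside a larger matrix and back.\<close>

lemma form_bound_reindex_on:
  fixes f :: "'a \<Rightarrow> 'i" and g :: "'b \<Rightarrow> 'j"
  assumes "form_bound A C" "inj_on f {i. P i}" "inj_on g {j. Q j}"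
  shows "form_bound (\<lambda>i j. if P i \<and> Q j then A (f i) (g j) else 0) C"
  unfolding form_bound_def
proof (intro allI impI)
  fix I :: "'a set" and J :: "'b set" and \<eta> :: "'a \<Rightarrow> complex" and \<xi> :: "'b \<Rightarrow> complex" assume *: "finite I" "finite J"
  let ?I = "{i \<in> I. P i}" and ?J = "{j \<in> J. Q j}"
  let ?e = "\<lambda>i. \<eta> (inv_into ?I f i)" and ?x = "\<lambda>j. \<xi> (inv_into ?J g j)"
  have f: "inj_on f ?I" and g: "inj_on g ?J" using assms by (auto intro: inj_on_subset)
  have "(\<Sum>i\<in>I. \<Sum>j\<in>J. \<eta> i * (if P i \<and> Q j then A (f i) (g j) else 0) * \<xi> j)
     = (\<Sum>i\<in>?I. \<Sum>j\<in>J. \<eta> i * (if P i \<and> Q j then A (f i) (g j) else 0) * \<xi> j)"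
    by (rule sum.mono_neutral_right) (use * in auto)
  also have "\<dots> = (\<Sum>i\<in>?I. \<Sum>j\<in>?J. \<eta> i * A (f i) (g j) * \<xi> j)"
    by (intro sum.cong refl sum.mono_neutral_cong_right) (use * in auto)
  also have "\<dots> = (\<Sum>i\<in>f ` ?I. \<Sum>j\<in>g ` ?J. ?e i * A i j * ?x j)"
    by (simp add: sum.reindex f g inv_into_f_f)
  finally have "cmod (\<Sum>i\<in>I. \<Sum>j\<in>J. \<eta> i * (if P i \<and> Q j then A (f i) (g j) else 0) * \<xi> j)
     = cmod (\<Sum>i\<in>f ` ?I. \<Sum>j\<in>g ` ?J. ?e i * A i j * ?x j)" by (rule arg_cong)
  also have "\<dots> \<le> C * fin_norm (f ` ?I) ?e * fin_norm (g ` ?J) ?x"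
    by (rule form_boundD[OF assms(1)]) (use * in auto)
  also have "\<dots> = C * (fin_norm ?I \<eta> * fin_norm ?J \<xi>)"
    by (simp add: sum.reindex f g inv_into_f_f L2_set_def)
  also have "\<dots> \<le> C * (fin_norm I \<eta> * fin_norm J \<xi>)"
    unfolding L2_set_def
    by (intro mult_left_mono mult_mono real_sqrt_le_mono sum_mono2 form_bound_nonneg[OF assms(1)] real_sqrt_ge_zero sum_nonneg)
      (use * in auto)
  finally show "cmod (\<Sum>i\<in>I. \<Sum>j\<in>J. \<eta> i * (if P i \<and> Q j then A (f i) (g j) else 0) * \<xi> j)
        \<le> C * fin_norm I \<eta> * fin_norm J \<xi>" by (simp add: mult.assoc)
qed

lemma form_bound_reindex:
  assumes "form_bound A C" "inj f" "inj g"
  shows "form_bound (\<lambda>i j. A (f i) (g j)) C"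
  using form_bound_reindex_on[of A C f "\<lambda>_. True" g "\<lambda>_. True"] assms by simp

lemma form_bound_restrict:
  assumes "form_bound A C"
  shows "form_bound (\<lambda>i j. if P i \<and> Q j then A i j else 0) C"
  using form_bound_reindex_on[OF assms, of id P id Q] by (simp cong: if_cong)

lemma form_bound_cnj:
  fixes A :: "'a \<Rightarrow> 'b \<Rightarrow> complex"
  assumes "form_bound A C" shows "form_bound (\<lambda>i j. cnj (A i j)) C"
  unfolding form_bound_def
proof (intro allI impI)
  fix I :: "'a set" and J :: "'b set" and \<eta> :: "'a \<Rightarrow> complex" and \<xi> :: "'b \<Rightarrow> complex" assume *: "finite I" "finite J"
  have "(\<Sum>i\<in>I. \<Sum>j\<in>J. \<eta> i * cnj (A i j) * \<xi> j) = cnj (\<Sum>i\<in>I. \<Sum>j\<in>J. cnj (\<eta> i) * A i j * cnj (\<xi> j))"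
    by simp
  then show "cmod (\<Sum>i\<in>I. \<Sum>j\<in>J. \<eta> i * cnj (A i j) * \<xi> j)
        \<le> C * fin_norm I \<eta> * fin_norm J \<xi>"
    using form_boundD[OF assms *, of "\<lambda>i. cnj (\<eta> i)" "\<lambda>j. cnj (\<xi> j)"] by (simp only: complex_mod_cnj)
qed

text \<open>Test the form against the conjugate of the image vector.\<close>

lemma form_bound_apply:
  assumes "form_bound A C" "finite I" "finite J"
  shows "L2_set (\<lambda>i. cmod (\<Sum>j\<in>J. A i j * \<xi> j)) I \<le> C * fin_norm J \<xi>"
proof -
  let ?w = "\<lambda>i. \<Sum>j\<in>J. A i j * \<xi> j"
  let ?L = "fin_norm I ?w"
  have "(\<Sum>i\<in>I. \<Sum>j\<in>J. cnj (?w i) * A i j * \<xi> j) = (\<Sum>i\<in>I. cnj (?w i) * ?w i)"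
    by (simp add: sum_distrib_left mult.assoc)
  also have "\<dots> = complex_of_real (?L\<^sup>2)"
    by (simp add: L2_set_def sum_nonneg complex_norm_square mult.commute del: of_real_power)
  finally have "?L\<^sup>2 \<le> C * ?L * fin_norm J \<xi>"
    using form_boundD[OF assms, of "\<lambda>i. cnj (?w i)" \<xi>]
    by (simp only: norm_of_real abs_power2 complex_mod_cnj)
  then have "?L * ?L \<le> ?L * (C * fin_norm J \<xi>)"
    by (simp add: power2_eq_square mult_ac)
  moreover have "0 \<le> ?L" "0 \<le> C * fin_norm J \<xi>"
    using form_bound_nonneg[OF assms(1)] by (auto simp: L2_set_nonneg)
  ultimately show ?thesis by (cases "?L = 0") auto
qed

lemma cmod_sum_mult_le_L2:
  "cmod (\<Sum>i\<in>I. \<eta> i * w i) \<le> fin_norm I \<eta> * fin_norm I w"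
proof -
  have "cmod (\<Sum>i\<in>I. \<eta> i * w i) \<le> (\<Sum>i\<in>I. \<bar>cmod (\<eta> i)\<bar> * \<bar>cmod (w i)\<bar>)"
    by (rule order_trans[OF norm_sum]) (simp add: norm_mult)
  then show ?thesis by (rule order_trans[OF _ L2_set_mult_ineq])
qed

lemma form_boundI_apply:
  assumes "\<And>I J \<xi>. finite I \<Longrightarrow> finite J \<Longrightarrow>
     L2_set (\<lambda>i. cmod (\<Sum>j\<in>J. A i j * \<xi> j)) I \<le> C * fin_norm J \<xi>"
  shows "form_bound A C"
  unfolding form_bound_def
proof (intro allI impI)
  fix I :: "'a set" and J :: "'b set" and \<eta> :: "'a \<Rightarrow> complex" and \<xi> :: "'b \<Rightarrow> complex" assume *: "finite I" "finite J"
  have "cmod (bilin I J \<eta> A \<xi>) = cmod (\<Sum>i\<in>I. \<eta> i * (\<Sum>j\<in>J. A i j * \<xi> j))"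
    by (simp add: sum_distrib_left mult.assoc)
  also have "\<dots> \<le> fin_norm I \<eta> * (C * fin_norm J \<xi>)"
    by (rule order_trans[OF cmod_sum_mult_le_L2]) (intro mult_left_mono assms * L2_set_nonneg)
  finally show "cmod (bilin I J \<eta> A \<xi>)
        \<le> C * fin_norm I \<eta> * fin_norm J \<xi>" by (simp add: mult_ac)
qed

lemma form_bound_compose:
  fixes A :: "'a \<Rightarrow> 'b \<Rightarrow> complex" and B :: "'b \<Rightarrow> 'c \<Rightarrow> complex"
  assumes "form_bound A C" "form_bound B D" "finite R"
  shows "form_bound (\<lambda>i j. \<Sum>r\<in>R. A i r * B r j) (C * D)"
proof (rule form_boundI_apply)
  fix I :: "'a set" and J :: "'c set" and \<xi> :: "'c \<Rightarrow> complex" assume *: "finite I" "finite J"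
  have "(\<Sum>j\<in>J. (\<Sum>r\<in>R. A i r * B r j) * \<xi> j) = (\<Sum>r\<in>R. A i r * (\<Sum>j\<in>J. B r j * \<xi> j))" for i
    by (simp only: sum_distrib_left sum_distrib_right mult.assoc) (rule sum.swap)
  then have "L2_set (\<lambda>i. cmod (\<Sum>j\<in>J. (\<Sum>r\<in>R. A i r * B r j) * \<xi> j)) I
     \<le> C * L2_set (\<lambda>r. cmod (\<Sum>j\<in>J. B r j * \<xi> j)) R"
    using form_bound_apply[OF assms(1) *(1) assms(3)] by simp
  also have "\<dots> \<le> C * (D * fin_norm J \<xi>)"
    by (intro mult_left_mono form_bound_apply assms * form_bound_nonneg[OF assms(1)])
  finally show "L2_set (\<lambda>i. cmod (\<Sum>j\<in>J. (\<Sum>r\<in>R. A i r * B r j) * \<xi> j)) I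
     \<le> C * D * fin_norm J \<xi>" by (simp add: mult.assoc)
qed

lemma form_bound_unit: "form_bound (\<lambda>i j. if i = i0 \<and> j = j0 then c else 0) (cmod c)"
proof (rule form_boundI_cofinal, intro exI conjI allI)
  fix I :: "'a set" and J :: "'b set" and \<eta> :: "'a \<Rightarrow> complex" and \<xi> :: "'b \<Rightarrow> complex" assume *: "finite I" "finite J"
  let ?I = "insert i0 I" and ?J = "insert j0 J"
  show "finite ?I" "finite ?J" "I \<subseteq> ?I" "J \<subseteq> ?J" using * by auto
  have "(\<Sum>i\<in>?I. \<Sum>j\<in>?J. \<eta> i * (if i = i0 \<and> j = j0 then c else 0) * \<xi> j)
     = (\<Sum>i\<in>?I. if i = i0 then (\<Sum>j\<in>?J. if j = j0 then \<eta> i0 * c * \<xi> j0 else 0) else 0)"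
    by (intro sum.cong refl) (auto intro!: sum.cong sum.neutral)
  also have "\<dots> = \<eta> i0 * c * \<xi> j0" using * by (simp add: sum.delta del: sum.insert)
  finally have "cmod (\<Sum>i\<in>?I. \<Sum>j\<in>?J. \<eta> i * (if i = i0 \<and> j = j0 then c else 0) * \<xi> j)
    = cmod c * (cmod (\<eta> i0) * cmod (\<xi> j0))" by (simp only: norm_mult mult_ac)
  also have "\<dots> \<le> cmod c * (fin_norm ?I \<eta> * fin_norm ?J \<xi>)"
    by (intro mult_left_mono mult_mono member_le_L2_set L2_set_nonneg) (use * in auto)
  finally show "cmod (\<Sum>i\<in>?I. \<Sum>j\<in>?J. \<eta> i * (if i = i0 \<and> j = j0 then c else 0) * \<xi> j)
    \<le> cmod c * fin_norm ?I \<eta> * fin_norm ?J \<xi>"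
    by (simp add: mult.assoc)
qed

lemma L2_set_Times:
  "L2_set f (K \<times> R) = L2_set (\<lambda>k. L2_set (\<lambda>r. f (k, r)) R) K"
  by (simp add: L2_set_def sum_nonneg sum.cartesian_product case_prod_beta)

text \<open>
  The matrix is \<open>1 \<otimes> U\<close>: its form is a sum of forms of \<open>U\<close>, one for each \<open>k\<close>, and these are put
  together by the Cauchy-Schwarz inequality in \<open>k\<close>.
\<close>

lemma form_bound_amplify:
  fixes U :: "'i \<Rightarrow> 'j \<Rightarrow> complex"
  assumes "form_bound U D"
  shows "form_bound (\<lambda>(k :: 'k, r) (k', q). if k = k' then U r q else 0) D"
proof (rule form_boundI_cofinal, intro exI conjI allI)
  fix I :: "('k \<times> 'i) set" and J :: "('k \<times> 'j) set" and \<eta> :: "'k \<times> 'i \<Rightarrow> complex" and \<xi> :: "'k \<times> 'j \<Rightarrow> complex" assume *: "finite I" "finite J"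
  let ?K = "fst ` I \<union> fst ` J"
  let ?I = "?K \<times> snd ` I" and ?J = "?K \<times> snd ` J"
  let ?e = "\<lambda>k. L2_set (\<lambda>r. cmod (\<eta> (k, r))) (snd ` I)"
  let ?x = "\<lambda>k. L2_set (\<lambda>r. cmod (\<xi> (k, r))) (snd ` J)"
  show fin: "finite ?I" "finite ?J" using * by auto
  show "I \<subseteq> ?I" "J \<subseteq> ?J" by force+
  have "(\<Sum>i\<in>?I. \<Sum>j\<in>?J. \<eta> i * (case i of (k, r) \<Rightarrow> \<lambda>(k', q). if k = k' then U r q else 0) j * \<xi> j)
    = (\<Sum>k\<in>?K. \<Sum>r\<in>snd ` I. \<Sum>k'\<in>?K. \<Sum>q\<in>snd ` J. if k' = k then \<eta> (k, r) * U r q * \<xi> (k, q) else 0)"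
    unfolding sum.cartesian_product' prod.case by (intro sum.cong refl) auto
  also have "\<dots> = (\<Sum>k\<in>?K. \<Sum>r\<in>snd ` I. \<Sum>k'\<in>?K. if k' = k then (\<Sum>q\<in>snd ` J. \<eta> (k, r) * U r q * \<xi> (k, q)) else 0)"
    by (intro sum.cong refl) auto
  also have "\<dots> = (\<Sum>k\<in>?K. \<Sum>r\<in>snd ` I. \<Sum>q\<in>snd ` J. \<eta> (k, r) * U r q * \<xi> (k, q))"
    by (intro sum.cong refl) (use * in simp)
  finally have "cmod (\<Sum>i\<in>?I. \<Sum>j\<in>?J. \<eta> i * (case i of (k, r) \<Rightarrow> \<lambda>(k', q). if k = k' then U r q else 0) j * \<xi> j)
    \<le> (\<Sum>k\<in>?K. cmod (\<Sum>r\<in>snd ` I. \<Sum>q\<in>snd ` J. \<eta> (k, r) * U r q * \<xi> (k, q)))"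
    by (simp only: norm_sum)
  also have "\<dots> \<le> (\<Sum>k\<in>?K. D * ?e k * ?x k)"
    by (intro sum_mono form_boundD[OF assms]) (use * in auto)
  also have "\<dots> = D * (\<Sum>k\<in>?K. \<bar>?e k\<bar> * \<bar>?x k\<bar>)"
    by (simp add: sum_distrib_left L2_set_nonneg mult.assoc)
  also have "\<dots> \<le> D * (L2_set ?e ?K * L2_set ?x ?K)"
    by (intro mult_left_mono L2_set_mult_ineq form_bound_nonneg[OF assms])
  finally show "cmod (\<Sum>i\<in>?I. \<Sum>j\<in>?J. \<eta> i * (case i of (k, r) \<Rightarrow> \<lambda>(k', q). if k = k' then U r q else 0) j * \<xi> j)
     \<le> D * fin_norm ?I \<eta> * fin_norm ?J \<xi>"
    by (simp add: L2_set_Times mult.assoc)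
qed

lemma form_bound_limit:
  fixes B :: "'a \<Rightarrow> 'b \<Rightarrow> complex"
  assumes "F \<noteq> bot" "\<And>i j. ((\<lambda>m. A m i j) \<longlongrightarrow> B i j) F"
    and "(C \<longlongrightarrow> D) F" "eventually (\<lambda>m. form_bound (A m) (C m)) F"
  shows "form_bound B D"
  unfolding form_bound_def
proof (intro allI impI)
  fix I :: "'a set" and J :: "'b set" and \<eta> :: "'a \<Rightarrow> complex" and \<xi> :: "'b \<Rightarrow> complex" assume *: "finite I" "finite J"
  show "cmod (bilin I J \<eta> B \<xi>)
     \<le> D * fin_norm I \<eta> * fin_norm J \<xi>"
  proof (rule tendsto_le[OF assms(1)])
    show "((\<lambda>m. C m * fin_norm I \<eta> * fin_norm J \<xi>)
       \<longlongrightarrow> D * fin_norm I \<eta> * fin_norm J \<xi>) F"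
      by (intro tendsto_intros assms)
    show "((\<lambda>m. cmod (\<Sum>i\<in>I. \<Sum>j\<in>J. \<eta> i * A m i j * \<xi> j)) \<longlongrightarrow> cmod (bilin I J \<eta> B \<xi>)) F"
      by (intro tendsto_intros assms)
    show "\<forall>\<^sub>F m in F. cmod (\<Sum>i\<in>I. \<Sum>j\<in>J. \<eta> i * A m i j * \<xi> j)
       \<le> C m * fin_norm I \<eta> * fin_norm J \<xi>"
      using assms(4) by eventually_elim (rule form_boundD[OF _ *])
  qed
qed

lemma form_bound_finite_entries:
  assumes "finite I" "finite J" "\<And>i j. cmod (A i j) \<le> c"
    and "\<And>i j. i \<notin> I \<or> j \<notin> J \<Longrightarrow> A i j = 0"
  shows "form_bound A (of_nat (card I) * of_nat (card J) * c)"
proof -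
  have eq: "A = (\<lambda>i j. \<Sum>s\<in>I\<times>J. if i = fst s \<and> j = snd s then A (fst s) (snd s) else 0)"
  proof (intro ext)
    fix i j
    have "(\<Sum>s\<in>I\<times>J. if i = fst s \<and> j = snd s then A (fst s) (snd s) else 0)
      = (\<Sum>s\<in>I\<times>J. if s = (i, j) then A i j else 0)"
      by (intro sum.cong refl) (auto simp: prod_eq_iff)
    also have "\<dots> = A i j" using assms by (auto simp: sum.delta)
    finally show "A i j = (\<Sum>s\<in>I\<times>J. if i = fst s \<and> j = snd s then A (fst s) (snd s) else 0)" by simp
  qed
  have "form_bound A (\<Sum>s\<in>I\<times>J. cmod (A (fst s) (snd s)))"
    by (subst eq, rule form_bound_sum[OF _ form_bound_unit]) (use assms in simp)
  moreover have "(\<Sum>s\<in>I\<times>J. cmod (A (fst s) (snd s))) \<le> (\<Sum>s\<in>I\<times>J. c)"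
    by (intro sum_mono assms)
  ultimately show ?thesis by (auto intro: form_bound_mono simp: card_cartesian_product)
qed

section \<open>Orthonormal systems, operator norms and compactness\<close>

lemma L2_set_cmod_sq: "complex_of_real ((fin_norm K w)\<^sup>2) = (\<Sum>k\<in>K. w k * cnj (w k))"
  by (simp add: L2_set_def sum_nonneg complex_norm_square del: of_real_power)

text \<open>The vectors \<open>u r\<close> are orthogonal, each of norm one or zero. Both expansions are used: the first
  factors \<open>v\<close> through \<open>u\<close>, the second keeps the entries of a product with \<open>u\<close> in any subspace that
  contains those of the product with \<open>v\<close>.
  A zero vector appears whenever a vector \<open>v j\<close> depends linearly on its predecessors.\<close>

lemma finite_gram_schmidt:
  fixes v :: "nat \<Rightarrow> 'k \<Rightarrow> complex"
  assumes "finite K"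
  shows "\<exists>u e. (\<forall>r<N. \<forall>s<N. r \<noteq> s \<longrightarrow> (\<Sum>k\<in>K. u r k * cnj (u s k)) = 0) \<and>
     (\<forall>r<N. (\<Sum>k\<in>K. u r k * cnj (u r k)) = 1 \<or> (\<forall>k\<in>K. u r k = 0)) \<and>
     (\<forall>j<N. \<forall>k\<in>K. v j k = (\<Sum>r<N. (\<Sum>l\<in>K. v j l * cnj (u r l)) * u r k)) \<and>
     (\<forall>r<N. \<forall>k\<in>K. u r k = (\<Sum>j<N. e r j * v j k))"
proof (induction N)
  case 0
  show ?case by simp
next
  case (Suc N)
  define ip where "ip x y = (\<Sum>k\<in>K. x k * cnj (y k))" for x y :: "'k \<Rightarrow> complex"
  from Suc.IH[folded ip_def] obtain u e where
    H: "(\<forall>r<N. \<forall>s<N. r \<noteq> s \<longrightarrow> ip (u r) (u s) = 0) \<and>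
      (\<forall>r<N. ip (u r) (u r) = 1 \<or> (\<forall>k\<in>K. u r k = 0)) \<and>
      (\<forall>j<N. \<forall>k\<in>K. v j k = (\<Sum>r<N. ip (v j) (u r) * u r k)) \<and>
      (\<forall>r<N. \<forall>k\<in>K. u r k = (\<Sum>j<N. e r j * v j k))"
    by (elim exE) (rule that)
  have orth: "\<And>r s. r < N \<Longrightarrow> s < N \<Longrightarrow> r \<noteq> s \<Longrightarrow> ip (u r) (u s) = 0"
    using H[THEN conjunct1] by blast
  have unit: "\<And>r. r < N \<Longrightarrow> ip (u r) (u r) = 1 \<or> (\<forall>k\<in>K. u r k = 0)"
    using H[THEN conjunct2, THEN conjunct1] by blast
  have vu: "\<And>j k. j < N \<Longrightarrow> k \<in> K \<Longrightarrow> v j k = (\<Sum>r<N. ip (v j) (u r) * u r k)"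
    using H[THEN conjunct2, THEN conjunct2, THEN conjunct1] by blast
  have ue: "\<And>r k. r < N \<Longrightarrow> k \<in> K \<Longrightarrow> u r k = (\<Sum>j<N. e r j * v j k)"
    using H[THEN conjunct2, THEN conjunct2, THEN conjunct2] by blast
  have ip_cong: "ip x y = ip x' y'" if "\<And>k. k \<in> K \<Longrightarrow> x k = x' k" "\<And>k. k \<in> K \<Longrightarrow> y k = y' k" for x y x' y'
    unfolding ip_def using that by (intro sum.cong) auto
  have ip_sum: "ip (\<lambda>k. \<Sum>r<N. c r * x r k) y = (\<Sum>r<N. c r * ip (x r) y)" for c x y
    unfolding ip_def sum_distrib_left sum_distrib_right
    by (subst sum.swap) (simp add: mult.assoc)
  have ip_diff: "ip (\<lambda>k. x k - y k) z = ip x z - ip y z" for x y z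
    by (simp add: ip_def algebra_simps sum_subtractf)
  have ip_add: "ip (\<lambda>k. x k + y k) z = ip x z + ip y z" for x y z
    by (simp add: ip_def algebra_simps sum.distrib)
  have ip_div: "ip x (\<lambda>k. y k / complex_of_real t) = ip x y / complex_of_real t" for x y t
    by (simp add: ip_def sum_divide_distrib)
  have ip_div': "ip (\<lambda>k. x k / complex_of_real t) y = ip x y / complex_of_real t" for x y t
    by (simp add: ip_def sum_divide_distrib)
  have ip_cnj: "ip x y = cnj (ip y x)" for x y
    by (simp add: ip_def mult.commute)
  define c where "c r = ip (v N) (u r)" for r
  define p where "p k = (\<Sum>r<N. c r * u r k)" for k
  define w where "w k = v N k - p k" for k
  define \<sigma> where "\<sigma> = fin_norm K w"
  \<comment> \<open>If \<open>w\<close> vanishes, division by zero makes the new vector zero, as it should be.\<close>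
  define u' where "u' = u(N := (\<lambda>k. w k / complex_of_real \<sigma>))"
  define e' where "e' = e(N := (\<lambda>j. (if j = N then 1 else - (\<Sum>r<N. c r * e r j)) / complex_of_real \<sigma>))"
  define e'' where "e'' r j = (if r < N \<and> j = N then 0 else e' r j)" for r j
  have u'_less: "u' r = u r" if "r < N" for r using that by (simp add: u'_def)
  have u'_N: "u' N = (\<lambda>k. w k / complex_of_real \<sigma>)" by (simp add: u'_def)
  have ip_p: "ip p (u s) = c s" if "s < N" for s
  proof -
    have "ip p (u s) = (\<Sum>r<N. c r * ip (u r) (u s))"
      unfolding p_def by (rule ip_sum)
    also have "\<dots> = (\<Sum>r<N. if r = s then c s * ip (u s) (u s) else 0)"
      by (intro sum.cong refl) (use orth that in auto)
    also have "\<dots> = c s * ip (u s) (u s)" using that by (simp add: sum.delta)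
    also have "\<dots> = c s"
      using unit[OF that] by (auto simp: c_def ip_def)
    finally show ?thesis .
  qed
  have w_orth: "ip w (u s) = 0" if "s < N" for s
    unfolding w_def by (subst ip_diff) (simp add: ip_p that c_def)
  have ww: "ip w w = complex_of_real (\<sigma>\<^sup>2)"
    unfolding ip_def \<sigma>_def by (rule L2_set_cmod_sq[symmetric])
  have \<sigma>0: "w k = 0" if "\<sigma> = 0" "k \<in> K" for k
    using that assms by (auto simp: \<sigma>_def L2_set_eq_0_iff)
  have new_orth: "ip (u' N) (u s) = 0" "ip (u s) (u' N) = 0" if "s < N" for s
  proof -
    show 1: "ip (u' N) (u s) = 0" unfolding u'_N ip_div' by (simp add: w_orth that)
    show "ip (u s) (u' N) = 0" by (subst ip_cnj) (simp add: 1)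
  qed
  have orth': "ip (u' r) (u' s) = 0" if "r < Suc N" "s < Suc N" "r \<noteq> s" for r s
    using that orth new_orth by (auto simp: less_Suc_eq u'_less)
  have unit': "ip (u' r) (u' r) = 1 \<or> (\<forall>k\<in>K. u' r k = 0)" if "r < Suc N" for r
  proof (cases "r < N")
    case True then show ?thesis using unit by (simp add: u'_less)
  next
    case False
    with that have r: "r = N" by simp
    show ?thesis
    proof (cases "\<sigma> = 0")
      case False
      then show ?thesis unfolding r u'_N ip_div ip_div' ww by (simp add: power2_eq_square)
    qed (simp add: r u'_N)
  qed
  have ip_p0: "ip p (u' N) = 0"
    unfolding p_def ip_sum using new_orth by simp
  have vN: "ip (v N) (u' N) * u' N k = w k" if "k \<in> K" for k
  proof -
    have "ip (v N) (u' N) = ip (\<lambda>k. w k + p k) (u' N)" by (simp add: w_def)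
    also have "\<dots> = ip w (u' N)" by (simp add: ip_add ip_p0)
    also have "\<dots> = complex_of_real (\<sigma>\<^sup>2) / complex_of_real \<sigma>" unfolding u'_N ip_div ww ..
    finally show ?thesis using \<sigma>0 that by (cases "\<sigma> = 0") (auto simp: u'_N power2_eq_square)
  qed
  have vu': "v j k = (\<Sum>r<Suc N. ip (v j) (u' r) * u' r k)" if "j < Suc N" "k \<in> K" for j k
  proof (cases "j < N")
    case True
    have "ip (v j) (u' N) = ip (\<lambda>k. \<Sum>r<N. ip (v j) (u r) * u r k) (u' N)"
      using vu[OF True] by (intro ip_cong) auto
    also have "\<dots> = 0" unfolding ip_sum using new_orth by simp
    finally show ?thesis using vu[OF True that(2)] by (simp add: u'_less)
  next
    case False
    then have "j = N" using that by simp
    then show ?thesis using vN[OF that(2)] by (simp add: u'_less c_def[symmetric] p_def[symmetric]) (simp add: w_def)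
  qed
  have ue': "u' r k = (\<Sum>j<Suc N. e'' r j * v j k)" if "r < Suc N" "k \<in> K" for r k
  proof (cases "r < N")
    case True
    then show ?thesis using ue[OF True that(2)] by (simp add: u'_less e''_def e'_def)
  next
    case False
    then have r: "r = N" using that by simp
    have "p k = (\<Sum>r<N. c r * (\<Sum>j<N. e r j * v j k))" unfolding p_def using ue that by simp
    also have "\<dots> = (\<Sum>j<N. (\<Sum>r<N. c r * e r j) * v j k)"
      unfolding sum_distrib_left sum_distrib_right by (subst sum.swap) (simp add: mult.assoc)
    finally show ?thesis
      by (simp add: r u'_N w_def e''_def e'_def sum_negf diff_divide_distrib add_divide_distrib
          flip: sum_divide_distrib)
  qed
  show ?case
    unfolding ip_def[symmetric]
  proof (intro exI conjI allI ballI impI)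
    fix r s assume "r < Suc N" "s < Suc N" "r \<noteq> s"
    then show "ip (u' r) (u' s) = 0" by (rule orth')
  next
    fix r assume "r < Suc N"
    then show "ip (u' r) (u' r) = 1 \<or> (\<forall>k\<in>K. u' r k = 0)" by (rule unit')
  next
    fix j k assume "j < Suc N" "k \<in> K"
    then show "v j k = (\<Sum>r<Suc N. ip (v j) (u' r) * u' r k)" by (rule vu')
  next
    fix r k assume "r < Suc N" "k \<in> K"
    then show "u' r k = (\<Sum>j<Suc N. e'' r j * v j k)" by (rule ue')
  qed
qed

text \<open>
  Bessel's inequality, in the form that the map sending the standard basis to the system \<open>u\<close> is a
  contraction.
\<close>

lemma form_bound_orthonormal:
  fixes u :: "nat \<Rightarrow> 'k \<Rightarrow> complex"
  assumes "finite K"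
    and orth: "\<And>r s. r < N \<Longrightarrow> s < N \<Longrightarrow> r \<noteq> s \<Longrightarrow> (\<Sum>k\<in>K. u r k * cnj (u s k)) = 0"
    and unit: "\<And>r. r < N \<Longrightarrow> (\<Sum>k\<in>K. u r k * cnj (u r k)) = 1 \<or> (\<forall>k\<in>K. u r k = 0)"
  shows "form_bound (\<lambda>r k. if r < N \<and> k \<in> K then u r k else 0) 1"
proof -
  have key: "L2_set (\<lambda>k. cmod (\<Sum>r<N. u r k * \<xi> r)) K \<le> fin_norm {..<N} \<xi>" for \<xi>
  proof -
    have "complex_of_real ((L2_set (\<lambda>k. cmod (\<Sum>r<N. u r k * \<xi> r)) K)\<^sup>2)
       = (\<Sum>k\<in>K. \<Sum>r<N. \<Sum>s<N. u r k * \<xi> r * (cnj (u s k) * cnj (\<xi> s)))"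
      unfolding L2_set_cmod_sq by (simp add: sum_product)
    also have "\<dots> = (\<Sum>r<N. \<Sum>s<N. \<Sum>k\<in>K. u r k * \<xi> r * (cnj (u s k) * cnj (\<xi> s)))"
      by (subst sum.swap, intro sum.cong refl, subst sum.swap, rule refl)
    also have "\<dots> = (\<Sum>r<N. \<Sum>s<N. \<xi> r * cnj (\<xi> s) * (\<Sum>k\<in>K. u r k * cnj (u s k)))"
      by (simp add: sum_distrib_left mult_ac)
    also have "\<dots> = (\<Sum>r<N. \<Sum>s<N. if s = r then \<xi> r * cnj (\<xi> r) * (\<Sum>k\<in>K. u r k * cnj (u r k)) else 0)"
      by (intro sum.cong refl) (use orth in auto)
    also have "\<dots> = (\<Sum>r<N. \<xi> r * cnj (\<xi> r) * (\<Sum>k\<in>K. u r k * cnj (u r k)))"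
      by (intro sum.cong refl) (simp add: sum.delta)
    finally have eq: "complex_of_real ((L2_set (\<lambda>k. cmod (\<Sum>r<N. u r k * \<xi> r)) K)\<^sup>2)
      = (\<Sum>r<N. \<xi> r * cnj (\<xi> r) * (\<Sum>k\<in>K. u r k * cnj (u r k)))" .
    have "(L2_set (\<lambda>k. cmod (\<Sum>r<N. u r k * \<xi> r)) K)\<^sup>2
       = (\<Sum>r<N. Re (\<xi> r * cnj (\<xi> r) * (\<Sum>k\<in>K. u r k * cnj (u r k))))"
      using arg_cong[OF eq, of Re] by (simp only: Re_complex_of_real Re_sum)
    also have "\<dots> \<le> (\<Sum>r<N. (cmod (\<xi> r))\<^sup>2)"
    proof (rule sum_mono)
      fix r assume "r \<in> {..<N}"
      then consider "(\<Sum>k\<in>K. u r k * cnj (u r k)) = 1" | "(\<Sum>k\<in>K. u r k * cnj (u r k)) = 0"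
        using unit[of r] by force
      then show "Re (\<xi> r * cnj (\<xi> r) * (\<Sum>k\<in>K. u r k * cnj (u r k))) \<le> (cmod (\<xi> r))\<^sup>2"
        by cases (simp_all add: cmod_power2 flip: power2_eq_square)
    qed
    finally show ?thesis
      unfolding L2_set_def[of "\<lambda>r. cmod (\<xi> r)"] by (rule real_le_rsqrt)
  qed
  have "form_bound (\<lambda>k r. if r < N \<and> k \<in> K then u r k else 0) 1"
  proof (rule form_boundI_cofinal, intro exI conjI allI)
    fix I :: "'k set" and J :: "nat set" and \<eta> :: "'k \<Rightarrow> complex" and \<xi> :: "nat \<Rightarrow> complex" assume *: "finite I" "finite J"
    let ?I = "I \<union> K" and ?J = "J \<union> {..<N}"
    show fin: "finite ?I" "finite ?J" using * assms by auto
    show "I \<subseteq> ?I" "J \<subseteq> ?J" by auto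
    have "(\<Sum>k\<in>?I. \<Sum>r\<in>?J. \<eta> k * (if r < N \<and> k \<in> K then u r k else 0) * \<xi> r)
      = (\<Sum>k\<in>K. \<Sum>r\<in>?J. \<eta> k * (if r < N \<and> k \<in> K then u r k else 0) * \<xi> r)"
      by (rule sum.mono_neutral_right) (use fin in auto)
    also have "\<dots> = (\<Sum>k\<in>K. \<Sum>r<N. \<eta> k * u r k * \<xi> r)"
      by (intro sum.cong refl sum.mono_neutral_cong_right) (use fin in auto)
    also have "\<dots> = (\<Sum>k\<in>K. \<eta> k * (\<Sum>r<N. u r k * \<xi> r))"
      by (simp add: sum_distrib_left mult.assoc)
    finally have "cmod (\<Sum>k\<in>?I. \<Sum>r\<in>?J. \<eta> k * (if r < N \<and> k \<in> K then u r k else 0) * \<xi> r)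
      \<le> fin_norm K \<eta> * L2_set (\<lambda>k. cmod (\<Sum>r<N. u r k * \<xi> r)) K"
      using cmod_sum_mult_le_L2 by metis
    also have "\<dots> \<le> fin_norm ?I \<eta> * fin_norm ?J \<xi>"
    proof (intro mult_mono L2_set_nonneg order_trans[OF key])
      show "fin_norm K \<eta> \<le> fin_norm ?I \<eta>"
        unfolding L2_set_def by (intro real_sqrt_le_mono sum_mono2) (use fin in auto)
      show "fin_norm {..<N} \<xi> \<le> fin_norm ?J \<xi>"
        unfolding L2_set_def by (intro real_sqrt_le_mono sum_mono2) (use fin in auto)
    qed
    finally show "cmod (\<Sum>k\<in>?I. \<Sum>r\<in>?J. \<eta> k * (if r < N \<and> k \<in> K then u r k else 0) * \<xi> r)
      \<le> 1 * fin_norm ?I \<eta> * fin_norm ?J \<xi>" by simp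
  qed
  then show ?thesis by (subst form_bound_transpose[symmetric])
qed

lemma ell2_finite_support:
  assumes "finite J" "\<And>j. j \<notin> J \<Longrightarrow> v j = 0"
  shows "v \<in> ell2" "ell2_norm v = fin_norm J v"
proof -
  have "((\<lambda>i. (cmod (v i))\<^sup>2) has_sum (\<Sum>j\<in>J. (cmod (v j))\<^sup>2)) UNIV"
    by (rule has_sum_finite_neutralI) (use assms in auto)
  then show "v \<in> ell2" "ell2_norm v = fin_norm J v"
    unfolding ell2_def ell2_norm_def L2_set_def
    by (auto simp: summable_on_def infsumI)
qed

lemma L2_set_le_ell2_norm:
  assumes "v \<in> ell2" "finite J"
  shows "fin_norm J v \<le> ell2_norm v"
  unfolding L2_set_def ell2_norm_def
  by (rule real_sqrt_le_mono, rule finite_sum_le_infsum) (use assms in \<open>auto simp: ell2_def\<close>)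

lemma ell2I_L2_set:
  assumes "\<And>J. finite J \<Longrightarrow> fin_norm J v \<le> B"
  shows "v \<in> ell2" "ell2_norm v \<le> B"
proof -
  have B: "0 \<le> B" using assms[of "{}"] by simp
  have b: "(\<Sum>j\<in>J. (cmod (v j))\<^sup>2) \<le> B\<^sup>2" if "finite J" for J
    using assms[OF that] unfolding L2_set_def by (rule sqrt_le_D)
  have s: "(\<lambda>j. (cmod (v j))\<^sup>2) summable_on UNIV"
    by (rule nonneg_bdd_above_summable_on) (auto intro!: bdd_aboveI2[where M = "B\<^sup>2"] b)
  then show "v \<in> ell2" by (simp add: ell2_def)
  have "(\<Sum>\<^sub>\<infinity>j. (cmod (v j))\<^sup>2) \<le> B\<^sup>2"
    by (rule infsum_le_finite_sums[OF s]) (use b in auto)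
  then show "ell2_norm v \<le> B"
    unfolding ell2_norm_def using B by (intro real_le_lsqrt) auto
qed

text \<open>Rows of \<open>A\<close> are square summable, so that \<open>A v\<close> exists; the estimate for \<open>A v\<close> on a finite set
  of coordinates is the limit of the estimates for the finite truncations of \<open>v\<close>.\<close>

lemma form_bound_mat_apply:
  assumes A: "form_bound A C" and v: "v \<in> ell2"
  shows "(\<lambda>j. A i j * v j) summable_on UNIV" "mat_apply A v \<in> ell2"
    "ell2_norm (mat_apply A v) \<le> C * ell2_norm v"
proof -
  have C: "0 \<le> C" by (rule form_bound_nonneg[OF A])
  have summable: "(\<lambda>j. A i j * v j) summable_on UNIV" for i
  proof -
    have "(\<Sum>j\<in>J. norm (A i j * v j)) \<le> C * ell2_norm v" if J: "finite J" for J
    proof -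
      have 1: "L2_set (\<lambda>j. cmod (A i j)) J \<le> C"
        using form_bound_apply[of "\<lambda>j i. A i j" C J "{i}" "\<lambda>_. 1"] J
          form_bound_transpose[THEN iffD2, OF A] by simp
      have "(\<Sum>j\<in>J. norm (A i j * v j)) = (\<Sum>j\<in>J. \<bar>cmod (A i j)\<bar> * \<bar>cmod (v j)\<bar>)"
        by (simp add: norm_mult)
      also have "\<dots> \<le> L2_set (\<lambda>j. cmod (A i j)) J * fin_norm J v"
        by (rule L2_set_mult_ineq)
      also have "\<dots> \<le> C * ell2_norm v"
        by (intro mult_mono 1 L2_set_le_ell2_norm v J C L2_set_nonneg)
      finally show ?thesis .
    qed
    then have "(\<lambda>j. norm (A i j * v j)) summable_on UNIV"
      by (intro nonneg_bdd_above_summable_on) (auto intro!: bdd_aboveI2[where M = "C * ell2_norm v"])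
    then show ?thesis by (rule abs_summable_summable)
  qed
  have "L2_set (\<lambda>i. cmod (mat_apply A v i)) I \<le> C * ell2_norm v" if I: "finite I" for I
  proof (rule tendsto_upperbound)
    have "((\<lambda>J. \<Sum>j\<in>J. A i j * v j) \<longlongrightarrow> mat_apply A v i) (finite_subsets_at_top UNIV)" for i
      unfolding mat_apply_def using has_sum_infsum[OF summable] by (simp add: has_sum_def)
    then show "((\<lambda>J. L2_set (\<lambda>i. cmod (\<Sum>j\<in>J. A i j * v j)) I) \<longlongrightarrow> L2_set (\<lambda>i. cmod (mat_apply A v i)) I)
       (finite_subsets_at_top UNIV)"
      unfolding L2_set_def by (intro tendsto_intros)
    have "L2_set (\<lambda>i. cmod (\<Sum>j\<in>J. A i j * v j)) I \<le> C * ell2_norm v" if J: "finite J" for J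
      using form_bound_apply[OF A I J] mult_left_mono[OF L2_set_le_ell2_norm[OF v J] C]
      by (rule order_trans)
    then show "\<forall>\<^sub>F J in finite_subsets_at_top UNIV. L2_set (\<lambda>i. cmod (\<Sum>j\<in>J. A i j * v j)) I \<le> C * ell2_norm v"
      by (auto simp: eventually_finite_subsets_at_top_weakI)
  qed simp
  from ell2I_L2_set[of "mat_apply A v", OF this]
  show "mat_apply A v \<in> ell2" "ell2_norm (mat_apply A v) \<le> C * ell2_norm v" by blast+
  show "(\<lambda>j. A i j * v j) summable_on UNIV" by (rule summable)
qed

text \<open>For the second statement it is enough that the supremum defining the norm is finite and takes the
  finitely supported vectors into account.\<close>

lemma
  fixes A :: "'a \<Rightarrow> 'b \<Rightarrow> complex"
  shows bounded_mat_iff: "bounded_mat A \<longleftrightarrow> (\<exists>C. form_bound A C)"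
  and form_bound_mat_op_norm: "bounded_mat A \<Longrightarrow> form_bound A (mat_op_norm A)"
  and mat_op_norm_le: "form_bound A C \<Longrightarrow> mat_op_norm A \<le> C"
proof -
  have ball0: "(\<lambda>_. 0) \<in> {v \<in> ell2. ell2_norm v \<le> 1}" by (simp add: ell2_def ell2_norm_def)
  show fb: "form_bound A (mat_op_norm A)" if bd: "bounded_mat A"
  proof (rule form_boundI_apply)
    fix I :: "'a set" and J :: "'b set" and \<xi> :: "'b \<Rightarrow> complex" assume *: "finite I" "finite J"
    let ?L = "fin_norm J \<xi>"
    show "L2_set (\<lambda>i. cmod (\<Sum>j\<in>J. A i j * \<xi> j)) I \<le> mat_op_norm A * ?L"
    proof (cases "?L = 0")
      case True
      then have "\<And>j. j \<in> J \<Longrightarrow> \<xi> j = 0" using * by (auto simp: L2_set_eq_0_iff)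
      then show ?thesis using True by (simp add: L2_set_def)
    next
      case False
      then have L: "?L > 0" using L2_set_nonneg[of "\<lambda>j. cmod (\<xi> j)" J] by linarith
      define v where "v j = (if j \<in> J then \<xi> j / complex_of_real ?L else 0)" for j
      have v0: "v j = 0" if "j \<notin> J" for j using that by (simp add: v_def)
      have "ell2_norm v = fin_norm J v" by (rule ell2_finite_support[OF *(2) v0])
      also have "\<dots> = L2_set (\<lambda>j. (1 / ?L) * cmod (\<xi> j)) J"
        by (rule L2_set_cong) (use L in \<open>auto simp: v_def norm_divide\<close>)
      also have "\<dots> = (1 / ?L) * ?L" by (rule L2_set_right_distrib[symmetric]) (use L in simp)
      finally have v1: "ell2_norm v = 1" using L by simp
      have v2: "v \<in> ell2" by (rule ell2_finite_support[OF *(2) v0])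
      obtain C where C: "\<And>v. v \<in> ell2 \<Longrightarrow> ell2_norm (mat_apply A v) \<le> C * ell2_norm v"
        using bd unfolding bounded_mat_def by blast
      have bdd: "bdd_above ((\<lambda>v. ell2_norm (mat_apply A v)) ` {v \<in> ell2. ell2_norm v \<le> 1})"
      proof (rule bdd_aboveI2)
        fix v :: "'b \<Rightarrow> complex" assume v: "v \<in> {v \<in> ell2. ell2_norm v \<le> 1}"
        have "C * ell2_norm v \<le> \<bar>C\<bar> * 1"
          using v by (intro mult_mono) (auto simp: ell2_norm_def infsum_nonneg)
        then show "ell2_norm (mat_apply A v) \<le> \<bar>C\<bar>" using C[of v] v by auto
      qed
      have "L2_set (\<lambda>i. cmod (mat_apply A v i)) I \<le> ell2_norm (mat_apply A v)"
        by (rule L2_set_le_ell2_norm) (use bd v2 * in \<open>auto simp: bounded_mat_def\<close>)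
      also have "\<dots> \<le> mat_op_norm A"
        unfolding mat_op_norm_def by (rule cSUP_upper[OF _ bdd]) (use v1 v2 in auto)
      finally have 1: "L2_set (\<lambda>i. cmod (mat_apply A v i)) I \<le> mat_op_norm A" .
      have "mat_apply A v i = (\<Sum>j\<in>J. A i j * \<xi> j) / complex_of_real ?L" for i
      proof -
        have "mat_apply A v i = (\<Sum>j\<in>J. A i j * v j)"
          unfolding mat_apply_def by (intro infsumI has_sum_finite_neutralI) (use * v0 in auto)
        then show ?thesis by (simp add: v_def sum_divide_distrib)
      qed
      then have "L2_set (\<lambda>i. cmod (mat_apply A v i)) I = L2_set (\<lambda>i. (1 / ?L) * cmod (\<Sum>j\<in>J. A i j * \<xi> j)) I"
        using L by (simp add: norm_divide)
      also have "\<dots> = (1 / ?L) * L2_set (\<lambda>i. cmod (\<Sum>j\<in>J. A i j * \<xi> j)) I"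
        by (rule L2_set_right_distrib[symmetric]) (use L in simp)
      finally have "L2_set (\<lambda>i. cmod (\<Sum>j\<in>J. A i j * \<xi> j)) I = ?L * L2_set (\<lambda>i. cmod (mat_apply A v i)) I"
        using L by simp
      then show ?thesis using mult_left_mono[OF 1 less_imp_le[OF L]] by (simp only: mult.commute)
    qed
  qed
  show le: "mat_op_norm A \<le> C" if A: "form_bound A C" for C
    unfolding mat_op_norm_def
  proof (rule cSUP_least)
    show "{v \<in> ell2. ell2_norm v \<le> 1} \<noteq> ({} :: ('b \<Rightarrow> complex) set)" using ball0 by blast
    fix v :: "'b \<Rightarrow> complex" assume "v \<in> {v \<in> ell2. ell2_norm v \<le> 1}"
    then have v: "v \<in> ell2" "ell2_norm v \<le> 1" by auto
    have "ell2_norm (mat_apply A v) \<le> C * ell2_norm v" "C * ell2_norm v \<le> C * 1"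
      by (intro form_bound_mat_apply[OF A] mult_left_mono form_bound_nonneg[OF A] v)+
    then show "ell2_norm (mat_apply A v) \<le> C" by simp
  qed
  show "bounded_mat A \<longleftrightarrow> (\<exists>C. form_bound A C)"
  proof
    assume "\<exists>C. form_bound A C"
    then obtain C where "form_bound A C" ..
    from form_bound_mat_apply[OF this] show "bounded_mat A"
      unfolding bounded_mat_def by (intro conjI ballI allI exI[of _ C])
  qed (use fb in blast)
qed

lemma mat_op_norm_le_iff: "bounded_mat A \<Longrightarrow> mat_op_norm A \<le> C \<longleftrightarrow> form_bound A C"
  using form_bound_mat_op_norm form_bound_mono mat_op_norm_le by blast

lemma mat_op_norm_nonneg: "bounded_mat A \<Longrightarrow> 0 \<le> mat_op_norm A"
  using form_bound_mat_op_norm form_bound_nonneg by blast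

lemma bounded_vectors_convergent_subseq:
  fixes s :: "nat \<Rightarrow> nat \<Rightarrow> complex"
  assumes "\<And>m i. i < n \<Longrightarrow> cmod (s m i) \<le> B"
  shows "\<exists>r l. strict_mono (r :: nat \<Rightarrow> nat) \<and> (\<forall>i<n. (\<lambda>m. s (r m) i) \<longlonglongrightarrow> l i)"
  using assms
proof (induction n)
  case 0
  have "strict_mono (id :: nat \<Rightarrow> nat)" by (simp add: strict_mono_def)
  then show ?case by blast
next
  case (Suc n)
  obtain r l where r: "strict_mono (r :: nat \<Rightarrow> nat)" "\<And>i. i < n \<Longrightarrow> (\<lambda>m. s (r m) i) \<longlonglongrightarrow> l i"
    using Suc.IH Suc.prems by (meson less_SucI)
  have "bounded (range (\<lambda>m. s (r m) n))" using Suc.prems by (auto simp: bounded_iff)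
  then obtain l' r' where r': "strict_mono (r' :: nat \<Rightarrow> nat)" "((\<lambda>m. s (r m) n) \<circ> r') \<longlonglongrightarrow> l'"
    using bounded_imp_convergent_subsequence by blast
  have "(\<lambda>m. s (r (r' m)) i) \<longlonglongrightarrow> (l(n := l')) i" if "i < Suc n" for i
  proof (cases "i = n")
    case True then show ?thesis using r'(2) by (simp add: o_def)
  next
    case False
    then show ?thesis using LIMSEQ_subseq_LIMSEQ[OF r(2) r'(1)] that by (simp add: o_def)
  qed
  moreover have "strict_mono (\<lambda>m. r (r' m))" using r(1) r'(1) by (simp add: strict_mono_def)
  ultimately show ?case by blast
qed

lemma tendsto_L2_set_diff_0:
  assumes "\<And>i. i \<in> I \<Longrightarrow> (\<lambda>m. f m i) \<longlonglongrightarrow> (l i :: complex)"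
  shows "(\<lambda>m. L2_set (\<lambda>i. cmod (f m i - l i)) I) \<longlonglongrightarrow> 0"
proof -
  have "(\<lambda>m. L2_set (\<lambda>i. cmod (f m i - l i)) I) \<longlonglongrightarrow> L2_set (\<lambda>i. cmod (l i - l i)) I"
    unfolding L2_set_def by (intro tendsto_intros assms)
  then show ?thesis by (simp add: L2_set_def)
qed

text \<open>The images of a bounded sequence are bounded sequences in \<open>\<complex>\<^sup>n\<close>.\<close>

lemma compact_mat_finite_rows:
  fixes A :: "nat \<Rightarrow> 'j \<Rightarrow> complex"
  assumes A: "form_bound A C" and rows: "\<And>i j. n \<le> i \<Longrightarrow> A i j = 0"
  shows "compact_mat A"
  unfolding compact_mat_def
proof (intro conjI allI impI)
  show "bounded_mat A" using A bounded_mat_iff by blast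
  fix u :: "nat \<Rightarrow> 'j \<Rightarrow> complex" assume u: "\<forall>m. u m \<in> ell2 \<and> ell2_norm (u m) \<le> 1"
  have "cmod (mat_apply A (u m) i) \<le> C" for m i
  proof -
    have "cmod (mat_apply A (u m) i) \<le> ell2_norm (mat_apply A (u m))"
      using L2_set_le_ell2_norm[OF form_bound_mat_apply(2)[OF A, of "u m"], of "{i}"] u by simp
    also have "\<dots> \<le> C * 1"
      using form_bound_mat_apply(3)[OF A, of "u m"] u mult_left_mono[OF _ form_bound_nonneg[OF A], of "ell2_norm (u m)" 1]
      by force
    finally show ?thesis by simp
  qed
  then obtain r l where r: "strict_mono (r :: nat \<Rightarrow> nat)"
    and l: "\<And>i. i < n \<Longrightarrow> (\<lambda>m. mat_apply A (u (r m)) i) \<longlonglongrightarrow> l i"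
    using bounded_vectors_convergent_subseq[of n "\<lambda>m i. mat_apply A (u m) i" C] by blast
  define w where "w i = (if i < n then l i else 0)" for i
  have "w \<in> ell2" by (rule ell2_finite_support[of "{..<n}"]) (auto simp: w_def)
  moreover have "ell2_norm (\<lambda>i. mat_apply A (u (r m)) i - w i)
     = L2_set (\<lambda>i. cmod (mat_apply A (u (r m)) i - w i)) {..<n}" for m
    by (rule ell2_finite_support) (auto simp: w_def mat_apply_def rows)
  moreover have "(\<lambda>m. L2_set (\<lambda>i. cmod (mat_apply A (u (r m)) i - w i)) {..<n}) \<longlonglongrightarrow> 0"
    by (rule tendsto_L2_set_diff_0) (use l in \<open>auto simp: w_def\<close>)
  ultimately show "\<exists>r w. strict_mono (r :: nat \<Rightarrow> nat) \<and> w \<in> ell2 \<and>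
      (\<lambda>m. ell2_norm (\<lambda>i. mat_apply A (u (r m)) i - w i)) \<longlonglongrightarrow> 0"
    using r by (intro exI[of _ r] exI[of _ w] conjI) simp_all
qed

text \<open>Only the first \<open>n\<close> coordinates of a vector matter, and these have a convergent subsequence.\<close>

lemma compact_mat_finite_cols:
  fixes A :: "'i \<Rightarrow> nat \<Rightarrow> complex"
  assumes A: "form_bound A C" and cols: "\<And>i j. n \<le> j \<Longrightarrow> A i j = 0"
  shows "compact_mat A"
  unfolding compact_mat_def
proof (intro conjI allI impI)
  show "bounded_mat A" using A bounded_mat_iff by blast
  fix u :: "nat \<Rightarrow> nat \<Rightarrow> complex" assume u: "\<forall>m. u m \<in> ell2 \<and> ell2_norm (u m) \<le> 1"
  have "cmod (u m i) \<le> 1" for m i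
    using L2_set_le_ell2_norm[of "u m" "{i}"] u by (auto intro: order_trans)
  then obtain r l where r: "strict_mono (r :: nat \<Rightarrow> nat)"
    and l: "\<And>i. i < n \<Longrightarrow> (\<lambda>m. u (r m) i) \<longlonglongrightarrow> l i"
    using bounded_vectors_convergent_subseq[of n u 1] by blast
  define v where "v m j = (if j < n then u (r m) j - l j else 0)" for m j
  define w where "w = mat_apply A (\<lambda>j. if j < n then l j else 0)"
  have v0: "v m j = 0" if "j \<notin> {..<n}" for m j using that by (simp add: v_def)
  have app: "mat_apply A x i = (\<Sum>j<n. A i j * x j)" for x i
    unfolding mat_apply_def by (intro infsumI has_sum_finite_neutralI) (auto simp: cols)
  have w2: "w \<in> ell2" unfolding w_def
    by (rule form_bound_mat_apply[OF A], rule ell2_finite_support[of "{..<n}"]) auto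
  have "(\<lambda>i. mat_apply A (u (r m)) i - w i) = mat_apply A (v m)" for m
    unfolding w_def app v_def by (simp add: fun_eq_iff algebra_simps sum_subtractf)
  then have le: "ell2_norm (\<lambda>i. mat_apply A (u (r m)) i - w i) \<le> C * L2_set (\<lambda>j. cmod (v m j)) {..<n}" for m
    using form_bound_mat_apply(3)[OF A ell2_finite_support(1)[of "{..<n}", OF _ v0[of _ m]]]
      ell2_finite_support(2)[of "{..<n}", OF _ v0[of _ m]] by simp
  have "(\<lambda>m. L2_set (\<lambda>j. cmod (u (r m) j - l j)) {..<n}) \<longlonglongrightarrow> 0"
    by (rule tendsto_L2_set_diff_0) (use l in auto)
  then have "(\<lambda>m. C * L2_set (\<lambda>j. cmod (v m j)) {..<n}) \<longlonglongrightarrow> 0"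
    by (intro tendsto_mult_right_zero) (simp add: v_def L2_set_def)
  then have "(\<lambda>m. ell2_norm (\<lambda>i. mat_apply A (u (r m)) i - w i)) \<longlonglongrightarrow> 0"
    by (rule Lim_null_comparison[OF always_eventually, rotated])
      (use le in \<open>simp add: ell2_norm_def infsum_nonneg\<close>)
  then show "\<exists>r w. strict_mono (r :: nat \<Rightarrow> nat) \<and> w \<in> ell2 \<and>
      (\<lambda>m. ell2_norm (\<lambda>i. mat_apply A (u (r m)) i - w i)) \<longlonglongrightarrow> 0"
    using r w2 by (intro exI[of _ r] exI[of _ w] conjI)
qed

section \<open>Matrix norms and operator spaces\<close>

text \<open>The part of the axioms of an operator space that passes to every linear subspace of the carrier,
  hence is available for the domain of a map that is to be extended.\<close>

locale matrix_normed_space =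
  fixes E :: "'a::ab_group_add opspace"
  assumes vs: "vector_space (os_scale E)"
    and carrier: "module.subspace (os_scale E) (os_carrier E)"
    and norm_nonneg: "1 \<le> k \<Longrightarrow> x \<in> os_mat E k \<Longrightarrow> 0 \<le> os_norm E k x"
    and norm_0D: "1 \<le> k \<Longrightarrow> x \<in> os_mat E k \<Longrightarrow> os_norm E k x = 0 \<Longrightarrow> x = (\<lambda>i j. 0)"
    and norm_scale: "1 \<le> k \<Longrightarrow> x \<in> os_mat E k \<Longrightarrow>
           os_norm E k (\<lambda>i j. os_scale E c (x i j)) = cmod c * os_norm E k x"
    and norm_add: "1 \<le> k \<Longrightarrow> x \<in> os_mat E k \<Longrightarrow> y \<in> os_mat E k \<Longrightarrow>
           os_norm E k (\<lambda>i j. x i j + y i j) \<le> os_norm E k x + os_norm E k y"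
begin

sublocale vector_space "os_scale E" by (rule vs)

lemma mat_entry: "x \<in> os_mat E k \<Longrightarrow> x i j \<in> os_carrier E"
  using subspace_0[OF carrier] by (auto simp: os_mat_def split: if_splits) metis

lemma mat_outside: "x \<in> os_mat E k \<Longrightarrow> \<not> (i < k \<and> j < k) \<Longrightarrow> x i j = 0"
  by (auto simp: os_mat_def)

lemma matI: "(\<And>i j. i < k \<Longrightarrow> j < k \<Longrightarrow> x i j \<in> os_carrier E) \<Longrightarrow>
    (\<And>i j. \<not> (i < k \<and> j < k) \<Longrightarrow> x i j = 0) \<Longrightarrow> x \<in> os_mat E k"
  by (auto simp: os_mat_def)

lemma mat_0: "(\<lambda>i j. 0) \<in> os_mat E k"
  by (rule matI) (auto simp: subspace_0 carrier)

lemma mat_scale: "x \<in> os_mat E k \<Longrightarrow> (\<lambda>i j. os_scale E c (x i j)) \<in> os_mat E k"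
  by (rule matI) (auto simp: mat_entry mat_outside intro: subspace_scale carrier)

lemma mat_add: "x \<in> os_mat E k \<Longrightarrow> y \<in> os_mat E k \<Longrightarrow> (\<lambda>i j. x i j + y i j) \<in> os_mat E k"
  by (rule matI) (auto simp: mat_entry mat_outside intro: subspace_add carrier)

lemma mat_oplus:
  "x \<in> os_mat E k \<Longrightarrow> y \<in> os_mat E l \<Longrightarrow> mat_direct_sum k x y \<in> os_mat E (k + l)"
  by (rule matI) (auto simp: mat_direct_sum_def mat_entry subspace_0[OF carrier] intro!: mat_outside)

lemma mat_sandwich_in:
  assumes "x \<in> os_mat E k" "a \<in> scalar_mat l k" "b \<in> scalar_mat k l"
  shows "mat_sandwich E k a x b \<in> os_mat E l"
proof (rule matI)
  fix i j
  show "mat_sandwich E k a x b i j \<in> os_carrier E"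
    unfolding mat_sandwich_def
    by (intro subspace_sum subspace_scale carrier mat_entry[OF assms(1)])
  assume "\<not> (i < l \<and> j < l)"
  then have "a i p * b q j = 0" for p q using assms(2,3) by (auto simp: scalar_mat_def)
  then show "mat_sandwich E k a x b i j = 0"
    by (simp only: mat_sandwich_def scale_zero_left sum.neutral_const)
qed

lemma norm_zero: "1 \<le> k \<Longrightarrow> os_norm E k (\<lambda>i j. 0) = 0"
  using norm_scale[OF _ mat_0, of k 0] by simp

lemma norm_sum:
  assumes "1 \<le> k" "finite S" "\<And>s. s \<in> S \<Longrightarrow> x s \<in> os_mat E k"
  shows "os_norm E k (\<lambda>i j. \<Sum>s\<in>S. x s i j) \<le> (\<Sum>s\<in>S. os_norm E k (x s)) \<and>
    (\<lambda>i j. \<Sum>s\<in>S. x s i j) \<in> os_mat E k"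
  using assms(2,3)
proof (induction S)
  case (insert s S)
  then show ?case
    using norm_add[OF assms(1), of "x s" "\<lambda>i j. \<Sum>s\<in>S. x s i j"] mat_add[of "x s" k "\<lambda>i j. \<Sum>s\<in>S. x s i j"]
    by auto
qed (simp add: norm_zero[OF assms(1)] mat_0)

lemma single_in: "v \<in> os_carrier E \<Longrightarrow> single_entry v \<in> os_mat E 1"
  by (rule matI) (auto simp: single_entry_def)

lemma norm1_nonneg: "v \<in> os_carrier E \<Longrightarrow> 0 \<le> os_norm1 E v"
  unfolding os_norm1_def by (intro norm_nonneg single_in) auto

lemma norm1_scale: "v \<in> os_carrier E \<Longrightarrow> os_norm1 E (os_scale E c v) = cmod c * os_norm1 E v"
proof -
  assume v: "v \<in> os_carrier E"
  have "single_entry (os_scale E c v) = (\<lambda>i j. os_scale E c (single_entry v i j))"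
    by (auto simp: single_entry_def fun_eq_iff)
  then show ?thesis unfolding os_norm1_def using norm_scale[OF _ single_in[OF v]] by simp
qed

lemma norm1_add:
  assumes v: "v \<in> os_carrier E" and w: "w \<in> os_carrier E"
  shows "os_norm1 E (v + w) \<le> os_norm1 E v + os_norm1 E w"
proof -
  have "single_entry (v + w) = (\<lambda>i j. single_entry v i j + single_entry w i j)"
    by (auto simp: single_entry_def fun_eq_iff)
  then show ?thesis unfolding os_norm1_def using norm_add[OF _ single_in[OF v] single_in[OF w]] by simp
qed

lemma norm1_0: "os_norm1 E 0 = 0"
  using norm1_scale[OF subspace_0[OF carrier], of 0] by simp

lemma norm1_0D: "v \<in> os_carrier E \<Longrightarrow> os_norm1 E v = 0 \<Longrightarrow> v = 0"
proof -
  assume "v \<in> os_carrier E" "os_norm1 E v = 0"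
  then have "single_entry v = (\<lambda>i j. 0)" by (intro norm_0D[of 1] single_in) (simp_all add: os_norm1_def)
  then have "single_entry v 0 0 = 0" by simp
  then show "v = 0" by (simp add: single_entry_def)
qed

lemma norm1_minus: "v \<in> os_carrier E \<Longrightarrow> os_norm1 E (- v) = os_norm1 E v"
  using norm1_scale[of v "-1"] by simp

lemma norm1_minus_commute:
  "v \<in> os_carrier E \<Longrightarrow> w \<in> os_carrier E \<Longrightarrow> os_norm1 E (v - w) = os_norm1 E (w - v)"
  using norm1_minus[OF subspace_diff[OF carrier], of v w] by simp

lemma Metric_space_os_dist: "Metric_space (os_carrier E) (os_dist E)"
proof
  fix x y z
  show "0 \<le> os_dist E x y" by (auto simp: os_dist_def norm1_nonneg subspace_diff carrier)
  show "os_dist E x y = os_dist E y x" by (auto simp: os_dist_def norm1_minus_commute)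
  show "os_dist E x y = 0 \<longleftrightarrow> x = y" if "x \<in> os_carrier E" "y \<in> os_carrier E"
    using that norm1_0D[of "x - y"] by (auto simp: os_dist_def norm1_0 subspace_diff carrier)
  show "os_dist E x z \<le> os_dist E x y + os_dist E y z"
    if "x \<in> os_carrier E" "y \<in> os_carrier E" "z \<in> os_carrier E"
    using that norm1_add[of "x - y" "y - z"] by (auto simp: os_dist_def subspace_diff carrier)
qed

definition Cauchy_seq :: "(nat \<Rightarrow> 'a) \<Rightarrow> bool" where
  "Cauchy_seq f \<longleftrightarrow> (\<forall>m. f m \<in> os_carrier E) \<and>
     (\<forall>e>0. \<exists>M. \<forall>m\<ge>M. \<forall>m'\<ge>M. os_norm1 E (f m - f m') < e)"

lemma mcomplete_iff:
  "Metric_space.mcomplete (os_carrier E) (os_dist E) \<longleftrightarrow>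
     (\<forall>f. Cauchy_seq f \<longrightarrow> (\<exists>l\<in>os_carrier E. (\<lambda>m. os_norm1 E (f m - l)) \<longlonglongrightarrow> 0))"
proof -
  interpret Metric_space "os_carrier E" "os_dist E" by (rule Metric_space_os_dist)
  have 1: "MCauchy f \<longleftrightarrow> Cauchy_seq f" for f
  proof (cases "\<forall>m. f m \<in> os_carrier E")
    case True
    then have "os_dist E (f m) (f m') = os_norm1 E (f m - f m')" for m m'
      by (simp add: os_dist_def)
    with True show ?thesis unfolding MCauchy_def Cauchy_seq_def
      by (simp add: image_subset_iff imp_conjL[symmetric]) meson
  qed (auto simp: MCauchy_def Cauchy_seq_def)
  have 2: "limitin mtopology f l sequentially \<longleftrightarrow> l \<in> os_carrier E \<and> (\<lambda>m. os_norm1 E (f m - l)) \<longlonglongrightarrow> 0"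
    if "\<forall>m. f m \<in> os_carrier E" for f l
    unfolding limitin_metric_dist_null using that by (auto simp: os_dist_def)
  show ?thesis unfolding mcomplete_def 1
    by (intro all_cong1 imp_cong refl) (use 2 in \<open>auto simp: Cauchy_seq_def Bex_def\<close>)
qed

end

text \<open>The inequality for \<open>c\<close> and for \<open>1 / c\<close> gives homogeneity.\<close>

lemma matrix_normed_spaceI:
  fixes E :: "'a::ab_group_add opspace"
  assumes vs: "vector_space (os_scale E)" and carrier: "module.subspace (os_scale E) (os_carrier E)"
    and nonneg: "\<And>k x. 1 \<le> k \<Longrightarrow> x \<in> os_mat E k \<Longrightarrow> 0 \<le> os_norm E k x"
    and zero: "\<And>k x. 1 \<le> k \<Longrightarrow> x \<in> os_mat E k \<Longrightarrow> os_norm E k x = 0 \<Longrightarrow> x = (\<lambda>i j. 0)"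
    and scale: "\<And>k x c. 1 \<le> k \<Longrightarrow> x \<in> os_mat E k \<Longrightarrow>
           os_norm E k (\<lambda>i j. os_scale E c (x i j)) \<le> cmod c * os_norm E k x"
    and add: "\<And>k x y. 1 \<le> k \<Longrightarrow> x \<in> os_mat E k \<Longrightarrow> y \<in> os_mat E k \<Longrightarrow>
           os_norm E k (\<lambda>i j. x i j + y i j) \<le> os_norm E k x + os_norm E k y"
  shows "matrix_normed_space E"
proof (rule matrix_normed_space.intro[OF vs carrier nonneg zero _ add])
  interpret vector_space "os_scale E" by (rule vs)
  fix k :: nat and x c assume k: "1 \<le> k" and x: "x \<in> os_mat E k"
  have cx: "(\<lambda>i j. os_scale E c (x i j)) \<in> os_mat E k"
    using x subspace_scale[OF carrier] by (auto simp: os_mat_def split: if_splits)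
  show "os_norm E k (\<lambda>i j. os_scale E c (x i j)) = cmod c * os_norm E k x"
  proof (cases "c = 0")
    case True
    then show ?thesis using scale[OF k x, of c] nonneg[OF k cx] by simp
  next
    case False
    have "os_norm E k x \<le> cmod (1 / c) * os_norm E k (\<lambda>i j. os_scale E c (x i j))"
      using scale[OF k cx, of "1 / c"] False by simp
    then have "cmod c * os_norm E k x \<le> os_norm E k (\<lambda>i j. os_scale E c (x i j))"
      using False by (simp add: norm_divide field_simps)
    then show ?thesis using scale[OF k x, of c] by simp
  qed
qed

locale Ruan_space =
  fixes E :: "'a::ab_group_add opspace"
  assumes os: "operator_space E"
begin

sublocale matrix_normed_space E
proof (rule matrix_normed_space.intro)
  note ax = os[unfolded operator_space_def]
  note norm_ax = ax[THEN conjunct2, THEN conjunct2, THEN conjunct1, rule_format]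
  show "vector_space (os_scale E)" by (rule ax[THEN conjunct1])
  show "module.subspace (os_scale E) (os_carrier E)" by (rule ax[THEN conjunct2, THEN conjunct1])
  fix k :: nat and x y :: "nat \<Rightarrow> nat \<Rightarrow> 'a" and c
  assume kx: "1 \<le> k" "x \<in> os_mat E k"
  show "0 \<le> os_norm E k x" using norm_ax[OF kx] by (elim conjE)
  show "x = (\<lambda>i j. 0)" if "os_norm E k x = 0"
    using norm_ax[OF kx] that by (elim conjE) (erule mp)
  show "os_norm E k (\<lambda>i j. os_scale E c (x i j)) = cmod c * os_norm E k x"
    using norm_ax[OF kx] by (elim conjE) (erule allE)
  show "os_norm E k (\<lambda>i j. x i j + y i j) \<le> os_norm E k x + os_norm E k y" if "y \<in> os_mat E k"
    using norm_ax[OF kx] that by (elim conjE) (erule bspec)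
qed

lemma norm_oplus: "1 \<le> k \<Longrightarrow> 1 \<le> l \<Longrightarrow> x \<in> os_mat E k \<Longrightarrow> y \<in> os_mat E l \<Longrightarrow>
    os_norm E (k + l) (mat_direct_sum k x y) = max (os_norm E k x) (os_norm E l y)"
  using os unfolding operator_space_def by blast

lemma norm_sandwich: "1 \<le> k \<Longrightarrow> 1 \<le> l \<Longrightarrow> x \<in> os_mat E k \<Longrightarrow> a \<in> scalar_mat l k \<Longrightarrow> b \<in> scalar_mat k l \<Longrightarrow>
    os_norm E l (mat_sandwich E k a x b) \<le> mat_op_norm a * os_norm E k x * mat_op_norm b"
  using os unfolding operator_space_def by blast

lemma complete_seq:
  "Cauchy_seq f \<Longrightarrow> \<exists>l\<in>os_carrier E. (\<lambda>m. os_norm1 E (f m - l)) \<longlonglongrightarrow> 0"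
  using os mcomplete_iff unfolding operator_space_def by blast

lemma norm_sandwich_contraction:
  assumes "1 \<le> k" "1 \<le> l" "x \<in> os_mat E k" "a \<in> scalar_mat l k" "b \<in> scalar_mat k l"
    and "form_bound a 1" "form_bound b 1"
  shows "os_norm E l (mat_sandwich E k a x b) \<le> os_norm E k x"
proof -
  have "0 \<le> mat_op_norm a" "mat_op_norm a \<le> 1" "0 \<le> mat_op_norm b" "mat_op_norm b \<le> 1"
    using assms(6,7) by (auto intro!: mat_op_norm_le mat_op_norm_nonneg bounded_mat_iff[THEN iffD2, OF exI])
  then have "mat_op_norm a * os_norm E k x * mat_op_norm b \<le> 1 * os_norm E k x * 1"
    using norm_nonneg[OF assms(1,3)] by (intro mult_mono) auto
  then show ?thesis using norm_sandwich[OF assms(1-5)] by simp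
qed

text \<open>A matrix with one nonzero entry \<open>v\<close> is the product of \<open>v\<close> with two matrix units.\<close>

lemma norm_le_sum_entries:
  assumes "1 \<le> k" "x \<in> os_mat E k"
  shows "os_norm E k x \<le> (\<Sum>s\<in>{..<k}\<times>{..<k}. os_norm1 E (x (fst s) (snd s)))"
proof -
  define y where "y s = mat_sandwich E 1 (\<lambda>r p. if r = fst s \<and> p = 0 then 1 else 0)
      (single_entry (x (fst s) (snd s))) (\<lambda>q t. if q = 0 \<and> t = snd s then 1 else 0)" for s
  have y: "y s r t = (if r = fst s \<and> t = snd s then x (fst s) (snd s) else 0)" for s r t
    by (simp add: y_def mat_sandwich_def single_entry_def)
  have yin: "y s \<in> os_mat E k" and yle: "os_norm E k (y s) \<le> os_norm1 E (x (fst s) (snd s))"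
    if "s \<in> {..<k}\<times>{..<k}" for s
  proof -
    show "y s \<in> os_mat E k" unfolding y_def
      by (rule mat_sandwich_in[OF single_in]) (use that in \<open>auto simp: mat_entry[OF assms(2)] scalar_mat_def\<close>)
    show "os_norm E k (y s) \<le> os_norm1 E (x (fst s) (snd s))"
      unfolding y_def os_norm1_def
      by (intro norm_sandwich_contraction single_in mat_entry[OF assms(2)])
        (use that assms form_bound_unit[of _ _ 1] in \<open>auto simp: scalar_mat_def\<close>)
  qed
  have "x = (\<lambda>i j. \<Sum>s\<in>{..<k}\<times>{..<k}. y s i j)"
  proof (intro ext)
    fix i j
    have "(\<Sum>s\<in>{..<k}\<times>{..<k}. y s i j) = (\<Sum>s\<in>{..<k}\<times>{..<k}. if s = (i, j) then x i j else 0)"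
      unfolding y by (intro sum.cong refl) (auto simp: prod_eq_iff)
    also have "\<dots> = x i j" using mat_outside[OF assms(2)] by (auto simp: sum.delta)
    finally show "x i j = (\<Sum>s\<in>{..<k}\<times>{..<k}. y s i j)" by simp
  qed
  then have "os_norm E k x \<le> (\<Sum>s\<in>{..<k}\<times>{..<k}. os_norm E k (y s))"
    using norm_sum[OF assms(1), of "{..<k}\<times>{..<k}" y] yin by auto
  also have "\<dots> \<le> (\<Sum>s\<in>{..<k}\<times>{..<k}. os_norm1 E (x (fst s) (snd s)))"
    by (intro sum_mono yle)
  finally show ?thesis .
qed

end

lemma operator_spaceI:
  assumes "matrix_normed_space E"
    and "\<And>k l x y. 1 \<le> k \<Longrightarrow> 1 \<le> l \<Longrightarrow> x \<in> os_mat E k \<Longrightarrow> y \<in> os_mat E l \<Longrightarrow>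
       os_norm E (k + l) (mat_direct_sum k x y) = max (os_norm E k x) (os_norm E l y)"
    and "\<And>k l x a b. 1 \<le> k \<Longrightarrow> 1 \<le> l \<Longrightarrow> x \<in> os_mat E k \<Longrightarrow> a \<in> scalar_mat l k \<Longrightarrow> b \<in> scalar_mat k l \<Longrightarrow>
       os_norm E l (mat_sandwich E k a x b) \<le> mat_op_norm a * os_norm E k x * mat_op_norm b"
    and "\<And>f. matrix_normed_space.Cauchy_seq E f \<Longrightarrow>
       \<exists>l\<in>os_carrier E. (\<lambda>m. os_norm1 E (f m - l)) \<longlonglongrightarrow> 0"
  shows "operator_space E"
  unfolding operator_space_def matrix_normed_space.mcomplete_iff[OF assms(1)]
proof (intro conjI allI ballI impI)
  show "vector_space (os_scale E)" "module.subspace (os_scale E) (os_carrier E)"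
    using assms(1) unfolding matrix_normed_space_def by auto
qed (use assms in \<open>auto simp: matrix_normed_space.norm_nonneg matrix_normed_space.norm_0D
     matrix_normed_space.norm_scale matrix_normed_space.norm_add\<close>)

lemma eq_if_same_upper_bounds: "(\<And>C. a \<le> C \<longleftrightarrow> b \<le> C) \<Longrightarrow> a = (b :: real)"
  by (meson order_antisym order_refl)

lemma sum_fun_apply2: "(\<Sum>s\<in>S. f s) i j = (\<Sum>s\<in>S. f s i j)"
  by (induction S rule: infinite_finite_induct) auto

section \<open>The spaces of columns and rows as operator spaces\<close>

text \<open>The two parts of the form act on complementary coordinates, so the Cauchy-Schwarz inequality in
  the plane combines the two estimates without loss.\<close>

lemma form_bound_block_diagonal:
  fixes A B :: "'a \<Rightarrow> 'b \<Rightarrow> complex"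
  assumes "form_bound A M" "form_bound B M"
  shows "form_bound (\<lambda>i j. if P i \<and> Q j then A i j else if \<not> P i \<and> \<not> Q j then B i j else 0) M"
  unfolding form_bound_def
proof (intro allI impI)
  fix I :: "'a set" and J :: "'b set" and \<eta> :: "'a \<Rightarrow> complex" and \<xi> :: "'b \<Rightarrow> complex" assume *: "finite I" "finite J"
  let ?D = "\<lambda>i j. if P i \<and> Q j then A i j else if \<not> P i \<and> \<not> Q j then B i j else 0"
  let ?e1 = "\<lambda>i. if P i then \<eta> i else 0" and ?e2 = "\<lambda>i. if P i then 0 else \<eta> i"
  let ?x1 = "\<lambda>i. if Q i then \<xi> i else 0" and ?x2 = "\<lambda>i. if Q i then 0 else \<xi> i"
  let ?E1 = "fin_norm I ?e1" and ?E2 = "fin_norm I ?e2"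
  let ?X1 = "fin_norm J ?x1" and ?X2 = "fin_norm J ?x2"
  have E: "?E1\<^sup>2 + ?E2\<^sup>2 = (fin_norm I \<eta>)\<^sup>2"
    by (simp add: L2_set_def sum_nonneg flip: sum.distrib) (auto intro!: sum.cong)
  have X: "?X1\<^sup>2 + ?X2\<^sup>2 = (fin_norm J \<xi>)\<^sup>2"
    by (simp add: L2_set_def sum_nonneg flip: sum.distrib) (auto intro!: sum.cong)
  have "bilin I J \<eta> ?D \<xi> =
     bilin I J ?e1 A ?x1 + bilin I J ?e2 B ?x2"
    unfolding sum.distrib[symmetric] by (intro sum.cong refl) auto
  then have "cmod (bilin I J \<eta> ?D \<xi>) \<le> M * ?E1 * ?X1 + M * ?E2 * ?X2"
    by (simp only:) (rule norm_triangle_mono[OF form_boundD[OF assms(1) *] form_boundD[OF assms(2) *]])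
  also have "\<dots> = M * (?E1 * ?X1 + ?E2 * ?X2)" by (simp add: algebra_simps)
  also have "?E1 * ?X1 + ?E2 * ?X2 \<le> sqrt (?E1\<^sup>2 + ?E2\<^sup>2) * sqrt (?X1\<^sup>2 + ?X2\<^sup>2)"
    using L2_set_mult_ineq[of "\<lambda>b. if b then ?E1 else ?E2" "\<lambda>b. if b then ?X1 else ?X2" UNIV]
    by (simp add: L2_set_def UNIV_bool sum_nonneg add.commute)
  finally show "cmod (bilin I J \<eta> ?D \<xi>)
        \<le> M * fin_norm I \<eta> * fin_norm J \<xi>"
    using form_bound_nonneg[OF assms(1)] by (simp add: E X mult.assoc mult_left_mono L2_set_nonneg)
qed

lemma block_eq: "(\<lambda>(p, i) (q, j). x p q i j) = (\<lambda>i j. x (fst i) (fst j) (snd i) (snd j))"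
  by (auto simp: fun_eq_iff)

abbreviation block :: "(nat \<Rightarrow> nat \<Rightarrow> nat \<Rightarrow> nat \<Rightarrow> complex) \<Rightarrow> nat \<times> nat \<Rightarrow> nat \<times> nat \<Rightarrow> complex" where
  "block x \<equiv> \<lambda>(p, i) (q, j). x p q i j"

lemma form_bound_block_entry:
  assumes "form_bound (block x) C" shows "form_bound (x p q) C"
proof -
  have "form_bound (\<lambda>i j. block x (p, i) (q, j)) C"
    using assms by (rule form_bound_reindex) (auto simp: inj_def)
  then show ?thesis by simp
qed

lemma form_bound_block_unit:
  assumes "form_bound A C"
  shows "form_bound (block (\<lambda>p q i j. if p = p0 \<and> q = q0 then A i j else 0)) C"
proof -
  have "form_bound (\<lambda>i j. if fst i = p0 \<and> fst j = q0 then A (snd i) (snd j) else 0) C"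
    by (rule form_bound_reindex_on[OF assms]) (auto simp: inj_on_def prod_eq_iff)
  then show ?thesis by (simp add: block_eq)
qed

lemma bounded_block:
  assumes x: "\<And>p q. p < k \<Longrightarrow> q < k \<Longrightarrow> bounded_mat (x p q)"
    and out: "\<And>p q. \<not> (p < k \<and> q < k) \<Longrightarrow> x p q = 0"
  shows "bounded_mat (block x)"
proof -
  let ?S = "{..<k} \<times> {..<k}"
  have "block x = (\<lambda>i j. \<Sum>s\<in>?S. block (\<lambda>p q i j. if p = fst s \<and> q = snd s then x (fst s) (snd s) i j else 0) i j)"
  proof (intro ext)
    fix i j :: "nat \<times> nat"
    have "(\<Sum>s\<in>?S. block (\<lambda>p q i j. if p = fst s \<and> q = snd s then x (fst s) (snd s) i j else 0) i j)
      = (\<Sum>s\<in>?S. if s = (fst i, fst j) then block x i j else 0)"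
      by (intro sum.cong refl) (auto simp: block_eq prod_eq_iff)
    also have "\<dots> = block x i j" using out by (auto simp: sum.delta block_eq)
    finally show "block x i j = (\<Sum>s\<in>?S. block (\<lambda>p q i j. if p = fst s \<and> q = snd s then x (fst s) (snd s) i j else 0) i j)"
      by simp
  qed
  moreover have "form_bound (\<lambda>i j. \<Sum>s\<in>?S. block (\<lambda>p q i j. if p = fst s \<and> q = snd s then x (fst s) (snd s) i j else 0) i j)
      (\<Sum>s\<in>?S. mat_op_norm (x (fst s) (snd s)))"
    by (intro form_bound_sum form_bound_block_unit form_bound_mat_op_norm) (auto intro: x)
  ultimately show ?thesis by (auto simp: bounded_mat_iff)
qed

lemma form_bound_block_single_entry: "form_bound (block (single_entry A)) C \<longleftrightarrow> form_bound A C"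
proof
  assume "form_bound (block (single_entry A)) C"
  from form_bound_block_entry[OF this, of 0 0] show "form_bound A C" by (simp add: single_entry_def)
next
  assume "form_bound A C"
  from form_bound_block_unit[OF this, of 0 0] show "form_bound (block (single_entry A)) C"
    by (simp add: single_entry_def block_eq if_distrib if_distribR cong: if_cong)
qed

text \<open>
  The matrix is \<open>(a \<otimes> 1) x (b \<otimes> 1)\<close>. The inner indices range over an infinite set, but finitely many
  of them, collected in \<open>F\<close>, determine the entries that are tested.
\<close>

lemma form_bound_block_sandwich:
  fixes a b :: "nat \<Rightarrow> nat \<Rightarrow> complex"
  assumes a: "form_bound a \<alpha>" and x: "form_bound (block x) C" and b: "form_bound b \<beta>"
  shows "form_bound (block (\<lambda>r s i j. \<Sum>p<k. \<Sum>q<k. a r p * b q s * x p q i j)) (\<alpha> * C * \<beta>)"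
    (is "form_bound ?Z _")
proof (rule form_boundI_local)
  fix I J :: "(nat \<times> nat) set" assume I: "finite I" and J: "finite J"
  define F where "F = snd ` I \<union> snd ` J"
  have F: "finite F" using I J by (simp add: F_def)
  define U where "U = (\<lambda>(r, i :: nat) (p, i'). if i = i' then a r p else 0)"
  define V where "V = (\<lambda>(q, j :: nat) (s, j'). if j = j' then b q s else 0)"
  have U: "form_bound U \<alpha>"
    using form_bound_reindex[OF form_bound_amplify[OF a], of prod.swap prod.swap]
    by (simp add: U_def block_eq cong: if_cong)
  have V: "form_bound V \<beta>"
    using form_bound_reindex[OF form_bound_amplify[OF b], of prod.swap prod.swap]
    by (simp add: V_def block_eq cong: if_cong)
  let ?R = "{..<k} \<times> F"
  have R: "finite ?R" using F by simp
  have bound: "form_bound (\<lambda>i j. \<Sum>t\<in>?R. (\<Sum>s\<in>?R. U i s * block x s t) * V t j) (\<alpha> * C * \<beta>)"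
    by (rule form_bound_compose[OF form_bound_compose[OF U x R] V R])
  have agree: "(\<Sum>t\<in>?R. (\<Sum>s\<in>?R. U i s * block x s t) * V t j) = ?Z i j"
    if "i \<in> I" "j \<in> J" for i j
  proof -
    have ij: "snd i \<in> F" "snd j \<in> F" using that by (auto simp: F_def)
    have "(\<Sum>t\<in>?R. (\<Sum>s\<in>?R. U i s * block x s t) * V t j) =
      (\<Sum>q<k. \<Sum>j'\<in>F. (\<Sum>p<k. \<Sum>i'\<in>F. U i (p, i') * x p q i' j') * V (q, j') j)"
      unfolding sum.cartesian_product' by simp
    also have "\<dots> = (\<Sum>q<k. \<Sum>j'\<in>F. (\<Sum>p<k. \<Sum>i'\<in>F. if i' = snd i then a (fst i) p * x p q i' j' else 0) * V (q, j') j)"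
      by (intro sum.cong refl arg_cong2[where f = "(*)"]) (auto simp: U_def block_eq)
    also have "\<dots> = (\<Sum>q<k. \<Sum>j'\<in>F. (\<Sum>p<k. a (fst i) p * x p q (snd i) j') * V (q, j') j)"
      using ij F by (simp add: sum.delta)
    also have "\<dots> = (\<Sum>q<k. \<Sum>j'\<in>F. if j' = snd j then (\<Sum>p<k. a (fst i) p * x p q (snd i) j') * b q (fst j) else 0)"
      by (intro sum.cong refl) (auto simp: V_def block_eq)
    also have "\<dots> = (\<Sum>q<k. (\<Sum>p<k. a (fst i) p * x p q (snd i) (snd j)) * b q (fst j))"
      using ij F by (simp add: sum.delta)
    also have "\<dots> = (\<Sum>q<k. \<Sum>p<k. a (fst i) p * b q (fst j) * x p q (snd i) (snd j))"
      by (simp add: sum_distrib_left mult_ac)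
    also have "\<dots> = ?Z i j" by (subst sum.swap) (simp add: block_eq)
    finally show ?thesis .
  qed
  show "\<exists>A'. form_bound A' (\<alpha> * C * \<beta>) \<and> (\<forall>i\<in>I. \<forall>j\<in>J. A' i j = ?Z i j)"
    by (intro exI conjI ballI, rule bound, rule agree)
qed

lemma scalar_mat_bounded:
  assumes c: "c \<in> scalar_mat m m'"
  shows "bounded_mat c"
proof -
  let ?S = "insert 0 ((\<lambda>s. cmod (c (fst s) (snd s))) ` ({..<m} \<times> {..<m'}))"
  have "cmod (c i j) \<le> Max ?S" for i j
  proof (rule Max_ge)
    show "cmod (c i j) \<in> ?S"
    proof (cases "i < m \<and> j < m'")
      case True
      then have "(i, j) \<in> {..<m} \<times> {..<m'}" by simp
      then show ?thesis by (rule insertI2[OF rev_image_eqI]) simp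
    qed (use c in \<open>auto simp: scalar_mat_def\<close>)
  qed simp
  then have "form_bound c (of_nat (card {..<m}) * of_nat (card {..<m'}) * Max ?S)"
    by (intro form_bound_finite_entries) (use c in \<open>auto simp: scalar_mat_def\<close>)
  then show ?thesis using bounded_mat_iff by blast
qed

text \<open>Rows and columns are treated together as the compact operators that vanish at the positions \<open>P\<close>.\<close>

definition pattern_ops :: "(nat \<Rightarrow> nat \<Rightarrow> bool) \<Rightarrow> (nat \<Rightarrow> nat \<Rightarrow> complex) opspace" where
  "pattern_ops P = compact_ops
     \<lparr>os_carrier := {A \<in> os_carrier compact_ops. \<forall>i j. P i j \<longrightarrow> A i j = 0}\<rparr>"

lemma M_inf_fin_pattern: "M_inf_fin n = pattern_ops (\<lambda>i j. n \<le> j)"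
  by (simp add: M_inf_fin_def pattern_ops_def)

lemma M_fin_inf_pattern: "M_fin_inf n = pattern_ops (\<lambda>i j. n \<le> i)"
  by (simp add: M_fin_inf_def pattern_ops_def)

text \<open>For these patterns boundedness implies compactness, so that the carrier is described by form bounds
  alone.\<close>

locale compact_pattern =
  fixes P :: "nat \<Rightarrow> nat \<Rightarrow> bool"
  assumes compactI: "\<And>A C. form_bound A C \<Longrightarrow> (\<And>i j. P i j \<Longrightarrow> A i j = 0) \<Longrightarrow> compact_mat A"
begin

abbreviation "E \<equiv> pattern_ops P"

lemma carrier_iff: "A \<in> os_carrier E \<longleftrightarrow> bounded_mat A \<and> (\<forall>i j. P i j \<longrightarrow> A i j = 0)"
  using compactI by (auto simp: pattern_ops_def compact_ops_def compact_mat_def bounded_mat_iff)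

lemma scale_eq: "os_scale E = (\<lambda>c A i j. c * A i j)"
  by (simp add: pattern_ops_def compact_ops_def)

lemma norm_eq: "os_norm E k x = mat_op_norm (block x)"
  by (simp add: pattern_ops_def compact_ops_def)

lemma bounded: assumes "x \<in> os_mat E k" shows "bounded_mat (block x)"
  using assms by (intro bounded_block[of k]) (auto simp: os_mat_def carrier_iff zero_fun_def split: if_splits)

lemma norm_le_iff: "x \<in> os_mat E k \<Longrightarrow> os_norm E k x \<le> C \<longleftrightarrow> form_bound (block x) C"
  unfolding norm_eq by (rule mat_op_norm_le_iff[OF bounded])

lemma form_bound_norm: "x \<in> os_mat E k \<Longrightarrow> form_bound (block x) (os_norm E k x)"
  using norm_le_iff by blast

lemma matrix_normed: "matrix_normed_space E"
proof (rule matrix_normed_spaceI)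
  show vs: "vector_space (os_scale E)"
    by unfold_locales (auto simp: scale_eq fun_eq_iff algebra_simps)
  then interpret vector_space "os_scale E" .
  show sub: "subspace (os_carrier E)"
  proof (rule subspaceI)
    show "0 \<in> os_carrier E"
      using form_bound_0 by (auto simp: carrier_iff bounded_mat_iff zero_fun_def)
    fix A B assume A: "A \<in> os_carrier E" and B: "B \<in> os_carrier E"
    have "form_bound (A + B) (mat_op_norm A + mat_op_norm B)"
      using form_bound_add[OF form_bound_mat_op_norm form_bound_mat_op_norm, of A B] A B
      by (simp add: carrier_iff plus_fun_def)
    then show "A + B \<in> os_carrier E" using A B by (auto simp: carrier_iff bounded_mat_iff)
  next
    fix c A assume A: "A \<in> os_carrier E"
    have "form_bound (os_scale E c A) (cmod c * mat_op_norm A)"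
      using form_bound_scale[OF form_bound_mat_op_norm, of A c] A by (simp add: carrier_iff scale_eq)
    then show "os_scale E c A \<in> os_carrier E"
      using A by (auto simp: carrier_iff bounded_mat_iff scale_eq)
  qed
  fix k :: nat and x y c assume k: "1 \<le> k" and x: "x \<in> os_mat E k"
  show "0 \<le> os_norm E k x" using form_bound_nonneg form_bound_norm[OF x] by blast
  show "x = (\<lambda>i j. 0)" if "os_norm E k x = 0"
  proof (intro ext)
    fix p q i j
    have "form_bound (x p q) 0" using form_bound_block_entry[OF form_bound_norm[OF x]] that by simp
    then show "x p q i j = 0 i j" using form_bound_0_iff by (metis zero_fun_apply)
  qed
  have sx: "(\<lambda>i j. os_scale E c (x i j)) \<in> os_mat E k" for c
    using x sub by (auto simp: os_mat_def subspace_scale split: if_splits)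
  have le: "form_bound (block (\<lambda>i j. os_scale E c (x i j))) (cmod c * os_norm E k x)" for c
    using form_bound_scale[OF form_bound_norm[OF x], of c] by (simp add: scale_eq block_eq)
  show "os_norm E k (\<lambda>i j. os_scale E c (x i j)) \<le> cmod c * os_norm E k x"
    using le norm_le_iff[OF sx] by blast
  show "os_norm E k (\<lambda>i j. x i j + y i j) \<le> os_norm E k x + os_norm E k y" if y: "y \<in> os_mat E k"
  proof -
    have "(\<lambda>i j. x i j + y i j) \<in> os_mat E k"
      using x y sub by (auto simp: os_mat_def subspace_add split: if_splits)
    moreover have "form_bound (block (\<lambda>i j. x i j + y i j)) (os_norm E k x + os_norm E k y)"
      using form_bound_add[OF form_bound_norm[OF x] form_bound_norm[OF y]] by (simp add: block_eq)
    ultimately show ?thesis using norm_le_iff by blast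
  qed
qed

lemma norm1_eq:
  assumes "A \<in> os_carrier E" shows "os_norm1 E A = mat_op_norm A"
proof (rule eq_if_same_upper_bounds)
  interpret matrix_normed_space E by (rule matrix_normed)
  fix C
  have "os_norm1 E A \<le> C \<longleftrightarrow> form_bound (block (single_entry A)) C"
    unfolding os_norm1_def by (rule norm_le_iff[OF single_in[OF assms]])
  also have "\<dots> \<longleftrightarrow> form_bound A C" by (rule form_bound_block_single_entry)
  also have "\<dots> \<longleftrightarrow> mat_op_norm A \<le> C"
    using mat_op_norm_le_iff[of A C] assms by (simp add: carrier_iff)
  finally show "os_norm1 E A \<le> C \<longleftrightarrow> mat_op_norm A \<le> C" .
qed

lemma operator_space_pattern: "operator_space E"
proof -
  interpret matrix_normed_space E by (rule matrix_normed)
  show ?thesis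
  proof (rule operator_spaceI[OF matrix_normed])
    fix k l :: nat and x y assume kl: "1 \<le> k" "1 \<le> l" and x: "x \<in> os_mat E k" and y: "y \<in> os_mat E l"
    show "os_norm E (k + l) (mat_direct_sum k x y) = max (os_norm E k x) (os_norm E l y)"
    proof (rule eq_if_same_upper_bounds)
      fix C
      have "form_bound (block (mat_direct_sum k x y)) C \<longleftrightarrow> form_bound (block x) C \<and> form_bound (block y) C"
      proof (intro iffI conjI)
        assume D: "form_bound (block (mat_direct_sum k x y)) C"
        have "(\<lambda>i j. if fst i < k \<and> fst j < k then block (mat_direct_sum k x y) i j else 0) = block x"
          using mat_outside[OF x] by (auto simp: fun_eq_iff mat_direct_sum_def)
        with form_bound_restrict[OF D, of "\<lambda>i. fst i < k" "\<lambda>i. fst i < k"]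
        show "form_bound (block x) C" by (simp only:)
        have "form_bound (\<lambda>i j. block (mat_direct_sum k x y) (map_prod ((+) k) id i) (map_prod ((+) k) id j)) C"
          by (rule form_bound_reindex[OF D]) (auto simp: inj_def)
        then show "form_bound (block y) C" by (simp add: mat_direct_sum_def block_eq)
      next
        assume b: "form_bound (block x) C \<and> form_bound (block y) C"
        let ?f = "map_prod (\<lambda>p. p - k) id :: nat \<times> nat \<Rightarrow> _"
        have "form_bound (\<lambda>i j. if k \<le> fst i \<and> k \<le> fst j then block y (?f i) (?f j) else 0) C"
          by (rule form_bound_reindex_on) (use b in \<open>auto simp: inj_on_def\<close>)
        from form_bound_block_diagonal[OF _ this, of "block x" "\<lambda>i. fst i < k" "\<lambda>i. fst i < k"] b
        have "form_bound (\<lambda>i j. if fst i < k \<and> fst j < k then block x i j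
           else if \<not> fst i < k \<and> \<not> fst j < k then
             (if k \<le> fst i \<and> k \<le> fst j then block y (?f i) (?f j) else 0) else 0) C" by blast
        moreover have "(\<lambda>i j. if fst i < k \<and> fst j < k then block x i j
           else if \<not> fst i < k \<and> \<not> fst j < k then
             (if k \<le> fst i \<and> k \<le> fst j then block y (?f i) (?f j) else 0) else 0) = block (mat_direct_sum k x y)"
          by (auto simp: fun_eq_iff mat_direct_sum_def)
        ultimately show "form_bound (block (mat_direct_sum k x y)) C" by simp
      qed
      then show "os_norm E (k + l) (mat_direct_sum k x y) \<le> C \<longleftrightarrow> max (os_norm E k x) (os_norm E l y) \<le> C"
        using norm_le_iff[OF x] norm_le_iff[OF y] norm_le_iff[OF mat_oplus[OF x y]] by simp
    qed
  next
    fix k l :: nat and x a b assume kl: "1 \<le> k" "1 \<le> l" and x: "x \<in> os_mat E k"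
      and a: "a \<in> scalar_mat l k" and b: "b \<in> scalar_mat k l"
    have "block (mat_sandwich E k a x b) = block (\<lambda>r s i j. \<Sum>p<k. \<Sum>q<k. a r p * b q s * x p q i j)"
      by (simp add: mat_sandwich_def scale_eq sum_fun_apply2)
    then show "os_norm E l (mat_sandwich E k a x b) \<le> mat_op_norm a * os_norm E k x * mat_op_norm b"
      unfolding norm_le_iff[OF mat_sandwich_in[OF x a b]]
      using form_bound_block_sandwich[OF form_bound_mat_op_norm[OF scalar_mat_bounded[OF a]]
        form_bound_norm[OF x] form_bound_mat_op_norm[OF scalar_mat_bounded[OF b]], of k] by simp
  next
    fix f assume f: "Cauchy_seq f"
    have fc: "f m \<in> os_carrier E" for m using f by (simp add: Cauchy_seq_def)
    have fd: "f m - f m' \<in> os_carrier E" for m m' by (intro subspace_diff carrier fc)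
    have cau: "\<exists>M. \<forall>m\<ge>M. \<forall>m'\<ge>M. form_bound (f m - f m') e" if "e > 0" for e
    proof -
      have "form_bound (f m - f m') e" if "os_norm1 E (f m - f m') < e" for m m'
        using that norm1_eq[OF fd] mat_op_norm_le_iff[of "f m - f m'" e] fd[of m m'] by (auto simp: carrier_iff)
      then show ?thesis using f that unfolding Cauchy_seq_def by meson
    qed
    have "\<exists>l. (\<lambda>m. f m i j) \<longlonglongrightarrow> l" for i j
    proof -
      have "Cauchy (\<lambda>m. f m i j)"
      proof (rule metric_CauchyI)
        fix e :: real assume "e > 0"
        then obtain M where M: "\<And>m m'. m \<ge> M \<Longrightarrow> m' \<ge> M \<Longrightarrow> form_bound (f m - f m') (e / 2)"
          using cau[of "e / 2"] by auto
        have "dist (f m i j) (f m' i j) < e" if "m \<ge> M" "m' \<ge> M" for m m'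
          using form_bound_entry[OF M[OF that], of i j] \<open>e > 0\<close> by (simp add: dist_norm)
        then show "\<exists>M. \<forall>m\<ge>M. \<forall>n\<ge>M. dist (f m i j) (f n i j) < e" by blast
      qed
      then show ?thesis using Cauchy_convergent_iff convergent_def by blast
    qed
    then obtain L where L: "\<And>i j. (\<lambda>m. f m i j) \<longlonglongrightarrow> L i j" by metis
    have lim: "\<exists>M. \<forall>m\<ge>M. form_bound (f m - L) e" if e: "e > 0" for e
    proof -
      obtain M where M: "\<And>m m'. m \<ge> M \<Longrightarrow> m' \<ge> M \<Longrightarrow> form_bound (f m - f m') e"
        using cau[OF e] by auto
      have "form_bound (f m - L) e" if m: "m \<ge> M" for m
      proof (rule form_bound_limit[OF sequentially_bot])
        show "(\<lambda>m'. (f m - f m') i j) \<longlonglongrightarrow> (f m - L) i j" for i j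
          by (simp, intro tendsto_intros L)
        show "\<forall>\<^sub>F m' in sequentially. form_bound (f m - f m') e"
          using M[OF m] eventually_sequentially by blast
      qed simp
      then show ?thesis by blast
    qed
    have Lc: "L \<in> os_carrier E"
    proof -
      obtain M where M: "form_bound (f M - L) 1" using lim[of 1] by auto
      have "form_bound (\<lambda>i j. f M i j - (f M - L) i j) (mat_op_norm (f M) + 1)"
        by (rule form_bound_diff[OF form_bound_mat_op_norm M]) (use fc carrier_iff in blast)
      then have "bounded_mat L" by (auto simp: bounded_mat_iff)
      moreover have "L i j = 0" if "P i j" for i j
      proof -
        have "(\<lambda>m. f m i j) = (\<lambda>m. 0)" using fc that carrier_iff by (auto simp: fun_eq_iff)
        then show ?thesis using L[of i j] by (simp add: LIMSEQ_const_iff)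
      qed
      ultimately show ?thesis by (simp add: carrier_iff)
    qed
    have "(\<lambda>m. os_norm1 E (f m - L)) \<longlonglongrightarrow> 0"
    proof (rule LIMSEQ_I)
      fix e :: real assume e: "e > 0"
      obtain M where M: "\<And>m. m \<ge> M \<Longrightarrow> form_bound (f m - L) (e / 2)" using lim[of "e/2"] e by auto
      have "norm (os_norm1 E (f m - L) - 0) < e" if "m \<ge> M" for m
      proof -
        have c: "f m - L \<in> os_carrier E" by (intro subspace_diff carrier fc Lc)
        have "os_norm1 E (f m - L) \<le> e / 2" using mat_op_norm_le[OF M[OF that]] by (simp add: norm1_eq[OF c])
        then show ?thesis using norm1_nonneg[OF c] e by simp
      qed
      then show "\<exists>M. \<forall>m\<ge>M. norm (os_norm1 E (f m - L) - 0) < e" by blast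
    qed
    then show "\<exists>l\<in>os_carrier E. (\<lambda>m. os_norm1 E (f m - l)) \<longlonglongrightarrow> 0" using Lc by blast
  qed
qed

end

interpretation cols: compact_pattern "\<lambda>i j. n \<le> j" for n :: nat
  by unfold_locales (rule compact_mat_finite_cols)

interpretation rows: compact_pattern "\<lambda>i j. n \<le> i" for n :: nat
  by unfold_locales (rule compact_mat_finite_rows)

section \<open>Direct sums and null sequences as operator spaces\<close>

text \<open>Direct sums and \<open>c\<^sub>0\<close>-sums have in common that the matrix norms are suprema over coordinates. The
  axioms of an operator space are inherited from the coordinates, with the exception of
  completeness, which depends on which families of coordinates are admitted.\<close>

locale coordinate_space =
  fixes E :: "'a::ab_group_add opspace" and S :: "'s set"
    and F :: "'s \<Rightarrow> 'b::ab_group_add opspace" and \<pi> :: "'s \<Rightarrow> 'a \<Rightarrow> 'b"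
  assumes S_ne: "S \<noteq> {}"
    and F: "s \<in> S \<Longrightarrow> operator_space (F s)"
    and vs: "vector_space (os_scale E)"
    and carrier: "module.subspace (os_scale E) (os_carrier E)"
    and \<pi>_in: "s \<in> S \<Longrightarrow> v \<in> os_carrier E \<Longrightarrow> \<pi> s v \<in> os_carrier (F s)"
    and \<pi>_add: "s \<in> S \<Longrightarrow> \<pi> s (v + w) = \<pi> s v + \<pi> s w"
    and \<pi>_scale: "s \<in> S \<Longrightarrow> \<pi> s (os_scale E c v) = os_scale (F s) c (\<pi> s v)"
    and \<pi>_inj: "v \<in> os_carrier E \<Longrightarrow> (\<And>s. s \<in> S \<Longrightarrow> \<pi> s v = 0) \<Longrightarrow> v = 0"
    and norm_le_iff: "1 \<le> k \<Longrightarrow> x \<in> os_mat E k \<Longrightarrow>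
      os_norm E k x \<le> C \<longleftrightarrow> (\<forall>s\<in>S. os_norm (F s) k (\<lambda>i j. \<pi> s (x i j)) \<le> C)"
begin

lemma \<pi>_0: "s \<in> S \<Longrightarrow> \<pi> s 0 = 0"
  using \<pi>_add[of s 0 0] by simp

lemma \<pi>_diff: "s \<in> S \<Longrightarrow> \<pi> s (v - w) = \<pi> s v - \<pi> s w"
  using \<pi>_add[of s "v - w" w] by simp

lemma \<pi>_sum: "s \<in> S \<Longrightarrow> \<pi> s (\<Sum>t\<in>T. f t) = (\<Sum>t\<in>T. \<pi> s (f t))"
  by (induction T rule: infinite_finite_induct) (auto simp: \<pi>_0 \<pi>_add)

lemma \<pi>_mat: "s \<in> S \<Longrightarrow> x \<in> os_mat E k \<Longrightarrow> (\<lambda>i j. \<pi> s (x i j)) \<in> os_mat (F s) k"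
  by (auto simp: os_mat_def \<pi>_in \<pi>_0)

lemma norm_coordinate_le:
  "1 \<le> k \<Longrightarrow> x \<in> os_mat E k \<Longrightarrow> s \<in> S \<Longrightarrow> os_norm (F s) k (\<lambda>i j. \<pi> s (x i j)) \<le> os_norm E k x"
  using norm_le_iff by blast

lemma Ruan_coordinate: "s \<in> S \<Longrightarrow> Ruan_space (F s)"
  using F by (rule Ruan_space.intro)

lemma matrix_normed_coordinate: "s \<in> S \<Longrightarrow> matrix_normed_space (F s)"
proof -
  assume "s \<in> S"
  then interpret Ruan_space "F s" by (rule Ruan_coordinate)
  show "matrix_normed_space (F s)" by (rule matrix_normed_space_axioms)
qed

lemma matrix_normed: "matrix_normed_space E"
proof (rule matrix_normed_spaceI[OF vs carrier])
  interpret vector_space "os_scale E" by (rule vs)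
  fix k :: nat and x y :: "nat \<Rightarrow> nat \<Rightarrow> 'a" and c assume k: "1 \<le> k" and x: "x \<in> os_mat E k"
  obtain s where s: "s \<in> S" using S_ne by blast
  show "0 \<le> os_norm E k x"
    using matrix_normed_space.norm_nonneg[OF matrix_normed_coordinate[OF s] k \<pi>_mat[OF s x]] norm_coordinate_le[OF k x s] by simp
  show "x = (\<lambda>i j. 0)" if 0: "os_norm E k x = 0"
  proof (intro ext \<pi>_inj)
    fix i j show "x i j \<in> os_carrier E"
      using x subspace_0[OF carrier] by (cases "i < k \<and> j < k") (auto simp: os_mat_def split: if_splits)
    fix s assume s: "s \<in> S"
    have "os_norm (F s) k (\<lambda>i j. \<pi> s (x i j)) = 0"
      using matrix_normed_space.norm_nonneg[OF matrix_normed_coordinate[OF s] k \<pi>_mat[OF s x]] norm_coordinate_le[OF k x s] 0 by simp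
    from matrix_normed_space.norm_0D[OF matrix_normed_coordinate[OF s] k \<pi>_mat[OF s x] this]
    show "\<pi> s (x i j) = 0" by (rule fun_cong[OF fun_cong])
  qed
  have sx: "(\<lambda>i j. os_scale E c (x i j)) \<in> os_mat E k"
    using x carrier by (auto simp: os_mat_def subspace_scale split: if_splits)
  have sn: "os_norm (F s) k (\<lambda>i j. \<pi> s (os_scale E c (x i j))) = cmod c * os_norm (F s) k (\<lambda>i j. \<pi> s (x i j))"
    if s: "s \<in> S" for s
    using matrix_normed_space.norm_scale[OF matrix_normed_coordinate[OF s] k \<pi>_mat[OF s x], of c] by (simp add: \<pi>_scale[OF s])
  show "os_norm E k (\<lambda>i j. os_scale E c (x i j)) \<le> cmod c * os_norm E k x"
    unfolding norm_le_iff[OF k sx]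
    by (intro ballI) (simp add: sn mult_left_mono norm_coordinate_le[OF k x])
  show "os_norm E k (\<lambda>i j. x i j + y i j) \<le> os_norm E k x + os_norm E k y" if y: "y \<in> os_mat E k"
  proof -
    have xy: "(\<lambda>i j. x i j + y i j) \<in> os_mat E k"
      using x y carrier by (auto simp: os_mat_def subspace_add split: if_splits)
    show ?thesis unfolding norm_le_iff[OF k xy]
    proof
      fix s assume s: "s \<in> S"
      show "os_norm (F s) k (\<lambda>i j. \<pi> s (x i j + y i j)) \<le> os_norm E k x + os_norm E k y"
        using matrix_normed_space.norm_add[OF matrix_normed_coordinate[OF s] k \<pi>_mat[OF s x] \<pi>_mat[OF s y]]
          norm_coordinate_le[OF k x s] norm_coordinate_le[OF k y s] by (simp add: \<pi>_add[OF s])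
    qed
  qed
qed

sublocale matrix_normed_space E by (rule matrix_normed)

lemma norm1_coordinate_le:
  assumes "s \<in> S" "v \<in> os_carrier E" shows "os_norm1 (F s) (\<pi> s v) \<le> os_norm1 E v"
proof -
  have "single_entry (\<pi> s v) = (\<lambda>i j. \<pi> s (single_entry v i j))"
    by (auto simp: single_entry_def fun_eq_iff \<pi>_0 assms)
  then show ?thesis using norm_coordinate_le[OF order_refl single_in[OF assms(2)] assms(1)]
    by (simp add: os_norm1_def)
qed

lemma norm1_leI:
  assumes "v \<in> os_carrier E" "\<And>s. s \<in> S \<Longrightarrow> os_norm1 (F s) (\<pi> s v) \<le> C" shows "os_norm1 E v \<le> C"
proof -
  have "single_entry (\<pi> s v) = (\<lambda>i j. \<pi> s (single_entry v i j))" if "s \<in> S" for s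
    by (auto simp: single_entry_def fun_eq_iff \<pi>_0 that)
  then show ?thesis using norm_le_iff[OF order_refl single_in[OF assms(1)], of C] assms(2)
    by (simp add: os_norm1_def)
qed

lemma coordinate_limits:
  assumes "Cauchy_seq f"
  shows "\<exists>L. \<forall>s\<in>S. L s \<in> os_carrier (F s) \<and> (\<lambda>m. os_norm1 (F s) (\<pi> s (f m) - L s)) \<longlonglongrightarrow> 0"
proof -
  have "\<exists>l\<in>os_carrier (F s). (\<lambda>m. os_norm1 (F s) (\<pi> s (f m) - l)) \<longlonglongrightarrow> 0" if s: "s \<in> S" for s
  proof -
    have f: "f m \<in> os_carrier E" for m using assms by (simp add: Cauchy_seq_def)
    have le: "os_norm1 (F s) (\<pi> s (f m) - \<pi> s (f m')) \<le> os_norm1 E (f m - f m')" for m m'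
      using norm1_coordinate_le[OF s subspace_diff[OF carrier f f], of m m'] by (simp add: \<pi>_diff s)
    have "matrix_normed_space.Cauchy_seq (F s) (\<lambda>m. \<pi> s (f m))"
      unfolding matrix_normed_space.Cauchy_seq_def[OF matrix_normed_coordinate[OF s]]
    proof (intro conjI allI impI)
      fix m show "\<pi> s (f m) \<in> os_carrier (F s)" by (rule \<pi>_in[OF s f])
    next
      fix e :: real assume "e > 0"
      then obtain M where "\<And>m m'. m \<ge> M \<Longrightarrow> m' \<ge> M \<Longrightarrow> os_norm1 E (f m - f m') < e"
        using assms unfolding Cauchy_seq_def by blast
      then show "\<exists>M. \<forall>m\<ge>M. \<forall>m'\<ge>M. os_norm1 (F s) (\<pi> s (f m) - \<pi> s (f m')) < e"
        using le by (meson le_less_trans)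
    qed
    then show ?thesis by (rule Ruan_space.complete_seq[OF Ruan_coordinate[OF s]])
  qed
  then show ?thesis by (intro bchoice) blast
qed

text \<open>The Cauchy condition is uniform in the coordinates, and stays so when one index tends to infinity.\<close>

lemma uniform_coordinate_limit:
  assumes f: "Cauchy_seq f"
    and L: "\<And>s. s \<in> S \<Longrightarrow> L s \<in> os_carrier (F s)"
           "\<And>s. s \<in> S \<Longrightarrow> (\<lambda>m. os_norm1 (F s) (\<pi> s (f m) - L s)) \<longlonglongrightarrow> 0"
    and e: "e > 0"
  shows "\<exists>M. \<forall>m\<ge>M. \<forall>s\<in>S. os_norm1 (F s) (\<pi> s (f m) - L s) \<le> e"
proof -
  have fc: "f m \<in> os_carrier E" for m using f by (simp add: Cauchy_seq_def)
  obtain M where M: "\<And>m m'. m \<ge> M \<Longrightarrow> m' \<ge> M \<Longrightarrow> os_norm1 E (f m - f m') < e"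
    using f e unfolding Cauchy_seq_def by blast
  have "os_norm1 (F s) (\<pi> s (f m) - L s) \<le> e" if m: "m \<ge> M" and s: "s \<in> S" for m s
  proof (rule tendsto_lowerbound)
    interpret Fs: matrix_normed_space "F s" by (rule matrix_normed_coordinate[OF s])
    have d: "\<pi> s (f m) - \<pi> s (f m') \<in> os_carrier (F s)" "\<pi> s (f m') - L s \<in> os_carrier (F s)" for m'
      by (intro Fs.subspace_diff Fs.carrier \<pi>_in[OF s fc] L(1)[OF s])+
    show "(\<lambda>m'. e + os_norm1 (F s) (\<pi> s (f m') - L s)) \<longlonglongrightarrow> e"
      using tendsto_add[OF tendsto_const L(2)[OF s], of e] by simp
    show "\<forall>\<^sub>F m' in sequentially. os_norm1 (F s) (\<pi> s (f m) - L s) \<le> e + os_norm1 (F s) (\<pi> s (f m') - L s)"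
      unfolding eventually_sequentially
    proof (intro exI allI impI)
      fix m' assume m': "M \<le> m'"
      have "os_norm1 (F s) (\<pi> s (f m) - \<pi> s (f m')) \<le> e"
        using norm1_coordinate_le[OF s subspace_diff[OF carrier fc fc], of m m'] M[OF m m'] by (simp add: \<pi>_diff s)
      then show "os_norm1 (F s) (\<pi> s (f m) - L s) \<le> e + os_norm1 (F s) (\<pi> s (f m') - L s)"
        using Fs.norm1_add[OF d(1) d(2), of m' m'] by simp
    qed
  qed simp
  then show ?thesis by blast
qed

lemma operator_space_if_complete:
  assumes complete: "\<And>f L. Cauchy_seq f \<Longrightarrow> (\<And>s. s \<in> S \<Longrightarrow> L s \<in> os_carrier (F s)) \<Longrightarrow>
     (\<And>s. s \<in> S \<Longrightarrow> (\<lambda>m. os_norm1 (F s) (\<pi> s (f m) - L s)) \<longlonglongrightarrow> 0) \<Longrightarrow>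
     \<exists>l\<in>os_carrier E. \<forall>s\<in>S. \<pi> s l = L s"
  shows "operator_space E"
proof (rule operator_spaceI[OF matrix_normed])
  fix k l :: nat and x y assume k: "1 \<le> k" and l: "1 \<le> l" and x: "x \<in> os_mat E k" and y: "y \<in> os_mat E l"
  have kl: "1 \<le> k + l" using k by simp
  have "os_norm (F s) (k + l) (\<lambda>i j. \<pi> s (mat_direct_sum k x y i j)) =
    max (os_norm (F s) k (\<lambda>i j. \<pi> s (x i j))) (os_norm (F s) l (\<lambda>i j. \<pi> s (y i j)))" if s: "s \<in> S" for s
  proof -
    have "(\<lambda>i j. \<pi> s (mat_direct_sum k x y i j)) = mat_direct_sum k (\<lambda>i j. \<pi> s (x i j)) (\<lambda>i j. \<pi> s (y i j))"
      by (auto simp: mat_direct_sum_def fun_eq_iff \<pi>_0 s)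
    then show ?thesis using Ruan_space.norm_oplus[OF Ruan_coordinate[OF s] k l \<pi>_mat[OF s x] \<pi>_mat[OF s y]] by simp
  qed
  then show "os_norm E (k + l) (mat_direct_sum k x y) = max (os_norm E k x) (os_norm E l y)"
    by (intro eq_if_same_upper_bounds)
      (auto simp: norm_le_iff[OF k x] norm_le_iff[OF l y] norm_le_iff[OF kl mat_oplus[OF x y]])
next
  fix k l :: nat and x a b assume k: "1 \<le> k" and l: "1 \<le> l" and x: "x \<in> os_mat E k"
    and a: "a \<in> scalar_mat l k" and b: "b \<in> scalar_mat k l"
  show "os_norm E l (mat_sandwich E k a x b) \<le> mat_op_norm a * os_norm E k x * mat_op_norm b"
    unfolding norm_le_iff[OF l mat_sandwich_in[OF x a b]]
  proof
    fix s assume s: "s \<in> S"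
    have "(\<lambda>i j. \<pi> s (mat_sandwich E k a x b i j)) = mat_sandwich (F s) k a (\<lambda>i j. \<pi> s (x i j)) b"
      by (simp add: mat_sandwich_def fun_eq_iff \<pi>_sum \<pi>_scale s)
    then have "os_norm (F s) l (\<lambda>i j. \<pi> s (mat_sandwich E k a x b i j))
      \<le> mat_op_norm a * os_norm (F s) k (\<lambda>i j. \<pi> s (x i j)) * mat_op_norm b"
      using Ruan_space.norm_sandwich[OF Ruan_coordinate[OF s] k l \<pi>_mat[OF s x] a b] by simp
    also have "\<dots> \<le> mat_op_norm a * os_norm E k x * mat_op_norm b"
      by (intro mult_right_mono mult_left_mono norm_coordinate_le k x s mat_op_norm_nonneg
          scalar_mat_bounded[OF a] scalar_mat_bounded[OF b])
    finally show "os_norm (F s) l (\<lambda>i j. \<pi> s (mat_sandwich E k a x b i j))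
      \<le> mat_op_norm a * os_norm E k x * mat_op_norm b" .
  qed
next
  fix f assume f: "Cauchy_seq f"
  obtain L where L: "\<And>s. s \<in> S \<Longrightarrow> L s \<in> os_carrier (F s)"
    "\<And>s. s \<in> S \<Longrightarrow> (\<lambda>m. os_norm1 (F s) (\<pi> s (f m) - L s)) \<longlonglongrightarrow> 0"
    using coordinate_limits[OF f] by blast
  obtain l where l: "l \<in> os_carrier E" "\<And>s. s \<in> S \<Longrightarrow> \<pi> s l = L s"
    using complete[OF f, of L] L by blast
  have fc: "f m \<in> os_carrier E" for m using f by (simp add: Cauchy_seq_def)
  have dc: "f m - l \<in> os_carrier E" for m by (intro subspace_diff carrier fc l)
  have "(\<lambda>m. os_norm1 E (f m - l)) \<longlonglongrightarrow> 0"
  proof (rule LIMSEQ_I)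
    fix e :: real assume e: "e > 0"
    obtain M where M: "\<And>m s. m \<ge> M \<Longrightarrow> s \<in> S \<Longrightarrow> os_norm1 (F s) (\<pi> s (f m) - L s) \<le> e / 2"
      using uniform_coordinate_limit[OF f, of L "e / 2"] L e by force
    have "norm (os_norm1 E (f m - l) - 0) < e" if "m \<ge> M" for m
    proof -
      have "os_norm1 E (f m - l) \<le> e / 2"
        by (rule norm1_leI[OF dc]) (use M that l in \<open>simp add: \<pi>_diff\<close>)
      then show ?thesis using norm1_nonneg[OF dc, of m] e by simp
    qed
    then show "\<exists>M. \<forall>m\<ge>M. norm (os_norm1 E (f m - l) - 0) < e" by blast
  qed
  then show "\<exists>l\<in>os_carrier E. (\<lambda>m. os_norm1 E (f m - l)) \<longlonglongrightarrow> 0" using l by blast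
qed

end

lemma operator_space_sum:
  fixes E F :: "'b::ab_group_add opspace"
  assumes "operator_space E" "operator_space F"
  shows "operator_space (E \<oplus>\<^sub>\<infinity> F)"
proof -
  interpret E: Ruan_space E by (rule Ruan_space.intro) fact
  interpret F: Ruan_space F by (rule Ruan_space.intro) fact
  let ?G = "\<lambda>b. if b then E else F" and ?\<pi> = "\<lambda>b. if b then fst else snd"
  interpret coordinate_space "E \<oplus>\<^sub>\<infinity> F" "UNIV :: bool set" ?G ?\<pi>
  proof (rule coordinate_space.intro)
    show vs: "vector_space (os_scale (E \<oplus>\<^sub>\<infinity> F))"
      by unfold_locales
        (auto simp: os_sum_def E.scale_left_distrib F.scale_left_distrib E.scale_right_distrib F.scale_right_distrib)
    then interpret V: vector_space "os_scale (E \<oplus>\<^sub>\<infinity> F)" .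
    show "V.subspace (os_carrier (E \<oplus>\<^sub>\<infinity> F))"
      by (rule V.subspaceI)
        (auto simp: os_sum_def zero_prod_def E.subspace_0 F.subspace_0 E.subspace_add F.subspace_add
          E.subspace_scale F.subspace_scale E.carrier F.carrier)
    show "v = 0" if "\<And>s. s \<in> UNIV \<Longrightarrow> ?\<pi> s v = 0" for v
      using that[of True] that[of False] by (simp add: prod_eq_iff)
  qed (use assms in \<open>auto simp: os_sum_def\<close>)
  show ?thesis
  proof (rule operator_space_if_complete)
    fix L :: "bool \<Rightarrow> 'b" assume "\<And>s. s \<in> UNIV \<Longrightarrow> L s \<in> os_carrier (?G s)"
    from this[of True] this[of False]
    show "\<exists>l\<in>os_carrier (E \<oplus>\<^sub>\<infinity> F). \<forall>s\<in>UNIV. ?\<pi> s l = L s"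
      by (intro bexI[of _ "(L True, L False)"]) (auto simp: os_sum_def)
  qed
qed

text \<open>The norms of the coordinates are dominated by finite sums of entry norms, which tend to zero; hence
  the supremum that defines the norm is a genuine one.\<close>

lemma os_c0_bdd:
  assumes Z: "operator_space Z" and x: "x \<in> os_mat (os_c0 Z) k" and k: "1 \<le> k"
  shows "bdd_above (range (\<lambda>m. os_norm Z k (\<lambda>i j. x i j m)))"
proof -
  interpret Z: Ruan_space Z by (rule Ruan_space.intro) fact
  have xm: "(\<lambda>i j. x i j m) \<in> os_mat Z k" for m
    using x by (auto simp: os_mat_def os_c0_def split: if_splits)
  have "(\<lambda>m. \<Sum>s\<in>{..<k}\<times>{..<k}. os_norm1 Z (x (fst s) (snd s) m)) \<longlonglongrightarrow> (\<Sum>s\<in>{..<k}\<times>{..<k}. 0)"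
    by (intro tendsto_sum) (use x in \<open>auto simp: os_mat_def os_c0_def split: if_splits\<close>)
  then have "Bseq (\<lambda>m. \<Sum>s\<in>{..<k}\<times>{..<k}. os_norm1 Z (x (fst s) (snd s) m))"
    by (rule convergent_imp_Bseq[OF convergentI])
  then obtain B where B: "\<And>m. norm (\<Sum>s\<in>{..<k}\<times>{..<k}. os_norm1 Z (x (fst s) (snd s) m)) \<le> B"
    unfolding Bseq_def by blast
  show ?thesis
  proof (rule bdd_aboveI2)
    fix m
    show "os_norm Z k (\<lambda>i j. x i j m) \<le> B"
      using Z.norm_le_sum_entries[OF k xm, of m] B[of m] by simp
  qed
qed

lemma os_c0_norm_le_iff:
  assumes "operator_space Z" "x \<in> os_mat (os_c0 Z) k" "1 \<le> k"
  shows "os_norm (os_c0 Z) k x \<le> C \<longleftrightarrow> (\<forall>m. os_norm Z k (\<lambda>i j. x i j m) \<le> C)"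
  using cSUP_le_iff[OF _ os_c0_bdd[OF assms], of C] by (simp add: os_c0_def)

lemma operator_space_c0:
  assumes Z: "operator_space Z"
  shows "operator_space (os_c0 Z)"
proof -
  interpret Z: Ruan_space Z by (rule Ruan_space.intro) fact
  interpret coordinate_space "os_c0 Z" "UNIV :: nat set" "\<lambda>_. Z" "\<lambda>m f. f m"
  proof (rule coordinate_space.intro)
    show vs: "vector_space (os_scale (os_c0 Z))"
      by unfold_locales
        (auto simp: os_c0_def fun_eq_iff Z.scale_left_distrib Z.scale_right_distrib)
    then interpret V: vector_space "os_scale (os_c0 Z)" .
    show "V.subspace (os_carrier (os_c0 Z))"
    proof (rule V.subspaceI)
      show "0 \<in> os_carrier (os_c0 Z)" by (simp add: os_c0_def Z.subspace_0 Z.carrier Z.norm1_0)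
      fix f g assume f: "f \<in> os_carrier (os_c0 Z)" and g: "g \<in> os_carrier (os_c0 Z)"
      have "(\<lambda>m. os_norm1 Z (f m) + os_norm1 Z (g m)) \<longlonglongrightarrow> 0 + 0"
        by (intro tendsto_add) (use f g in \<open>auto simp: os_c0_def\<close>)
      then have "(\<lambda>m. os_norm1 Z (f m) + os_norm1 Z (g m)) \<longlonglongrightarrow> 0" by simp
      then have "(\<lambda>m. os_norm1 Z (f m + g m)) \<longlonglongrightarrow> 0"
        by (rule Lim_null_comparison[OF always_eventually, rotated])
          (use f g in \<open>auto simp: os_c0_def Z.norm1_nonneg Z.norm1_add Z.subspace_add Z.carrier\<close>)
      then show "f + g \<in> os_carrier (os_c0 Z)"
        using f g by (auto simp: os_c0_def intro: Z.subspace_add Z.carrier)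
    next
      fix c f assume f: "f \<in> os_carrier (os_c0 Z)"
      have "(\<lambda>m. cmod c * os_norm1 Z (f m)) \<longlonglongrightarrow> 0"
        by (intro tendsto_mult_right_zero) (use f in \<open>auto simp: os_c0_def\<close>)
      then show "os_scale (os_c0 Z) c f \<in> os_carrier (os_c0 Z)"
        using f by (auto simp: os_c0_def Z.norm1_scale intro: Z.subspace_scale Z.carrier)
    qed
    show "os_norm (os_c0 Z) k x \<le> C \<longleftrightarrow> (\<forall>s\<in>UNIV. os_norm Z k (\<lambda>i j. x i j s) \<le> C)"
      if "1 \<le> k" "x \<in> os_mat (os_c0 Z) k" for k x C
      using os_c0_norm_le_iff[OF Z that(2,1)] by simp
  qed (use Z in \<open>auto simp: os_c0_def fun_eq_iff\<close>)
  show ?thesis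
  proof (rule operator_space_if_complete)
    fix f and L :: "nat \<Rightarrow> 'a" assume f: "Cauchy_seq f" and L: "\<And>s. s \<in> UNIV \<Longrightarrow> L s \<in> os_carrier Z"
      and lim: "\<And>s. s \<in> UNIV \<Longrightarrow> (\<lambda>m. os_norm1 Z (f m s - L s)) \<longlonglongrightarrow> 0"
    have "(\<lambda>s. os_norm1 Z (L s)) \<longlonglongrightarrow> 0"
    proof (rule LIMSEQ_I)
      fix e :: real assume e: "e > 0"
      obtain M where M: "\<And>s. os_norm1 Z (f M s - L s) \<le> e / 2"
        using uniform_coordinate_limit[OF f, of L "e / 2"] L lim e by force
      have "f M \<in> os_carrier (os_c0 Z)" using f by (simp add: Cauchy_seq_def)
      then have fM: "f M s \<in> os_carrier Z" "(\<lambda>s. os_norm1 Z (f M s)) \<longlonglongrightarrow> 0" for s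
        by (auto simp: os_c0_def)
      obtain N where N: "\<And>s. s \<ge> N \<Longrightarrow> norm (os_norm1 Z (f M s) - 0) < e / 2"
        using LIMSEQ_D[OF fM(2), of "e / 2"] e by auto
      have "norm (os_norm1 Z (L s) - 0) < e" if "s \<ge> N" for s
      proof -
        have d: "L s - f M s \<in> os_carrier Z" by (intro Z.subspace_diff Z.carrier L fM) simp
        have "os_norm1 Z (L s) \<le> os_norm1 Z (L s - f M s) + os_norm1 Z (f M s)"
          using Z.norm1_add[OF d fM(1)[of s]] by simp
        then show ?thesis
          using M[of s] N[OF that] Z.norm1_minus_commute[OF L fM(1), of s s] Z.norm1_nonneg[OF L, of s] by simp
      qed
      then show "\<exists>N. \<forall>s\<ge>N. norm (os_norm1 Z (L s) - 0) < e" by blast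
    qed
    then have "L \<in> os_carrier (os_c0 Z)" using L by (simp add: os_c0_def)
    then show "\<exists>l\<in>os_carrier (os_c0 Z). \<forall>s\<in>UNIV. l s = L s" by blast
  qed
qed

section \<open>The Hahn-Banach theorem\<close>

definition sublinear_on :: "(real \<Rightarrow> 'v \<Rightarrow> 'v::ab_group_add) \<Rightarrow> 'v set \<Rightarrow> ('v \<Rightarrow> real) \<Rightarrow> bool" where
  "sublinear_on sc V q \<longleftrightarrow> (\<forall>z\<in>V. \<forall>w\<in>V. q (z + w) \<le> q z + q w) \<and>
     (\<forall>z\<in>V. \<forall>r>0. q (sc r z) = r * q z)"

locale real_subspace = vector_space sc for sc :: "real \<Rightarrow> 'v::ab_group_add \<Rightarrow> 'v" +
  fixes V :: "'v set"
  assumes V: "subspace V"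
begin

lemmas V_closed = subspace_add[OF V] subspace_scale[OF V] subspace_neg[OF V] subspace_0[OF V] subspace_diff[OF V]

lemma sublinear_0: "sublinear_on sc V q \<Longrightarrow> q 0 = 0"
proof -
  assume "sublinear_on sc V q"
  then have "q (sc 2 0) = 2 * q 0" using V_closed(4) unfolding sublinear_on_def by (simp del: scale_zero_right)
  then show "q 0 = 0" by simp
qed

lemma sublinear_neg: "sublinear_on sc V q \<Longrightarrow> z \<in> V \<Longrightarrow> - q (- z) \<le> q z"
proof -
  assume q: "sublinear_on sc V q" and z: "z \<in> V"
  have "q (z + - z) \<le> q z + q (- z)" using q z V_closed(3) unfolding sublinear_on_def by blast
  then show ?thesis using sublinear_0[OF q] by simp
qed

text \<open>
  Lowering a sublinear functional: for a convex cone \<open>K\<close> of pairs \<open>(w, c)\<close> with \<open>c \<le> q w\<close>, the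
  infimal convolution of \<open>q\<close> with \<open>K\<close> is sublinear, lies below \<open>q\<close>, and has a value of at most \<open>-c\<close>
  at \<open>-w\<close>.
\<close>

lemma sublinear_lower:
  assumes q: "sublinear_on sc V q"
    and K0: "(0, 0) \<in> K" and KV: "\<And>w c. (w, c) \<in> K \<Longrightarrow> w \<in> V \<and> c \<le> q w"
    and Kadd: "\<And>w c w' c'. (w, c) \<in> K \<Longrightarrow> (w', c') \<in> K \<Longrightarrow> (w + w', c + c') \<in> K"
    and Kscale: "\<And>w c r. (w, c) \<in> K \<Longrightarrow> r > 0 \<Longrightarrow> (sc r w, r * c) \<in> K"
  obtains q' where "sublinear_on sc V q'" "\<And>z. z \<in> V \<Longrightarrow> q' z \<le> q z" "\<And>z. z \<notin> V \<Longrightarrow> q' z = 0"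
    "\<And>w c. (w, c) \<in> K \<Longrightarrow> q' (- w) \<le> - c"
proof
  define q' where "q' z = (if z \<in> V then (INF k\<in>K. q (z + fst k) - snd k) else 0)" for z
  have q_add: "q (z + w) \<le> q z + q w" if "z \<in> V" "w \<in> V" for z w
    using q that unfolding sublinear_on_def by blast
  have q_scale: "q (sc r z) = r * q z" if "z \<in> V" "r > 0" for z r
    using q that unfolding sublinear_on_def by blast
  have lower: "- q (- z) \<le> q (z + fst k) - snd k" if z: "z \<in> V" and k: "k \<in> K" for z k
  proof -
    have kV: "fst k \<in> V" "snd k \<le> q (fst k)" using KV[of "fst k" "snd k"] k by auto
    have "q (z + fst k + - z) \<le> q (z + fst k) + q (- z)" by (intro q_add V_closed z kV)
    then show ?thesis using kV by simp
  qed
  have bdd: "bdd_below ((\<lambda>k. q (z + fst k) - snd k) ` K)" if "z \<in> V" for z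
    by (rule bdd_belowI2) (rule lower[OF that])
  have le: "q' z \<le> q (z + w) - c" if "z \<in> V" "(w, c) \<in> K" for z w c
    using cINF_lower[OF bdd[OF that(1)] that(2)] that(1) by (simp add: q'_def)
  have ge: "m \<le> q' z" if "z \<in> V" "\<And>w c. (w, c) \<in> K \<Longrightarrow> m \<le> q (z + w) - c" for m z
    unfolding q'_def using that K0 by (auto intro!: cINF_greatest)
  have add: "q' (z + z') \<le> q' z + q' z'" if z: "z \<in> V" "z' \<in> V" for z z'
  proof -
    have 1: "q' (z + z') - (q (z + w) - c) \<le> q' z'" if wc: "(w, c) \<in> K" for w c
    proof (rule ge[OF z(2)])
      fix w' c' assume wc': "(w', c') \<in> K"
      have "q' (z + z') \<le> q ((z + z') + (w + w')) - (c + c')"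
        by (intro le Kadd wc wc' V_closed z)
      also have "(z + z') + (w + w') = (z + w) + (z' + w')" by (simp add: ac_simps)
      also have "q ((z + w) + (z' + w')) \<le> q (z + w) + q (z' + w')"
        by (intro q_add V_closed z) (use KV wc wc' in auto)
      finally show "q' (z + z') - (q (z + w) - c) \<le> q (z' + w') - c'" by simp
    qed
    have "q' (z + z') - q' z' \<le> q' z" by (rule ge[OF z(1)]) (use 1 in force)
    then show ?thesis by simp
  qed
  have scale_le: "q' (sc r z) \<le> r * q' z" if z: "z \<in> V" and r: "r > 0" for r z
  proof -
    have "q' (sc r z) / r \<le> q' z"
    proof (rule ge[OF z])
      fix w c assume wc: "(w, c) \<in> K"
      have "q' (sc r z) \<le> q (sc r z + sc r w) - r * c" by (intro le Kscale wc r V_closed z)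
      also have "sc r z + sc r w = sc r (z + w)" by (simp add: scale_right_distrib)
      also have "q (sc r (z + w)) = r * q (z + w)"
        by (intro q_scale V_closed z r) (use KV wc in auto)
      finally show "q' (sc r z) / r \<le> q (z + w) - c" using r by (simp add: field_simps)
    qed
    then show ?thesis using r by (simp add: field_simps)
  qed
  have scale: "q' (sc r z) = r * q' z" if z: "z \<in> V" and r: "r > 0" for r z
  proof (rule antisym[OF scale_le[OF z r]])
    have "q' (sc (1 / r) (sc r z)) \<le> (1 / r) * q' (sc r z)"
      by (rule scale_le) (use r z V_closed in auto)
    then show "r * q' z \<le> q' (sc r z)" using r by (simp add: field_simps)
  qed
  show "sublinear_on sc V q'" unfolding sublinear_on_def using add scale by blast
  show "q' z \<le> q z" if "z \<in> V" for z using le[OF that K0] by simp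
  show "q' z = 0" if "z \<notin> V" for z using that by (simp add: q'_def)
  show "q' (- w) \<le> - c" if "(w, c) \<in> K" for w c
    using le[OF _ that, of "- w"] KV[OF that] V_closed(3) sublinear_0[OF q] by simp
qed

text \<open>Zorn's lemma: a chain of sublinear functionals below \<open>p\<close> is bounded below by \<open>- p (- z)\<close>, and its
  pointwise infimum is sublinear. Fixing the value zero off \<open>V\<close> makes the order antisymmetric.\<close>

lemma minimal_sublinear:
  assumes p: "sublinear_on sc V p"
  obtains g where "sublinear_on sc V g" "\<And>z. z \<in> V \<Longrightarrow> g z \<le> p z"
    "\<And>q. sublinear_on sc V q \<Longrightarrow> (\<And>z. z \<in> V \<Longrightarrow> q z \<le> g z) \<Longrightarrow> (\<And>z. z \<notin> V \<Longrightarrow> q z = 0) \<Longrightarrow> q = g"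
proof -
  define A where "A = {q. sublinear_on sc V q \<and> (\<forall>z\<in>V. q z \<le> p z) \<and> (\<forall>z. z \<notin> V \<longrightarrow> q z = 0)}"
  define R where "R a b \<longleftrightarrow> (\<forall>z\<in>V. b z \<le> a z)" for a b :: "'v \<Rightarrow> real"
  have po: "partial_order_on A (relation_of R A)"
    unfolding partial_order_on_def preorder_on_def
  proof (intro conjI)
    show "refl_on A (relation_of R A)" by (auto simp: refl_on_def relation_of_def R_def)
    show "trans (relation_of R A)" by (force simp: trans_def relation_of_def R_def)
    show "relation_of R A \<subseteq> A \<times> A" by (auto simp: relation_of_def)
    show "antisym (relation_of R A)"
    proof (rule antisymI)
      fix a b assume ab: "(a, b) \<in> relation_of R A" "(b, a) \<in> relation_of R A"
      have "a z = b z" for z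
        using ab by (cases "z \<in> V") (auto simp: relation_of_def R_def A_def intro: antisym)
      then show "a = b" by blast
    qed
  qed
  have chain: "\<exists>u\<in>A. \<forall>a\<in>C. R a u" if C: "C \<in> Chains (relation_of R A)" for C
  proof (cases "C = {}")
    case True
    have "(\<lambda>z. if z \<in> V then p z else 0) \<in> A"
      using p V_closed by (auto simp: A_def sublinear_on_def)
    then show ?thesis using True by blast
  next
    case False
    have CA: "C \<subseteq> A" and tot: "\<And>a b. a \<in> C \<Longrightarrow> b \<in> C \<Longrightarrow> R a b \<or> R b a"
      using C unfolding Chains_def relation_of_def by auto
    define u where "u z = (INF a\<in>C. a z)" for z
    have sub: "sublinear_on sc V a" and lep: "\<And>z. z \<in> V \<Longrightarrow> a z \<le> p z" if "a \<in> C" for a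
      using CA that by (auto simp: A_def)
    have bdd: "bdd_below ((\<lambda>a. a z) ` C)" if z: "z \<in> V" for z
    proof (rule bdd_belowI2)
      fix a assume a: "a \<in> C"
      show "- p (- z) \<le> a z"
        using sublinear_neg[OF sub[OF a] z] lep[OF a, of "- z"] V_closed(3)[OF z] by simp
    qed
    have le: "u z \<le> a z" if "z \<in> V" "a \<in> C" for z a
      unfolding u_def using cINF_lower[OF bdd[OF that(1)] that(2)] .
    have ge: "m \<le> u z" if "\<And>a. a \<in> C \<Longrightarrow> m \<le> a z" for m z
      unfolding u_def using False that by (rule cINF_greatest)
    have add: "u (z + w) \<le> u z + u w" if zw: "z \<in> V" "w \<in> V" for z w
    proof -
      have 1: "u (z + w) - a z \<le> b w" if a: "a \<in> C" and b: "b \<in> C" for a b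
      proof -
        obtain d where d: "d \<in> C" "d z \<le> a z" "d w \<le> b w"
          using tot[OF a b] a b zw unfolding R_def by blast
        have "u (z + w) \<le> d (z + w)" by (intro le d V_closed zw)
        also have "\<dots> \<le> d z + d w" using sub[OF d(1)] zw unfolding sublinear_on_def by blast
        finally show ?thesis using d by simp
      qed
      have "u (z + w) - a z \<le> u w" if "a \<in> C" for a by (rule ge) (rule 1[OF that])
      then have "u (z + w) - u w \<le> a z" if "a \<in> C" for a using that by fastforce
      then have "u (z + w) - u w \<le> u z" by (rule ge)
      then show ?thesis by simp
    qed
    have hom: "a (sc r z) = r * a z" if "a \<in> C" "z \<in> V" "r > 0" for a r z
      using sub[OF that(1)] that unfolding sublinear_on_def by blast
    have scale: "u (sc r z) = r * u z" if z: "z \<in> V" and r: "r > 0" for r z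
    proof (rule antisym)
      have "u (sc r z) / r \<le> u z"
      proof (rule ge)
        fix a assume a: "a \<in> C"
        show "u (sc r z) / r \<le> a z"
          using le[OF V_closed(2)[OF z] a, of r] hom[OF a z r] r by (simp add: field_simps)
      qed
      then show "u (sc r z) \<le> r * u z" using r by (simp add: field_simps)
      show "r * u z \<le> u (sc r z)"
      proof (rule ge)
        fix a assume a: "a \<in> C"
        show "r * u z \<le> a (sc r z)" using le[OF z a] r by (simp add: hom[OF a z r])
      qed
    qed
    have "u \<in> A"
      unfolding A_def
    proof (intro CollectI conjI ballI allI impI)
      show "sublinear_on sc V u" unfolding sublinear_on_def using add scale by blast
      obtain a where a: "a \<in> C" using False by blast
      show "u z \<le> p z" if "z \<in> V" for z using le[OF that a] lep[OF a that] by simp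
      show "u z = 0" if "z \<notin> V" for z
      proof -
        have "a z = 0" if "a \<in> C" for a using CA that \<open>z \<notin> V\<close> by (auto simp: A_def)
        then have "(\<lambda>a. a z) ` C = (\<lambda>a. 0) ` C" by (intro image_cong) auto
        then show ?thesis using False by (simp add: u_def image_constant_conv)
      qed
    qed
    then show ?thesis using le unfolding R_def by blast
  qed
  obtain g where g: "g \<in> A" and gmin: "\<And>q. q \<in> A \<Longrightarrow> R g q \<Longrightarrow> q = g"
    using predicate_Zorn[OF po chain] by blast
  show thesis
  proof (rule that)
    show "sublinear_on sc V g" and gp: "\<And>z. z \<in> V \<Longrightarrow> g z \<le> p z" using g by (auto simp: A_def)
    fix q assume q: "sublinear_on sc V q" "\<And>z. z \<in> V \<Longrightarrow> q z \<le> g z" "\<And>z. z \<notin> V \<Longrightarrow> q z = 0"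
    then have "q \<in> A" using gp by (fastforce simp: A_def)
    then show "q = g" by (rule gmin) (use q in \<open>simp add: R_def\<close>)
  qed
qed

text \<open>A minimal sublinear functional \<open>g\<close> is odd: lowering it along the ray through \<open>w\<close> with slope \<open>g w\<close>
  does not change it, so that \<open>g (- w) \<le> - g w\<close>. An odd sublinear functional is linear.\<close>

lemma linear_below_sublinear:
  assumes p: "sublinear_on sc V p"
  obtains g where "\<And>z w. z \<in> V \<Longrightarrow> w \<in> V \<Longrightarrow> g (z + w) = g z + g w"
    "\<And>r z. z \<in> V \<Longrightarrow> g (sc r z) = r * g z" "\<And>z. z \<in> V \<Longrightarrow> g z \<le> p z"
proof -
  obtain g where g: "sublinear_on sc V g" "\<And>z. z \<in> V \<Longrightarrow> g z \<le> p z"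
    and gmin: "\<And>q. sublinear_on sc V q \<Longrightarrow> (\<And>z. z \<in> V \<Longrightarrow> q z \<le> g z) \<Longrightarrow> (\<And>z. z \<notin> V \<Longrightarrow> q z = 0) \<Longrightarrow> q = g"
    using minimal_sublinear[OF p] by blast
  have g_add: "g (z + w) \<le> g z + g w" if "z \<in> V" "w \<in> V" for z w
    using g(1) that unfolding sublinear_on_def by blast
  have g_scale: "g (sc r z) = r * g z" if "z \<in> V" "r > 0" for z r
    using g(1) that unfolding sublinear_on_def by blast
  have neg: "g (- w) = - g w" if w: "w \<in> V" for w
  proof (rule antisym)
    let ?K = "{(sc r w, r * g w) | r. r \<ge> 0}"
    obtain q' where q': "sublinear_on sc V q'" "\<And>z. z \<in> V \<Longrightarrow> q' z \<le> g z" "\<And>z. z \<notin> V \<Longrightarrow> q' z = 0"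
      "\<And>v c. (v, c) \<in> ?K \<Longrightarrow> q' (- v) \<le> - c"
    proof (rule sublinear_lower[OF g(1), of ?K])
      show "(0, 0) \<in> ?K" by (intro CollectI exI[of _ 0]) simp
      show "v \<in> V \<and> c \<le> g v" if vc: "(v, c) \<in> ?K" for v c
      proof -
        obtain r where r: "v = sc r w" "c = r * g w" "r \<ge> 0" using vc by blast
        then show ?thesis using g_scale[OF w, of r] V_closed(2)[OF w] V_closed(4) sublinear_0[OF g(1)]
          by (cases "r = 0") auto
      qed
      show "(v + v', c + c') \<in> ?K" if vc: "(v, c) \<in> ?K" "(v', c') \<in> ?K" for v c v' c'
      proof -
        obtain r r' where "v = sc r w" "c = r * g w" "r \<ge> 0" "v' = sc r' w" "c' = r' * g w" "r' \<ge> 0"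
          using vc by blast
        then show ?thesis by (intro CollectI exI[of _ "r + r'"]) (simp add: scale_left_distrib distrib_right)
      qed
      show "(sc r v, r * c) \<in> ?K" if vc: "(v, c) \<in> ?K" and r: "r > 0" for v c r
      proof -
        obtain r' where "v = sc r' w" "c = r' * g w" "r' \<ge> 0" using vc by blast
        then show ?thesis using r by (intro CollectI exI[of _ "r * r'"]) simp
      qed
    qed (use that in blast)
    have "q' = g" by (rule gmin) (use q' in auto)
    moreover have "(w, g w) \<in> ?K" by (intro CollectI exI[of _ 1]) simp
    ultimately show "g (- w) \<le> - g w" using q'(4) by blast
    show "- g w \<le> g (- w)" using sublinear_neg[OF g(1) V_closed(3)[OF w]] by simp
  qed
  show thesis
  proof (rule that)
    show "g (z + w) = g z + g w" if "z \<in> V" "w \<in> V" for z w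
      using g_add[OF that] g_add[OF V_closed(3)[OF that(1)] V_closed(3)[OF that(2)]] neg that V_closed(1)[OF that]
        neg[OF V_closed(1)[OF that]] by (simp add: minus_add_distrib)
    show "g (sc r z) = r * g z" if z: "z \<in> V" for r z
    proof -
      consider "r > 0" | "r = 0" | "r < 0" by linarith
      then show ?thesis
      proof cases
        case 3
        have "g (- sc (- r) z) = - ((- r) * g z)"
          using 3 z V_closed(2) by (simp add: neg g_scale del: scale_minus_left)
        then show ?thesis by simp
      qed (use g_scale z sublinear_0[OF g(1)] in auto)
    qed
  qed (use g in blast)
qed

text \<open>Lower \<open>p\<close> along the graph of \<open>f\<close>; every linear functional below the result agrees with \<open>f\<close> on \<open>U\<close>.\<close>

theorem hahn_banach_real:
  assumes p: "sublinear_on sc V p" and U: "subspace U" "U \<subseteq> V"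
    and f_add: "\<And>z w. z \<in> U \<Longrightarrow> w \<in> U \<Longrightarrow> f (z + w) = f z + f w"
    and f_scale: "\<And>r z. z \<in> U \<Longrightarrow> f (sc r z) = r * f z"
    and fp: "\<And>z. z \<in> U \<Longrightarrow> f z \<le> p z"
  obtains g where "\<And>z w. z \<in> V \<Longrightarrow> w \<in> V \<Longrightarrow> g (z + w) = g z + g w"
    "\<And>r z. z \<in> V \<Longrightarrow> g (sc r z) = r * g z" "\<And>z. z \<in> V \<Longrightarrow> g z \<le> p z" "\<And>z. z \<in> U \<Longrightarrow> g z = f z"
proof -
  have f0: "f 0 = 0" using f_scale[OF subspace_0[OF U(1)], of 0] by simp
  let ?K = "{(u, f u) | u. u \<in> U}"
  obtain q where q: "sublinear_on sc V q" "\<And>z. z \<in> V \<Longrightarrow> q z \<le> p z"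
    and qK: "\<And>w c. (w, c) \<in> ?K \<Longrightarrow> q (- w) \<le> - c"
  proof (rule sublinear_lower[OF p, of ?K])
    show "(0, 0) \<in> ?K" using f0 subspace_0[OF U(1)] by force
    show "(w + w', c + c') \<in> ?K" if "(w, c) \<in> ?K" "(w', c') \<in> ?K" for w c w' c'
      using that f_add subspace_add[OF U(1)] by force
    show "(sc r w, r * c) \<in> ?K" if "(w, c) \<in> ?K" "r > 0" for w c r
      using that f_scale subspace_scale[OF U(1)] by force
    show "w \<in> V \<and> c \<le> p w" if "(w, c) \<in> ?K" for w c using that U fp by auto
  qed (use that in blast)
  obtain g where g: "\<And>z w. z \<in> V \<Longrightarrow> w \<in> V \<Longrightarrow> g (z + w) = g z + g w"
    "\<And>r z. z \<in> V \<Longrightarrow> g (sc r z) = r * g z" "\<And>z. z \<in> V \<Longrightarrow> g z \<le> q z"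
    using linear_below_sublinear[OF q(1)] by blast
  have ge: "f z \<le> g z" if z: "z \<in> U" for z
  proof -
    have zV: "z \<in> V" using z U by blast
    have "g (- z) \<le> - f z" using g(3)[OF V_closed(3)[OF zV]] qK[of z "f z"] z by force
    moreover have "g (- z) = - g z" using g(2)[OF zV, of "-1"] by simp
    ultimately show ?thesis by simp
  qed
  show thesis
  proof (rule that[OF g(1) g(2)])
    show "g z \<le> p z" if "z \<in> V" for z using g(3)[OF that] q(2)[OF that] by simp
    show "g z = f z" if z: "z \<in> U" for z
    proof (rule antisym[OF _ ge[OF z]])
      have "f (- z) = - f z" using f_scale[OF z, of "-1"] by simp
      moreover have "g (- z) = - g z" using g(2)[of z "-1"] z U by auto
      ultimately show "g z \<le> f z" using ge[OF subspace_neg[OF U(1) z]] by simp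
    qed
  qed
qed

end

theorem hahn_banach_complex:
  fixes sc :: "complex \<Rightarrow> 'v::ab_group_add \<Rightarrow> 'v" and f :: "'v \<Rightarrow> complex"
  assumes vs: "vector_space sc" and subV: "module.subspace sc V" and U: "module.subspace sc U" "U \<subseteq> V"
    and p_add: "\<And>z w. z \<in> V \<Longrightarrow> w \<in> V \<Longrightarrow> p (z + w) \<le> p z + p w"
    and p_scale: "\<And>c z. z \<in> V \<Longrightarrow> p (sc c z) \<le> cmod c * p z"
    and f_add: "\<And>z w. z \<in> U \<Longrightarrow> w \<in> U \<Longrightarrow> f (z + w) = f z + f w"
    and f_scale: "\<And>c z. z \<in> U \<Longrightarrow> f (sc c z) = c * f z"
    and fp: "\<And>z. z \<in> U \<Longrightarrow> cmod (f z) \<le> p z"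
  obtains g where "\<And>z w. z \<in> V \<Longrightarrow> w \<in> V \<Longrightarrow> g (z + w) = g z + g w"
    "\<And>c z. z \<in> V \<Longrightarrow> g (sc c z) = c * g z" "\<And>z. z \<in> V \<Longrightarrow> cmod (g z) \<le> p z" "\<And>z. z \<in> U \<Longrightarrow> g z = f z"
proof -
  interpret C: vector_space sc by (rule vs)
  let ?r = "\<lambda>r. sc (complex_of_real r)"
  have vsr: "vector_space ?r"
    by unfold_locales (auto simp: C.scale_left_distrib C.scale_right_distrib)
  interpret R: vector_space ?r by (rule vsr)
  have VR: "R.subspace V" and UR: "R.subspace U"
    using subV U by (auto simp: R.subspace_def C.subspace_def)
  interpret real_subspace ?r V by unfold_locales (rule VR)
  have p_hom: "p (?r r z) = r * p z" if z: "z \<in> V" and r: "r > 0" for r z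
  proof (rule antisym)
    show "p (?r r z) \<le> r * p z" using p_scale[OF z, of "of_real r"] r by simp
    have "p (?r (1 / r) (?r r z)) \<le> cmod (of_real (1 / r)) * p (?r r z)"
      by (intro p_scale C.subspace_scale subV z)
    then show "r * p z \<le> p (?r r z)" using r by (simp add: field_simps norm_divide)
  qed
  have psub: "sublinear_on ?r V p" unfolding sublinear_on_def using p_add p_hom by blast
  obtain h where h_add: "\<And>z w. z \<in> V \<Longrightarrow> w \<in> V \<Longrightarrow> h (z + w) = h z + h w"
    and h_scale: "\<And>r z. z \<in> V \<Longrightarrow> h (?r r z) = r * h z" and hp: "\<And>z. z \<in> V \<Longrightarrow> h z \<le> p z"
    and hf: "\<And>z. z \<in> U \<Longrightarrow> h z = Re (f z)"
  proof (rule hahn_banach_real[OF psub UR U(2), of "\<lambda>z. Re (f z)"])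
    show "Re (f z) \<le> p z" if "z \<in> U" for z using fp[OF that] complex_Re_le_cmod order_trans by blast
  qed (use f_add f_scale that in auto)
  \<comment> \<open>A complex linear functional is determined by its real part \<open>h\<close>.\<close>
  define g where "g z = Complex (h z) (- h (sc \<i> z))" for z
  have iV: "sc c z \<in> V" if "z \<in> V" for c z using C.subspace_scale[OF subV that] .
  have g_add: "g (z + w) = g z + g w" if "z \<in> V" "w \<in> V" for z w
    using that by (simp add: g_def h_add iV C.scale_right_distrib complex_eq_iff)
  have g_real: "g (?r r z) = of_real r * g z" if z: "z \<in> V" for r z
  proof -
    have "sc \<i> (?r r z) = ?r r (sc \<i> z)" by (simp add: mult.commute)
    then show ?thesis
      unfolding g_def using h_scale[OF z] h_scale[OF iV[OF z], of r \<i>]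
      by (simp del: C.scale_scale add: complex_eq_iff)
  qed
  have g_i: "g (sc \<i> z) = \<i> * g z" if z: "z \<in> V" for z
    using h_scale[OF z, of "-1"] by (simp add: g_def complex_eq_iff)
  have g_scale: "g (sc c z) = c * g z" if z: "z \<in> V" for c z
  proof -
    have "sc c z = ?r (Re c) z + ?r (Im c) (sc \<i> z)"
      by (subst complex_eq[of c]) (simp add: C.scale_left_distrib mult.commute)
    then have "g (sc c z) = of_real (Re c) * g z + of_real (Im c) * (\<i> * g z)"
      using z by (simp only: g_add g_real g_i iV)
    also have "\<dots> = (of_real (Re c) + \<i> * of_real (Im c)) * g z" by (simp add: algebra_simps)
    finally show ?thesis by (simp only: complex_eq[symmetric])
  qed
  show thesis
  proof (rule that[OF g_add g_scale])
    show "cmod (g z) \<le> p z" if z: "z \<in> V" for z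
    proof (cases "g z = 0")
      case True
      have "0 = h (?r 0 z)" using h_scale[OF z, of 0] by simp
      moreover have "0 = Re (g z)" using True by simp
      ultimately show ?thesis using True hp[OF z] by (simp add: g_def)
    next
      case False
      define c where "c = of_real (cmod (g z)) / g z"
      have c: "cmod c = 1" "c * g z = of_real (cmod (g z))" using False by (auto simp: c_def norm_divide)
      have "cmod (g z) = Re (g (sc c z))" by (simp only: g_scale[OF z] c Re_complex_of_real)
      also have "\<dots> = h (sc c z)" by (simp add: g_def)
      also have "\<dots> \<le> p (sc c z)" by (rule hp[OF iV[OF z]])
      also have "\<dots> \<le> p z" using p_scale[OF z, of c] c by simp
      finally show ?thesis .
    qed
    show "g z = f z" if z: "z \<in> U" for z
      using hf[OF z] hf[OF C.subspace_scale[OF U(1) z], of \<i>] f_scale[OF z, of \<i>]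
      by (simp add: g_def complex_eq_iff)
  qed
qed

section \<open>A norm on finite matrices dual to complete boundedness\<close>

lemma sum_lessThan_add:
  fixes f :: "nat \<Rightarrow> 'a::comm_monoid_add"
  shows "(\<Sum>p<k + l. f p) = (\<Sum>p<k. f p) + (\<Sum>p<l. f (k + p))"
  by (induction l) (auto simp: ac_simps)

text \<open>The functionals \<open>t p q\<close> are the entries of a map into matrices, which is completely bounded with
  constant \<open>C\<close>.\<close>

definition cb_form :: "('y::ab_group_add) opspace \<Rightarrow> real \<Rightarrow> (nat \<Rightarrow> nat \<Rightarrow> 'y \<Rightarrow> complex) \<Rightarrow> bool" where
  "cb_form Y C t \<longleftrightarrow> (\<forall>k\<ge>1. \<forall>x\<in>os_mat Y k. form_bound (\<lambda>(i, p) (j, q). t p q (x i j)) (C * os_norm Y k x))"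

definition functional_on :: "('y::ab_group_add) opspace \<Rightarrow> ('y \<Rightarrow> complex) \<Rightarrow> bool" where
  "functional_on Y \<phi> \<longleftrightarrow> (\<forall>v\<in>os_carrier Y. \<forall>w\<in>os_carrier Y. \<phi> (v + w) = \<phi> v + \<phi> w) \<and>
     (\<forall>c. \<forall>v\<in>os_carrier Y. \<phi> (os_scale Y c v) = c * \<phi> v)"

definition hs_sq :: "nat \<Rightarrow> nat \<Rightarrow> (nat \<Rightarrow> nat \<Rightarrow> complex) \<Rightarrow> real" where
  "hs_sq N k a = (\<Sum>i<N. \<Sum>p<k. (cmod (a i p))\<^sup>2)"

lemma hs_sq_nonneg: "0 \<le> hs_sq N k a"
  by (simp add: hs_sq_def sum_nonneg)

lemma hs_sq_mono_rows:
  assumes "a \<in> scalar_mat N k" "N \<le> M" shows "hs_sq M k a = hs_sq N k a"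
  unfolding hs_sq_def by (rule sum.mono_neutral_right) (use assms in \<open>auto simp: scalar_mat_def\<close>)

lemma hs_sq_mono_cols:
  assumes "a \<in> scalar_mat k N" "N \<le> M" shows "hs_sq k M a = hs_sq k N a"
  unfolding hs_sq_def
  by (intro sum.cong refl sum.mono_neutral_right) (use assms in \<open>auto simp: scalar_mat_def\<close>)

text \<open>The infimum over \<open>s\<close> on the right is \<open>A * B\<close>, also if it is not attained because \<open>A\<close> or \<open>B\<close>
  vanishes.\<close>

lemma le_mult_if_le_all_weighted:
  fixes A B g :: real
  assumes A: "0 \<le> A" and B: "0 \<le> B" and le: "\<And>s. s > 0 \<Longrightarrow> g \<le> (s * A\<^sup>2 + B\<^sup>2 / s) / 2"
  shows "g \<le> A * B"
proof -
  consider "A > 0" "B > 0" | "A = 0" | "B = 0" using A B by linarith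
  then show ?thesis
  proof cases
    case 1
    then have "(B / A * A\<^sup>2 + B\<^sup>2 / (B / A)) / 2 = A * B" by (simp add: power2_eq_square field_simps)
    then show ?thesis using le[of "B / A"] 1 by simp
  next
    case 2
    have "g \<le> e" if e: "e > 0" for e
    proof -
      note le[OF divide_pos_pos[OF add_nonneg_pos[OF zero_le_power2[of B] zero_less_one] e]]
      also have "((B\<^sup>2 + 1) / e * A\<^sup>2 + B\<^sup>2 / ((B\<^sup>2 + 1) / e)) / 2 = B\<^sup>2 / ((B\<^sup>2 + 1) / e) / 2"
        using 2 by simp
      also have "B\<^sup>2 / ((B\<^sup>2 + 1) / e) / 2 = e * (B\<^sup>2 / (B\<^sup>2 + 1)) / 2" by simp
      also have "\<dots> \<le> e * 1 / 2" using e
        by (intro divide_right_mono mult_left_mono) (auto simp: divide_le_eq not_less add_nonneg_nonneg)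
      finally show ?thesis using e by simp
    qed
    then have "g \<le> 0" by (rule field_le_epsilon) simp
    then show ?thesis using 2 by simp
  next
    case 3
    have "g \<le> e" if e: "e > 0" for e
    proof -
      note le[OF divide_pos_pos[OF e add_nonneg_pos[OF zero_le_power2[of A] zero_less_one]]]
      also have "(e / (A\<^sup>2 + 1) * A\<^sup>2 + B\<^sup>2 / (e / (A\<^sup>2 + 1))) / 2 = e / (A\<^sup>2 + 1) * A\<^sup>2 / 2"
        using 3 by simp
      also have "e / (A\<^sup>2 + 1) * A\<^sup>2 / 2 = e * (A\<^sup>2 / (A\<^sup>2 + 1)) / 2" by simp
      also have "\<dots> \<le> e * 1 / 2" using e
        by (intro divide_right_mono mult_left_mono) (auto simp: divide_le_eq not_less add_nonneg_nonneg)
      finally show ?thesis using e by simp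
    qed
    then have "g \<le> 0" by (rule field_le_epsilon) simp
    then show ?thesis using 3 by simp
  qed
qed

context matrix_normed_space
begin

lemma os_mat_mono: "z \<in> os_mat E N \<Longrightarrow> N \<le> M \<Longrightarrow> z \<in> os_mat E M"
  by (rule matI) (auto simp: mat_entry mat_outside)

definition fin_mats :: "(nat \<Rightarrow> nat \<Rightarrow> 'a) set" where
  "fin_mats = (\<Union>N. os_mat E N)"

definition mscale :: "complex \<Rightarrow> (nat \<Rightarrow> nat \<Rightarrow> 'a) \<Rightarrow> nat \<Rightarrow> nat \<Rightarrow> 'a" where
  "mscale c z = (\<lambda>i j. os_scale E c (z i j))"

lemma vs_mscale: "vector_space mscale"
  by unfold_locales (auto simp: mscale_def fun_eq_iff scale_right_distrib scale_left_distrib)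

lemma fin_matsI: "z \<in> os_mat E N \<Longrightarrow> z \<in> fin_mats"
  by (auto simp: fin_mats_def)

lemma fin_mats_common_size:
  assumes "z \<in> fin_mats" "z' \<in> fin_mats"
  obtains N where "z \<in> os_mat E N" "z' \<in> os_mat E N"
proof -
  obtain N N' where "z \<in> os_mat E N" "z' \<in> os_mat E N'" using assms by (auto simp: fin_mats_def)
  then show thesis by (intro that[of "max N N'"]) (auto intro: os_mat_mono)
qed

lemma subspace_fin_mats: "module.subspace mscale fin_mats"
proof -
  interpret M: vector_space mscale by (rule vs_mscale)
  show ?thesis
  proof (rule M.subspaceI)
    show "0 \<in> fin_mats" using fin_matsI[OF mat_0] by (simp add: zero_fun_def)
    show "z + z' \<in> fin_mats" if "z \<in> fin_mats" "z' \<in> fin_mats" for z z'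
      by (rule fin_mats_common_size[OF that]) (use fin_matsI[OF mat_add] in \<open>simp add: plus_fun_def\<close>)
    show "mscale c z \<in> fin_mats" if "z \<in> fin_mats" for c z
      using that mat_scale unfolding fin_mats_def mscale_def by blast
  qed
qed

end

context Ruan_space
begin

lemma sandwich_scale:
  "mat_sandwich E k (\<lambda>i p. \<alpha> * a i p) (\<lambda>i j. os_scale E \<beta> (x i j)) (\<lambda>i j. \<gamma> * b i j) =
    mscale (\<alpha> * \<beta> * \<gamma>) (mat_sandwich E k a x b)"
  by (simp add: mat_sandwich_def mscale_def scale_sum_right mult_ac)

text \<open>
  The values \<open>(\<parallel>a\<parallel>\<^sup>2 + \<parallel>b\<parallel>\<^sup>2) / 2\<close>, in Hilbert-Schmidt norms, over all factorisations \<open>z = a x b\<close> with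
  \<open>\<parallel>x\<parallel> \<le> 1\<close>; their infimum is the projective-type norm of a finite matrix \<open>z\<close> whose dual
  consists of the completely bounded maps.
\<close>

definition factor_costs :: "(nat \<Rightarrow> nat \<Rightarrow> 'a) \<Rightarrow> real set" where
  "factor_costs z = {(hs_sq N k a + hs_sq k N b) / 2 | N k a x b. 1 \<le> k \<and> x \<in> os_mat E k \<and> os_norm E k x \<le> 1 \<and>
     a \<in> scalar_mat N k \<and> b \<in> scalar_mat k N \<and> z = mat_sandwich E k a x b}"

definition factor_norm :: "(nat \<Rightarrow> nat \<Rightarrow> 'a) \<Rightarrow> real" where
  "factor_norm z = Inf (factor_costs z)"

lemma factor_costsI:
  "1 \<le> k \<Longrightarrow> x \<in> os_mat E k \<Longrightarrow> os_norm E k x \<le> 1 \<Longrightarrow> a \<in> scalar_mat N k \<Longrightarrow> b \<in> scalar_mat k N \<Longrightarrow>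
   (hs_sq N k a + hs_sq k N b) / 2 \<in> factor_costs (mat_sandwich E k a x b)"
  unfolding factor_costs_def by blast

lemma factor_costs_nonneg: "r \<in> factor_costs z \<Longrightarrow> 0 \<le> r"
  unfolding factor_costs_def by clarify (intro divide_nonneg_pos add_nonneg_nonneg hs_sq_nonneg, simp)

lemma factor_norm_le: "r \<in> factor_costs z \<Longrightarrow> factor_norm z \<le> r"
  unfolding factor_norm_def by (intro cInf_lower bdd_belowI[of _ 0] factor_costs_nonneg)

text \<open>Multiplying \<open>a\<close> and dividing \<open>b\<close> by a common factor turns the arithmetic mean in the cost into the
  geometric mean.\<close>

lemma sandwich_factor_norm:
  assumes k: "1 \<le> k" and x: "x \<in> os_mat E k" and a: "a \<in> scalar_mat N k" and b: "b \<in> scalar_mat k N"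
  shows "factor_norm (mat_sandwich E k a x b) \<le> os_norm E k x * sqrt (hs_sq N k a) * sqrt (hs_sq k N b)"
    "factor_costs (mat_sandwich E k a x b) \<noteq> {}"
proof -
  let ?\<nu> = "os_norm E k x"
  have cost: "(s * (sqrt (hs_sq N k a))\<^sup>2 + (?\<nu> * sqrt (hs_sq k N b))\<^sup>2 / s) / 2 \<in> factor_costs (mat_sandwich E k a x b)"
    if s: "s > 0" for s
  proof -
    obtain y where y: "y \<in> os_mat E k" "os_norm E k y \<le> 1" "x = (\<lambda>i j. os_scale E (of_real ?\<nu>) (y i j))"
    proof (cases "?\<nu> = 0")
      case True
      then have "x = (\<lambda>i j. 0)" using norm_0D[OF k x] by simp
      then show ?thesis using that[of "\<lambda>i j. 0"] mat_0 norm_zero[OF k] by simp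
    next
      case False
      let ?y = "\<lambda>i j. os_scale E (1 / of_real ?\<nu>) (x i j)"
      have "os_norm E k ?y = 1"
        using norm_scale[OF k x, of "1 / of_real ?\<nu>"] norm_nonneg[OF k x] False by (simp add: norm_divide)
      then show ?thesis using that[of ?y] mat_scale[OF x] False by simp
    qed
    let ?a = "\<lambda>i p. of_real (sqrt s) * a i p" and ?b = "\<lambda>q j. of_real (?\<nu> / sqrt s) * b q j"
    have ss: "sqrt s \<noteq> 0" using s by simp
    have "mat_sandwich E k a x b = mat_sandwich E k (\<lambda>i p. 1 * a i p) (\<lambda>i j. os_scale E (of_real ?\<nu>) (y i j)) (\<lambda>i j. 1 * b i j)"
      using y(3) by simp
    also have "\<dots> = mat_sandwich E k ?a (\<lambda>i j. os_scale E 1 (y i j)) ?b"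
      unfolding sandwich_scale using ss by (simp flip: of_real_mult of_real_divide)
    finally have eq: "mat_sandwich E k a x b = mat_sandwich E k ?a y ?b" by simp
    have "(hs_sq N k ?a + hs_sq k N ?b) / 2 \<in> factor_costs (mat_sandwich E k ?a y ?b)"
      by (intro factor_costsI k y) (use a b in \<open>auto simp: scalar_mat_def\<close>)
    moreover have "hs_sq N k ?a = s * (sqrt (hs_sq N k a))\<^sup>2"
      using s by (simp add: hs_sq_nonneg) (simp add: hs_sq_def norm_mult power_mult_distrib sum_distrib_left)
    moreover have "hs_sq k N ?b = (?\<nu> * sqrt (hs_sq k N b))\<^sup>2 / s"
      using s by (simp add: hs_sq_nonneg power_mult_distrib)
        (simp add: hs_sq_def norm_mult norm_divide power_mult_distrib power_divide sum_distrib_left sum_divide_distrib)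
    ultimately show ?thesis unfolding eq by simp
  qed
  show "factor_norm (mat_sandwich E k a x b) \<le> ?\<nu> * sqrt (hs_sq N k a) * sqrt (hs_sq k N b)"
    using le_mult_if_le_all_weighted[of "sqrt (hs_sq N k a)" "?\<nu> * sqrt (hs_sq k N b)"]
      factor_norm_le[OF cost] norm_nonneg[OF k x] by (simp add: hs_sq_nonneg mult_ac)
  show "factor_costs (mat_sandwich E k a x b) \<noteq> {}" using cost[of 1] by auto
qed

lemma factor_costs_nonempty:
  assumes "z \<in> fin_mats" shows "factor_costs z \<noteq> {}"
proof -
  obtain N where N: "z \<in> os_mat E N" using assms by (auto simp: fin_mats_def)
  let ?M = "max 1 N" and ?I = "\<lambda>i j. if i = j \<and> i < max 1 N then 1 else (0::complex)"
  have z: "z \<in> os_mat E ?M" using os_mat_mono[OF N] by simp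
  have I: "?I \<in> scalar_mat ?M ?M" by (auto simp: scalar_mat_def)
  have scale_if: "os_scale E (if P then 1 else 0) v = (if P then v else 0)" for P v by simp
  have "mat_sandwich E ?M ?I z ?I = z"
  proof (intro ext)
    fix i j
    have "mat_sandwich E ?M ?I z ?I i j =
      (\<Sum>p<?M. if p = i then (\<Sum>q<?M. if q = j then z i j else 0) else 0)"
      unfolding mat_sandwich_def
    proof (intro sum.cong refl)
      fix p assume "p \<in> {..<?M}"
      then show "(\<Sum>q<?M. os_scale E (?I i p * ?I q j) (z p q)) = (if p = i then (\<Sum>q<?M. if q = j then z i j else 0) else 0)"
        by (cases "p = i") (auto simp: scale_if)
    qed
    also have "\<dots> = z i j" using mat_outside[OF z, of i j] by (cases "i < ?M \<and> j < ?M") auto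
    finally show "mat_sandwich E ?M ?I z ?I i j = z i j" .
  qed
  then show ?thesis
    using sandwich_factor_norm(2)[OF max.cobounded1 z I I] by simp
qed

text \<open>Put \<open>a\<close> and \<open>a'\<close> side by side, \<open>b\<close> and \<open>b'\<close> on top of each other, and \<open>x \<oplus> x'\<close> between them, whose
  norm is at most one by Ruan's axiom on direct sums.\<close>

lemma factor_costs_add:
  assumes "r \<in> factor_costs z" "r' \<in> factor_costs z'"
  shows "r + r' \<in> factor_costs (z + z')"
proof -
  obtain N k a x b where 1: "r = (hs_sq N k a + hs_sq k N b) / 2" "1 \<le> k" "x \<in> os_mat E k" "os_norm E k x \<le> 1"
    "a \<in> scalar_mat N k" "b \<in> scalar_mat k N" "z = mat_sandwich E k a x b"
    using assms(1) unfolding factor_costs_def by blast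
  obtain N' k' a' x' b' where 2: "r' = (hs_sq N' k' a' + hs_sq k' N' b') / 2" "1 \<le> k'" "x' \<in> os_mat E k'" "os_norm E k' x' \<le> 1"
    "a' \<in> scalar_mat N' k'" "b' \<in> scalar_mat k' N'" "z' = mat_sandwich E k' a' x' b'"
    using assms(2) unfolding factor_costs_def by blast
  define M where "M = max N N'"
  define \<alpha> where "\<alpha> i p = (if p < k then a i p else a' i (p - k))" for i p
  define \<beta> where "\<beta> q j = (if q < k then b q j else b' (q - k) j)" for q j
  have \<alpha>: "\<alpha> \<in> scalar_mat M (k + k')" and \<beta>: "\<beta> \<in> scalar_mat (k + k') M"
    using 1(5,6) 2(5,6) by (auto simp: scalar_mat_def \<alpha>_def \<beta>_def M_def)
  have "(hs_sq M (k + k') \<alpha> + hs_sq (k + k') M \<beta>) / 2 \<in> factor_costs (mat_sandwich E (k + k') \<alpha> (mat_direct_sum k x x') \<beta>)"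
    by (intro factor_costsI mat_oplus \<alpha> \<beta>) (use 1 2 in \<open>auto simp: norm_oplus\<close>)
  moreover have "hs_sq M (k + k') \<alpha> = hs_sq N k a + hs_sq N' k' a'"
  proof -
    have "hs_sq M (k + k') \<alpha> = hs_sq M k a + hs_sq M k' a'"
      by (simp add: hs_sq_def sum_lessThan_add \<alpha>_def sum.distrib)
    then show ?thesis using hs_sq_mono_rows[OF 1(5), of M] hs_sq_mono_rows[OF 2(5), of M] by (simp add: M_def)
  qed
  moreover have "hs_sq (k + k') M \<beta> = hs_sq k N b + hs_sq k' N' b'"
  proof -
    have "hs_sq (k + k') M \<beta> = hs_sq k M b + hs_sq k' M b'"
      by (simp add: hs_sq_def sum_lessThan_add \<beta>_def)
    then show ?thesis using hs_sq_mono_cols[OF 1(6), of M] hs_sq_mono_cols[OF 2(6), of M] by (simp add: M_def)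
  qed
  moreover have "mat_sandwich E (k + k') \<alpha> (mat_direct_sum k x x') \<beta> = z + z'"
    unfolding 1(7) 2(7)
    by (simp add: mat_sandwich_def fun_eq_iff sum_lessThan_add \<alpha>_def \<beta>_def mat_direct_sum_def sum.distrib)
  moreover have "(hs_sq N k a + hs_sq N' k' a' + (hs_sq k N b + hs_sq k' N' b')) / 2 = r + r'"
    by (simp add: 1(1) 2(1) add_divide_distrib)
  ultimately show ?thesis by (simp only:)
qed

lemma factor_norm_add:
  assumes "z \<in> fin_mats" "z' \<in> fin_mats"
  shows "factor_norm (z + z') \<le> factor_norm z + factor_norm z'"
proof -
  have 1: "factor_norm (z + z') - r \<le> factor_norm z'" if "r \<in> factor_costs z" for r
    unfolding factor_norm_def[of z']
    by (rule cInf_greatest[OF factor_costs_nonempty[OF assms(2)]])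
      (use factor_norm_le[OF factor_costs_add[OF that]] in force)
  have "factor_norm (z + z') - factor_norm z' \<le> factor_norm z"
    unfolding factor_norm_def[of z]
    by (rule cInf_greatest[OF factor_costs_nonempty[OF assms(1)]]) (use 1 in \<open>force simp: factor_norm_def\<close>)
  then show ?thesis by simp
qed

lemma factor_norm_scale:
  assumes "z \<in> fin_mats"
  shows "factor_norm (mscale c z) \<le> cmod c * factor_norm z"
proof -
  have cost: "cmod c * r \<in> factor_costs (mscale c z)" if r: "r \<in> factor_costs z" for r
  proof -
    obtain N k a x b where 1: "r = (hs_sq N k a + hs_sq k N b) / 2" "1 \<le> k" "x \<in> os_mat E k" "os_norm E k x \<le> 1"
      "a \<in> scalar_mat N k" "b \<in> scalar_mat k N" "z = mat_sandwich E k a x b"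
      using r unfolding factor_costs_def by blast
    let ?s = "complex_of_real (sqrt (cmod c))"
    let ?a = "\<lambda>i p. c / ?s * a i p" and ?b = "\<lambda>q j. ?s * b q j"
    have "(hs_sq N k ?a + hs_sq k N ?b) / 2 \<in> factor_costs (mat_sandwich E k ?a x ?b)"
      by (intro factor_costsI 1) (use 1 in \<open>auto simp: scalar_mat_def\<close>)
    moreover have "mat_sandwich E k ?a x ?b = mscale c z"
      using sandwich_scale[of k "c / ?s" a 1 x ?s b] by (simp add: 1(7))
    moreover have "hs_sq N k ?a = cmod c * hs_sq N k a"
      by (simp add: hs_sq_def norm_mult norm_divide power_mult_distrib power_divide sum_distrib_left)
        (auto simp: power2_eq_square intro!: sum.cong)
    moreover have "hs_sq k N ?b = cmod c * hs_sq k N b"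
      by (simp add: hs_sq_def norm_mult power_mult_distrib sum_distrib_left)
    ultimately show ?thesis by (simp add: 1(1) algebra_simps)
  qed
  show ?thesis
  proof (cases "c = 0")
    case True
    obtain r where r: "r \<in> factor_costs z" using factor_costs_nonempty[OF assms] by blast
    show ?thesis using factor_norm_le[OF cost[OF r]] True by simp
  next
    case False
    have "factor_norm (mscale c z) / cmod c \<le> factor_norm z"
      unfolding factor_norm_def[of z]
    proof (rule cInf_greatest[OF factor_costs_nonempty[OF assms]])
      fix r assume "r \<in> factor_costs z"
      then show "factor_norm (mscale c z) / cmod c \<le> r"
        using factor_norm_le[OF cost] False by (simp add: field_simps)
    qed
    then show ?thesis using False by (simp add: field_simps)
  qed
qed

end

section \<open>Extension of completely bounded maps into matrices\<close>

lemma sum_swap4: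
  "(\<Sum>p\<in>A. \<Sum>q\<in>B. \<Sum>i\<in>C. \<Sum>j\<in>D. f p q i j) = (\<Sum>i\<in>C. \<Sum>j\<in>D. \<Sum>p\<in>A. \<Sum>q\<in>B. f p q i j)"
proof -
  have "(\<Sum>p\<in>A. \<Sum>q\<in>B. \<Sum>i\<in>C. \<Sum>j\<in>D. f p q i j) = (\<Sum>s\<in>A\<times>B. \<Sum>t\<in>C\<times>D. f (fst s) (snd s) (fst t) (snd t))"
    unfolding sum.cartesian_product' by simp
  also have "\<dots> = (\<Sum>t\<in>C\<times>D. \<Sum>s\<in>A\<times>B. f (fst s) (snd s) (fst t) (snd t))" by (rule sum.swap)
  also have "\<dots> = (\<Sum>i\<in>C. \<Sum>j\<in>D. \<Sum>p\<in>A. \<Sum>q\<in>B. f p q i j)"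
    unfolding sum.cartesian_product' by simp
  finally show ?thesis .
qed

lemma sum_swap_inner:
  "(\<Sum>p\<in>A. \<Sum>q\<in>B. \<Sum>i\<in>C. \<Sum>j\<in>D. f p q i j) = (\<Sum>i\<in>C. \<Sum>p\<in>A. \<Sum>j\<in>D. \<Sum>q\<in>B. f p q i j)"
  unfolding sum_swap4[of f] by (intro sum.cong refl) (rule sum.swap)

lemma functional_on_0:
  assumes "matrix_normed_space Y" "functional_on Y \<phi>" shows "\<phi> 0 = 0"
proof -
  interpret matrix_normed_space Y by fact
  show ?thesis using assms(2) subspace_0[OF carrier] unfolding functional_on_def
    by (metis add_cancel_right_right add_0)
qed

lemma functional_on_sum_vectors:
  assumes "matrix_normed_space Y" "functional_on Y \<phi>" "\<And>s. s \<in> S \<Longrightarrow> v s \<in> os_carrier Y"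
  shows "\<phi> (\<Sum>s\<in>S. v s) = (\<Sum>s\<in>S. \<phi> (v s))"
proof -
  interpret matrix_normed_space Y by fact
  show ?thesis using assms(2,3) unfolding functional_on_def
    by (induction S rule: infinite_finite_induct)
      (auto simp: functional_on_0[OF assms(1,2)] subspace_sum[OF carrier])
qed

text \<open>The functional on finite matrices that has the restrictions \<open>t i j\<close> to the single entries. Summing
  over the support avoids a reference to the size of \<open>z\<close>.\<close>

definition pairing :: "(nat \<Rightarrow> nat \<Rightarrow> 'y \<Rightarrow> complex) \<Rightarrow> (nat \<Rightarrow> nat \<Rightarrow> 'y::zero) \<Rightarrow> complex" where
  "pairing t z = (\<Sum>s\<in>{s. z (fst s) (snd s) \<noteq> 0}. t (fst s) (snd s) (z (fst s) (snd s)))"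

lemma pairing_eq:
  assumes "\<And>i j. \<not> (i < N \<and> j < N) \<Longrightarrow> z i j = 0" "\<And>i j. t i j 0 = 0"
  shows "pairing t z = (\<Sum>i<N. \<Sum>j<N. t i j (z i j))"
proof -
  have "pairing t z = (\<Sum>s\<in>{..<N}\<times>{..<N}. t (fst s) (snd s) (z (fst s) (snd s)))"
    unfolding pairing_def
    by (rule sum.mono_neutral_left) (use assms in force)+
  then show ?thesis unfolding sum.cartesian_product' by simp
qed

context Ruan_space
begin

lemma sandwich_cong:
  assumes "\<And>p. p < k \<Longrightarrow> a i p = a' i p" "\<And>q. q < k \<Longrightarrow> b q j = b' q j"
  shows "mat_sandwich E k a x b i j = mat_sandwich E k a' x b' i j"
  unfolding mat_sandwich_def by (intro sum.cong refl) (use assms in auto)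

lemma sandwich_sandwich:
  "mat_sandwich E M e (mat_sandwich E k a x b) f =
   mat_sandwich E k (\<lambda>r p. \<Sum>i<M. e r i * a i p) x (\<lambda>q s. \<Sum>j<M. b q j * f j s)"
proof (intro ext)
  fix r s
  have "mat_sandwich E M e (mat_sandwich E k a x b) f r s =
    (\<Sum>i<M. \<Sum>j<M. \<Sum>p<k. \<Sum>q<k. os_scale E (e r i * f j s * (a i p * b q j)) (x p q))"
    by (simp add: mat_sandwich_def scale_sum_right)
  also have "\<dots> = (\<Sum>p<k. \<Sum>q<k. \<Sum>i<M. \<Sum>j<M. os_scale E (e r i * f j s * (a i p * b q j)) (x p q))"
    by (rule sum_swap4)
  also have "\<dots> = mat_sandwich E k (\<lambda>r p. \<Sum>i<M. e r i * a i p) x (\<lambda>q s. \<Sum>j<M. b q j * f j s) r s"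
    unfolding mat_sandwich_def sum_product scale_sum_left by (simp add: mult_ac)
  finally show "mat_sandwich E M e (mat_sandwich E k a x b) f r s =
    mat_sandwich E k (\<lambda>r p. \<Sum>i<M. e r i * a i p) x (\<lambda>q s. \<Sum>j<M. b q j * f j s) r s" .
qed

text \<open>Padding by zeros is the direct sum with a zero matrix.\<close>

lemma norm_pad:
  assumes k: "1 \<le> k" and x: "x \<in> os_mat E k" and M: "k \<le> M"
  shows "os_norm E M x = os_norm E k x"
proof (cases "k = M")
  case False
  then have l: "1 \<le> M - k" using M by simp
  have "x = mat_direct_sum k x (\<lambda>i j. 0)"
    using mat_outside[OF x] by (auto simp: mat_direct_sum_def fun_eq_iff)
  then show ?thesis
    using norm_oplus[OF k l x mat_0] norm_zero[OF l] norm_nonneg[OF k x] M by simp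
qed simp

lemma subspace_matrix_normed:
  assumes "subspace X" "X \<subseteq> os_carrier E"
  shows "matrix_normed_space (E\<lparr>os_carrier := X\<rparr>)"
proof -
  have mat: "os_mat (E\<lparr>os_carrier := X\<rparr>) k \<subseteq> os_mat E k" for k
    using assms(2) by (force simp: os_mat_def split: if_splits)
  show ?thesis
    by (rule matrix_normed_space.intro)
      (use assms mat norm_nonneg norm_0D norm_scale norm_add vs in \<open>simp_all add: subset_iff\<close>)
qed

text \<open>
  The completely bounded functionals are bounded for the factorisation norm of the larger space.
  If \<open>z = a y b\<close> has entries in the subspace while \<open>y\<close> does not, Gram-Schmidt gives \<open>a = c u\<close>,
  \<open>u = e a\<close> with a contraction \<open>u\<close>, similarly \<open>b = w d\<close>, \<open>w = b f\<close>, and then \<open>u y w = e z f\<close> has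
  entries in the subspace.
\<close>

lemma pairing_le_factor_cost:
  assumes X: "subspace X" "X \<subseteq> os_carrier E"
    and t: "cb_form (E\<lparr>os_carrier := X\<rparr>) C t" "\<And>p q. functional_on (E\<lparr>os_carrier := X\<rparr>) (t p q)"
    and z: "z \<in> os_mat (E\<lparr>os_carrier := X\<rparr>) N" and r: "r \<in> factor_costs z" and C: "0 \<le> C"
  shows "cmod (pairing t z) \<le> C * r"
proof -
  interpret X: matrix_normed_space "E\<lparr>os_carrier := X\<rparr>" by (rule subspace_matrix_normed[OF X])
  have t0: "t p q 0 = 0" for p q by (rule functional_on_0[OF X.matrix_normed_space_axioms t(2)])
  have t_scale: "t p q (os_scale E c v) = c * t p q v" if "v \<in> X" for p q c v
    using t(2)[of p q] that by (simp add: functional_on_def)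
  have t_sum: "t p q (\<Sum>s\<in>S. v s) = (\<Sum>s\<in>S. t p q (v s))" if "\<And>s. s \<in> S \<Longrightarrow> v s \<in> X" for S p q and v :: "nat \<Rightarrow> 'a"
    by (rule functional_on_sum_vectors[OF X.matrix_normed_space_axioms t(2)]) (use that in simp)
  obtain N' k a x b where rr: "r = (hs_sq N' k a + hs_sq k N' b) / 2" and k: "1 \<le> k" and x: "x \<in> os_mat E k" "os_norm E k x \<le> 1"
    and ab: "a \<in> scalar_mat N' k" "b \<in> scalar_mat k N'" and zeq: "z = mat_sandwich E k a x b"
    using r unfolding factor_costs_def by blast
  \<comment> \<open>A common size for \<open>z\<close> and its factorisation, positive so that the axioms apply to it.\<close>
  define M where "M = max 1 (max N N')"
  have M: "1 \<le> M" by (simp add: M_def)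
  have rM: "r = (hs_sq M k a + hs_sq k M b) / 2"
    using hs_sq_mono_rows[OF ab(1), of M] hs_sq_mono_cols[OF ab(2), of M] rr by (simp add: M_def)
  have zM: "z \<in> os_mat (E\<lparr>os_carrier := X\<rparr>) M"
    by (rule X.os_mat_mono[OF z]) (simp add: M_def)
  have zX: "z i j \<in> X" for i j using X.mat_entry[OF z] by simp
  obtain u e where u_orth: "\<forall>r<M. \<forall>s<M. r \<noteq> s \<longrightarrow> (\<Sum>p<k. u r p * cnj (u s p)) = 0"
    and u_unit: "\<forall>r<M. (\<Sum>p<k. u r p * cnj (u r p)) = 1 \<or> (\<forall>p\<in>{..<k}. u r p = 0)"
    and au: "\<forall>i<M. \<forall>p\<in>{..<k}. a i p = (\<Sum>r<M. (\<Sum>l<k. a i l * cnj (u r l)) * u r p)"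
    and ua: "\<forall>r<M. \<forall>p\<in>{..<k}. u r p = (\<Sum>i<M. e r i * a i p)"
    using finite_gram_schmidt[OF finite_lessThan[of k], where N = M and v = a]
    by (elim exE conjE) (rule that; assumption)
  obtain w f where w_orth: "\<forall>r<M. \<forall>s<M. r \<noteq> s \<longrightarrow> (\<Sum>p<k. w r p * cnj (w s p)) = 0"
    and w_unit: "\<forall>r<M. (\<Sum>p<k. w r p * cnj (w r p)) = 1 \<or> (\<forall>p\<in>{..<k}. w r p = 0)"
    and bw: "\<forall>j<M. \<forall>q\<in>{..<k}. b q j = (\<Sum>r<M. (\<Sum>l<k. b l j * cnj (w r l)) * w r q)"
    and wb: "\<forall>r<M. \<forall>q\<in>{..<k}. w r q = (\<Sum>j<M. f r j * b q j)"
    using finite_gram_schmidt[OF finite_lessThan[of k], where N = M and v = "\<lambda>j q. b q j"]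
    by (elim exE conjE) (rule that; assumption)
  define U where "U r p = (if r < M \<and> p \<in> {..<k} then u r p else 0)" for r p
  define W where "W r p = (if r < M \<and> p \<in> {..<k} then w r p else 0)" for r p
  define W' where "W' q s = W s q" for q s
  have U1: "form_bound U 1" unfolding U_def
    by (rule form_bound_orthonormal) (use u_orth u_unit in auto)
  have W1: "form_bound W 1" unfolding W_def
    by (rule form_bound_orthonormal) (use w_orth w_unit in auto)
  have W'1: "form_bound W' 1" unfolding W'_def using form_bound_transpose[THEN iffD2, OF W1] .
  have US: "U \<in> scalar_mat M k" "W' \<in> scalar_mat k M" by (auto simp: scalar_mat_def U_def W_def W'_def)
  define y where "y = mat_sandwich E k U x W'"
  define c where "c i r = (\<Sum>l<k. a i l * cnj (U r l))" for i r
  define d where "d s j = (\<Sum>l<k. b l j * cnj (W s l))" for s j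
  have y: "y \<in> os_mat E M" unfolding y_def by (rule mat_sandwich_in[OF x(1) US])
  have y1: "os_norm E M y \<le> 1"
    unfolding y_def using norm_sandwich_contraction[OF k M x(1) US U1 W'1] x(2) by simp
  have y_z: "y r s = mat_sandwich E M e z (\<lambda>j s. f s j) r s" if "r < M" "s < M" for r s
    unfolding zeq sandwich_sandwich y_def
    by (rule sandwich_cong) (use ua wb that in \<open>auto simp: U_def W_def W'_def mult.commute\<close>)
  have z_y: "z i j = mat_sandwich E M c y d i j" if "i < M" "j < M" for i j
    unfolding y_def sandwich_sandwich unfolding zeq
  proof (rule sandwich_cong)
    fix p assume p: "p < k"
    have "a i p = (\<Sum>r<M. (\<Sum>l<k. a i l * cnj (u r l)) * u r p)" using au that p by simp
    then show "a i p = (\<Sum>r<M. c i r * U r p)" using p by (simp add: c_def U_def)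
    have "b p j = (\<Sum>r<M. (\<Sum>l<k. b l j * cnj (w r l)) * w r p)" using bw that p by simp
    then show "b p j = (\<Sum>r<M. W' p r * d r j)" using p by (simp add: d_def W_def W'_def mult.commute)
  qed
  have yX: "y r s \<in> X" for r s
  proof (cases "r < M \<and> s < M")
    case True
    have "mat_sandwich E M e z (\<lambda>j s. f s j) r s \<in> X"
      unfolding mat_sandwich_def by (intro subspace_sum subspace_scale X(1) zX)
    then show ?thesis using y_z True by simp
  next
    case False then show ?thesis using mat_outside[OF y] subspace_0[OF X(1)] by simp
  qed
  have yXM: "y \<in> os_mat (E\<lparr>os_carrier := X\<rparr>) M"
    by (rule X.matI) (use yX mat_outside[OF y] in auto)
  let ?\<eta> = "\<lambda>(r, i). c i r" and ?\<xi> = "\<lambda>(s, j). d s j" and ?B = "{..<M} \<times> {..<M}"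
  have "pairing t z = (\<Sum>i<M. \<Sum>j<M. t i j (z i j))"
    by (rule pairing_eq) (use X.mat_outside[OF zM] t0 in auto)
  also have "\<dots> = (\<Sum>i<M. \<Sum>j<M. t i j (mat_sandwich E M c y d i j))"
    by (intro sum.cong refl) (simp add: z_y)
  also have "\<dots> = (\<Sum>i<M. \<Sum>j<M. \<Sum>r<M. \<Sum>s<M. c i r * t i j (y r s) * d s j)"
    unfolding mat_sandwich_def
    by (intro sum.cong refl) (simp add: t_sum t_scale yX subspace_sum subspace_scale X(1) mult_ac)
  also have "\<dots> = (\<Sum>r<M. \<Sum>i<M. \<Sum>s<M. \<Sum>j<M. c i r * t i j (y r s) * d s j)"
    by (rule sum_swap_inner)
  also have "\<dots> = (\<Sum>i\<in>?B. \<Sum>j\<in>?B. ?\<eta> i * (case i of (r, i) \<Rightarrow> \<lambda>(s, j). t i j (y r s)) j * ?\<xi> j)"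
    unfolding sum.cartesian_product' by simp
  finally have "cmod (pairing t z) \<le> C * os_norm E M y * fin_norm ?B ?\<eta> * fin_norm ?B ?\<xi>"
    using t(1) M yXM form_boundD[of "\<lambda>(r, i) (s, j). t i j (y r s)" _ ?B ?B ?\<eta> ?\<xi>]
    unfolding cb_form_def by simp
  also have "\<dots> \<le> C * 1 * fin_norm ?B ?\<eta> * fin_norm ?B ?\<xi>"
    by (intro mult_right_mono mult_left_mono y1 C L2_set_nonneg)
  finally have 1: "cmod (pairing t z) \<le> C * (fin_norm ?B ?\<eta> * fin_norm ?B ?\<xi>)" by (simp add: mult.assoc)
  have row: "(\<Sum>r<M. (cmod (\<Sum>l<k. v l * cnj (V r l)))\<^sup>2) \<le> (\<Sum>l<k. (cmod (v l))\<^sup>2)" if V: "form_bound V 1" for v V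
  proof -
    have "L2_set (\<lambda>r. cmod (\<Sum>l<k. cnj (V r l) * v l)) {..<M} \<le> 1 * fin_norm {..<k} v"
      by (rule form_bound_apply[OF form_bound_cnj[OF V]]) auto
    then show ?thesis by (simp add: L2_set_def mult.commute)
  qed
  have "(fin_norm ?B ?\<eta>)\<^sup>2 = (\<Sum>i<M. \<Sum>r<M. (cmod (c i r))\<^sup>2)"
    unfolding L2_set_def sum.cartesian_product' by (subst sum.swap) (simp add: sum_nonneg)
  also have "\<dots> \<le> hs_sq M k a" unfolding hs_sq_def c_def by (intro sum_mono row U1)
  finally have \<eta>: "(fin_norm ?B ?\<eta>)\<^sup>2 \<le> hs_sq M k a" .
  have "(fin_norm ?B ?\<xi>)\<^sup>2 = (\<Sum>j<M. \<Sum>s<M. (cmod (d s j))\<^sup>2)"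
    unfolding L2_set_def sum.cartesian_product' by (subst sum.swap) (simp add: sum_nonneg)
  also have "\<dots> \<le> (\<Sum>j<M. \<Sum>l<k. (cmod (b l j))\<^sup>2)" unfolding d_def by (intro sum_mono row W1)
  also have "\<dots> = hs_sq k M b" unfolding hs_sq_def by (rule sum.swap)
  finally have \<xi>: "(fin_norm ?B ?\<xi>)\<^sup>2 \<le> hs_sq k M b" .
  have amgm: "v * w \<le> (A + B) / 2" if "v\<^sup>2 \<le> A" "w\<^sup>2 \<le> B" for v w A B :: real
    using sum_squares_bound[of v w] that by simp
  have "fin_norm ?B ?\<eta> * fin_norm ?B ?\<xi> \<le> r"
    unfolding rM by (rule amgm[OF \<eta> \<xi>])
  then show ?thesis using 1 mult_left_mono[OF _ C] by (meson order_trans)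
qed

definition unit_mat :: "nat \<Rightarrow> nat \<Rightarrow> 'a \<Rightarrow> nat \<Rightarrow> nat \<Rightarrow> 'a" where
  "unit_mat p q v = (\<lambda>i j. if i = p \<and> j = q then v else 0)"

lemma unit_mat_in: "v \<in> os_carrier E \<Longrightarrow> unit_mat p q v \<in> fin_mats"
  by (rule fin_matsI[of _ "Suc (max p q)"], rule matI) (auto simp: unit_mat_def subspace_0[OF carrier])

text \<open>A form in the entries \<open>t' p q\<close> evaluated on a block matrix \<open>x\<close> is the value of \<open>g\<close> at \<open>a x b\<close>, where
  \<open>a\<close> and \<open>b\<close> consist of the coordinates of the two test vectors; their Hilbert-Schmidt norms are the
  norms of these vectors.\<close>

lemma cb_form_of_functional:
  assumes C: "0 \<le> C"
    and g_add: "\<And>z w. z \<in> fin_mats \<Longrightarrow> w \<in> fin_mats \<Longrightarrow> g (z + w) = g z + g w"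
    and g_scale: "\<And>c z. z \<in> fin_mats \<Longrightarrow> g (mscale c z) = c * g z"
    and g_le: "\<And>z. z \<in> fin_mats \<Longrightarrow> cmod (g z) \<le> C * factor_norm z"
  defines "t' \<equiv> \<lambda>p q v. g (unit_mat p q v)"
  shows "functional_on E (t' p q)" "cb_form E C t'"
proof -
  interpret M: vector_space mscale by (rule vs_mscale)
  have t'_lin: "functional_on E (t' p q)" for p q
    unfolding functional_on_def
  proof (intro conjI ballI allI)
    fix v w assume v: "v \<in> os_carrier E" and w: "w \<in> os_carrier E"
    have "unit_mat p q (v + w) = unit_mat p q v + unit_mat p q w" by (auto simp: unit_mat_def fun_eq_iff)
    then show "t' p q (v + w) = t' p q v + t' p q w"
      unfolding t'_def using g_add[OF unit_mat_in[OF v] unit_mat_in[OF w]] by simp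
  next
    fix c v assume v: "v \<in> os_carrier E"
    have "unit_mat p q (os_scale E c v) = mscale c (unit_mat p q v)" by (auto simp: unit_mat_def mscale_def fun_eq_iff)
    then show "t' p q (os_scale E c v) = c * t' p q v"
      unfolding t'_def using g_scale[OF unit_mat_in[OF v]] by simp
  qed
  have t'_0: "t' p q 0 = 0" for p q by (rule functional_on_0[OF matrix_normed_space_axioms t'_lin])
  have t'_sum: "t' p q (\<Sum>s\<in>S. v s) = (\<Sum>s\<in>S. t' p q (v s))" if "\<And>s. s \<in> S \<Longrightarrow> v s \<in> os_carrier E" for S p q and v :: "nat \<Rightarrow> 'a"
    by (rule functional_on_sum_vectors[OF matrix_normed_space_axioms t'_lin that])
  have t'_scale: "t' p q (os_scale E c v) = c * t' p q v" if "v \<in> os_carrier E" for p q c v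
    using t'_lin that unfolding functional_on_def by blast
  have g_sum: "g (\<Sum>s\<in>S. z s) = (\<Sum>s\<in>S. g (z s))" if "\<And>s. s \<in> S \<Longrightarrow> z s \<in> fin_mats" for S and z :: "nat \<times> nat \<Rightarrow> nat \<Rightarrow> nat \<Rightarrow> 'a"
  proof -
    have "g 0 = 0" using g_scale[OF M.subspace_0[OF subspace_fin_mats], of 0] by simp
    then show ?thesis using that
      by (induction S rule: infinite_finite_induct) (auto simp: g_add M.subspace_sum[OF subspace_fin_mats])
  qed
  have g_expand: "g z = (\<Sum>p<N. \<Sum>q<N. t' p q (z p q))" if z: "z \<in> os_mat E N" for z N
  proof -
    have "z = (\<Sum>s\<in>{..<N}\<times>{..<N}. unit_mat (fst s) (snd s) (z (fst s) (snd s)))"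
    proof (intro ext)
      fix i j
      have "(\<Sum>s\<in>{..<N}\<times>{..<N}. unit_mat (fst s) (snd s) (z (fst s) (snd s))) i j
        = (\<Sum>s\<in>{..<N}\<times>{..<N}. if s = (i, j) then z i j else 0)"
        unfolding sum_fun_apply2 by (intro sum.cong refl) (auto simp: unit_mat_def prod_eq_iff)
      also have "\<dots> = z i j" using mat_outside[OF z] by (auto simp: sum.delta)
      finally show "z i j = (\<Sum>s\<in>{..<N}\<times>{..<N}. unit_mat (fst s) (snd s) (z (fst s) (snd s))) i j" by simp
    qed
    then have "g z = (\<Sum>s\<in>{..<N}\<times>{..<N}. t' (fst s) (snd s) (z (fst s) (snd s)))"
      unfolding t'_def using g_sum[of "{..<N}\<times>{..<N}" "\<lambda>s. unit_mat (fst s) (snd s) (z (fst s) (snd s))"]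
        unit_mat_in mat_entry[OF z] by simp
    then show ?thesis unfolding sum.cartesian_product' by simp
  qed
  have "cb_form E C t'"
    unfolding cb_form_def
  proof (intro allI impI ballI)
    fix k :: nat and x assume k: "1 \<le> k" and x: "x \<in> os_mat E k"
    show "form_bound (\<lambda>(i, p) (j, q). t' p q (x i j)) (C * os_norm E k x)"
    proof (rule form_boundI_cofinal)
      fix I J :: "(nat \<times> nat) set" assume IJ: "finite I" "finite J"
      define L where "L = fst ` I \<union> snd ` I \<union> fst ` J \<union> snd ` J"
      have "finite L" using IJ by (simp add: L_def)
      then obtain m where m: "L \<subseteq> {..<m}" using finite_nat_iff_bounded by blast
      define M where "M = max m k"
      let ?B = "{..<M} \<times> {..<M}"
      have kM: "k \<le> M" and M1: "1 \<le> M" and LM: "L \<subseteq> {..<M}" using k m by (auto simp: M_def)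
      have xM: "x \<in> os_mat E M" by (rule os_mat_mono[OF x kM])
      have bound: "cmod (\<Sum>i\<in>?B. \<Sum>j\<in>?B. \<eta> i * (case i of (i, p) \<Rightarrow> \<lambda>(j, q). t' p q (x i j)) j * \<xi> j)
        \<le> C * os_norm E k x * fin_norm ?B \<eta> * fin_norm ?B \<xi>" for \<eta> \<xi>
      proof -
        define a where "a p i = (if p < M \<and> i < M then \<eta> (i, p) else 0)" for p i
        define b where "b j q = (if j < M \<and> q < M then \<xi> (j, q) else 0)" for j q
        have ab: "a \<in> scalar_mat M M" "b \<in> scalar_mat M M" by (auto simp: scalar_mat_def a_def b_def)
        let ?z = "mat_sandwich E M a x b"
        have z: "?z \<in> os_mat E M" by (rule mat_sandwich_in[OF xM ab])
        have "g ?z = (\<Sum>p<M. \<Sum>q<M. \<Sum>i<M. \<Sum>j<M. a p i * b j q * t' p q (x i j))"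
          unfolding g_expand[OF z] unfolding mat_sandwich_def
          by (intro sum.cong refl) (simp add: t'_sum t'_scale mat_entry[OF x] subspace_sum subspace_scale carrier)
        also have "\<dots> = (\<Sum>p<M. \<Sum>q<M. \<Sum>i<M. \<Sum>j<M. \<eta> (i, p) * t' p q (x i j) * \<xi> (j, q))"
          by (intro sum.cong refl) (simp add: a_def b_def mult_ac)
        also have "\<dots> = (\<Sum>i<M. \<Sum>p<M. \<Sum>j<M. \<Sum>q<M. \<eta> (i, p) * t' p q (x i j) * \<xi> (j, q))"
          by (rule sum_swap_inner)
        also have "\<dots> = (\<Sum>i\<in>?B. \<Sum>j\<in>?B. \<eta> i * (case i of (i, p) \<Rightarrow> \<lambda>(j, q). t' p q (x i j)) j * \<xi> j)"
          unfolding sum.cartesian_product' by simp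
        finally have eq: "g ?z = \<dots>" .
        have "cmod (g ?z) \<le> C * (os_norm E M x * sqrt (hs_sq M M a) * sqrt (hs_sq M M b))"
          using g_le[OF fin_matsI[OF z]] mult_left_mono[OF sandwich_factor_norm(1)[OF M1 xM ab] C] by simp
        moreover have "sqrt (hs_sq M M a) = fin_norm ?B \<eta>"
          unfolding L2_set_def hs_sq_def sum.cartesian_product' by (subst sum.swap) (simp add: a_def)
        moreover have "sqrt (hs_sq M M b) = fin_norm ?B \<xi>"
          unfolding L2_set_def hs_sq_def sum.cartesian_product' by (simp add: b_def)
        ultimately show ?thesis unfolding eq using norm_pad[OF k x kM] by (simp add: mult.assoc)
      qed
      have sub: "I \<subseteq> ?B" "J \<subseteq> ?B" using LM by (auto simp: L_def image_subset_iff)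
      show "\<exists>I' J'. finite I' \<and> finite J' \<and> I \<subseteq> I' \<and> J \<subseteq> J' \<and>
        (\<forall>\<eta> \<xi>. cmod (\<Sum>i\<in>I'. \<Sum>j\<in>J'. \<eta> i * (case i of (i, p) \<Rightarrow> \<lambda>(j, q). t' p q (x i j)) j * \<xi> j)
          \<le> C * os_norm E k x * fin_norm I' \<eta> * fin_norm J' \<xi>)"
        by (intro exI[of _ ?B] conjI allI bound sub) auto
    qed
  qed
  then show "functional_on E (t' p q)" "cb_form E C t'" using t'_lin by blast+
qed

text \<open>Wittstock's extension theorem for maps into matrices. It is the Hahn-Banach theorem for
  \<open>factor_norm\<close>, applied to the functional \<open>pairing t\<close>.\<close>

theorem cb_form_extension:
  assumes X: "subspace X" "X \<subseteq> os_carrier E" and C: "0 \<le> C"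
    and t: "cb_form (E\<lparr>os_carrier := X\<rparr>) C t" "\<And>p q. functional_on (E\<lparr>os_carrier := X\<rparr>) (t p q)"
  obtains t' where "cb_form E C t'" "\<And>p q. functional_on E (t' p q)" "\<And>p q v. v \<in> X \<Longrightarrow> t' p q v = t p q v"
proof -
  interpret X: matrix_normed_space "E\<lparr>os_carrier := X\<rparr>" by (rule subspace_matrix_normed[OF X])
  interpret M: vector_space mscale by (rule vs_mscale)
  have t0: "t p q 0 = 0" for p q by (rule functional_on_0[OF X.matrix_normed_space_axioms t(2)])
  have mscale_X: "X.mscale = mscale" by (simp add: X.mscale_def mscale_def fun_eq_iff)
  have U: "M.subspace X.fin_mats" using X.subspace_fin_mats by (simp add: mscale_X)
  have UV: "X.fin_mats \<subseteq> fin_mats"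
  proof
    fix z assume "z \<in> X.fin_mats"
    then obtain N where N: "z \<in> os_mat (E\<lparr>os_carrier := X\<rparr>) N" by (auto simp: X.fin_mats_def)
    have "z \<in> os_mat E N"
      by (rule matI) (use X.mat_entry[OF N] X.mat_outside[OF N] X(2) in auto)
    then show "z \<in> fin_mats" by (rule fin_matsI)
  qed
  have pair: "pairing t z = (\<Sum>i<N. \<Sum>j<N. t i j (z i j))" if "z \<in> os_mat (E\<lparr>os_carrier := X\<rparr>) N" for z N
    by (rule pairing_eq) (use X.mat_outside[OF that] t0 in auto)
  have t_lin: "t p q (v + w) = t p q v + t p q w" "t p q (os_scale E c v) = c * t p q v"
    if "v \<in> X" "w \<in> X" for p q v w c
    using t(2)[of p q] that by (simp_all add: functional_on_def)
  obtain g where g_add: "\<And>z w. z \<in> fin_mats \<Longrightarrow> w \<in> fin_mats \<Longrightarrow> g (z + w) = g z + g w"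
    and g_scale: "\<And>c z. z \<in> fin_mats \<Longrightarrow> g (mscale c z) = c * g z"
    and g_le: "\<And>z. z \<in> fin_mats \<Longrightarrow> cmod (g z) \<le> C * factor_norm z"
    and g_eq: "\<And>z. z \<in> X.fin_mats \<Longrightarrow> g z = pairing t z"
  proof (rule hahn_banach_complex[OF vs_mscale subspace_fin_mats U UV, of "\<lambda>z. C * factor_norm z" "pairing t"])
    show "C * factor_norm (z + w) \<le> C * factor_norm z + C * factor_norm w"
      if "z \<in> fin_mats" "w \<in> fin_mats" for z w
      using mult_left_mono[OF factor_norm_add[OF that] C] by (simp add: distrib_left)
    show "C * factor_norm (mscale c z) \<le> cmod c * (C * factor_norm z)" if "z \<in> fin_mats" for c z
      using mult_left_mono[OF factor_norm_scale[OF that] C, of c] by (simp add: mult_ac)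
    show "pairing t (z + w) = pairing t z + pairing t w" if zw: "z \<in> X.fin_mats" "w \<in> X.fin_mats" for z w
    proof -
      obtain N where N: "z \<in> os_mat (E\<lparr>os_carrier := X\<rparr>) N" "w \<in> os_mat (E\<lparr>os_carrier := X\<rparr>) N" using X.fin_mats_common_size[OF zw] by blast
      have zX: "z i j \<in> X" "w i j \<in> X" for i j using X.mat_entry[OF N(1)] X.mat_entry[OF N(2)] by auto
      have "z + w \<in> os_mat (E\<lparr>os_carrier := X\<rparr>) N" using X.mat_add[OF N] by (simp add: plus_fun_def)
      then show ?thesis using N by (simp add: pair t_lin zX sum.distrib)
    qed
    show "pairing t (mscale c z) = c * pairing t z" if z: "z \<in> X.fin_mats" for c z
    proof -
      obtain N where N: "z \<in> os_mat (E\<lparr>os_carrier := X\<rparr>) N" using z by (auto simp: X.fin_mats_def)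
      have zX: "z i j \<in> X" for i j using X.mat_entry[OF N] by auto
      have "mscale c z \<in> os_mat (E\<lparr>os_carrier := X\<rparr>) N" using X.mat_scale[OF N] by (simp add: mscale_def)
      then show ?thesis using N by (simp add: pair mscale_def t_lin(2)[OF zX zX] sum_distrib_left)
    qed
    show "cmod (pairing t z) \<le> C * factor_norm z" if z: "z \<in> X.fin_mats" for z
    proof (cases "C = 0")
      case True
      obtain N where N: "z \<in> os_mat (E\<lparr>os_carrier := X\<rparr>) N" using z by (auto simp: X.fin_mats_def)
      obtain r where "r \<in> factor_costs z" using factor_costs_nonempty z UV by blast
      then show ?thesis using pairing_le_factor_cost[OF X t N _ C, of r] True by simp
    next
      case False
      obtain N where N: "z \<in> os_mat (E\<lparr>os_carrier := X\<rparr>) N" using z by (auto simp: X.fin_mats_def)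
      have "cmod (pairing t z) / C \<le> factor_norm z"
        unfolding factor_norm_def
      proof (rule cInf_greatest)
        show "factor_costs z \<noteq> {}" using factor_costs_nonempty z UV by blast
        fix r assume "r \<in> factor_costs z"
        then show "cmod (pairing t z) / C \<le> r"
          using pairing_le_factor_cost[OF X t N _ C, of r] False C by (simp add: field_simps)
      qed
      then show ?thesis using False C by (simp add: field_simps)
    qed
  qed (use that in blast)
  have "g (unit_mat p q v) = t p q v" if v: "v \<in> X" for p q v
  proof -
    let ?N = "Suc (max p q)"
    have N: "unit_mat p q v \<in> os_mat (E\<lparr>os_carrier := X\<rparr>) ?N"
      by (rule X.matI) (use v subspace_0[OF X(1)] in \<open>auto simp: unit_mat_def\<close>)
    have "g (unit_mat p q v) = (\<Sum>i<?N. \<Sum>j<?N. t i j (unit_mat p q v i j))"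
      using g_eq[OF X.fin_matsI[OF N]] pair[OF N] by simp
    also have "\<dots> = (\<Sum>i<?N. if i = p then (\<Sum>j<?N. if j = q then t p q v else 0) else 0)"
    proof (intro sum.cong refl)
      fix i
      have "t i j (unit_mat p q v i j) = (if i = p \<and> j = q then t p q v else 0)" for j
        by (simp add: unit_mat_def t0)
      then show "(\<Sum>j<?N. t i j (unit_mat p q v i j)) = (if i = p then (\<Sum>j<?N. if j = q then t p q v else 0) else 0)"
        by (simp del: sum.lessThan_Suc)
    qed
    also have "\<dots> = t p q v" by (simp del: sum.lessThan_Suc add: less_Suc_eq_le)
    finally show ?thesis .
  qed
  then show thesis
    using that[of "\<lambda>p q v. g (unit_mat p q v)"] cb_form_of_functional[OF C g_add g_scale g_le] by blast
qed

end

section \<open>Correcting a pointwise null sequence of maps\<close>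

text \<open>Tychonoff's theorem. A finer filter takes the place of a convergent subsequence.\<close>

lemma bounded_family_cluster:
  fixes H :: "'m \<Rightarrow> 'x \<Rightarrow> complex"
  assumes F: "F \<noteq> bot" and B: "\<And>m x. cmod (H m x) \<le> B x"
  obtains G \<phi> where "G \<noteq> bot" "G \<le> F" "\<And>x. ((\<lambda>m. H m x) \<longlongrightarrow> \<phi> x) G"
proof -
  define K where "K = (\<Pi>\<^sub>E x\<in>UNIV. cball (0::complex) (B x))"
  have "compactin (product_topology (\<lambda>x::'x. euclidean) UNIV) K"
    unfolding K_def compactin_PiE by (simp add: compactin_euclidean_iff)
  then have K: "compact K" by (simp add: euclidean_product_topology compactin_euclidean_iff)
  have "eventually (\<lambda>f. f \<in> K) (filtermap H F)"
    using B by (simp add: eventually_filtermap K_def PiE_iff)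
  moreover have "filtermap H F \<noteq> bot" using F by (simp add: filtermap_bot_iff)
  ultimately obtain \<phi> where \<phi>: "inf (nhds \<phi>) (filtermap H F) \<noteq> bot"
    using K unfolding compact_filter by blast
  let ?G = "inf F (filtercomap H (nhds \<phi>))"
  show thesis
  proof (rule that)
    show "?G \<le> F" by simp
    show "?G \<noteq> bot"
    proof
      assume "?G = bot"
      then have "eventually (\<lambda>m. False) ?G" by simp
      then obtain P Q where P: "eventually P F" and Q: "eventually Q (filtercomap H (nhds \<phi>))"
        and PQ: "\<And>m. P m \<Longrightarrow> Q m \<Longrightarrow> False"
        unfolding eventually_inf by blast
      obtain Q' where Q': "eventually Q' (nhds \<phi>)" "\<And>m. Q' (H m) \<Longrightarrow> Q m"
        using Q unfolding eventually_filtercomap by blast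
      have "eventually (\<lambda>f. \<not> Q' f) (filtermap H F)"
        unfolding eventually_filtermap using P by eventually_elim (use PQ Q' in blast)
      then have "eventually (\<lambda>f. False) (inf (nhds \<phi>) (filtermap H F))"
        unfolding eventually_inf using Q'(1) by blast
      then show False using \<phi> by (simp add: trivial_limit_def)
    qed
    fix x
    have "filterlim H (nhds \<phi>) (filtercomap H (nhds \<phi>))" by (rule filterlim_filtercomap)
    then have lim: "filterlim H (nhds \<phi>) ?G" by (rule filterlim_mono) simp_all
    show "((\<lambda>m. H m x) \<longlongrightarrow> \<phi> x) ?G"
      by (rule continuous_on_tendsto_compose[OF continuous_on_product_coordinates lim]) simp_all
  qed
qed

lemma form_bound_amplified_compose:
  fixes T :: "'i \<Rightarrow> 'k \<times> nat \<Rightarrow> complex"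
  assumes T: "form_bound T D" and B: "form_bound B \<beta>"
  shows "form_bound (\<lambda>i (k, r). \<Sum>q<M. T i (k, q) * B q r) (D * \<beta>)"
proof (rule form_boundI_local, intro exI conjI ballI)
  fix I :: "'i set" and J :: "('k \<times> 'a) set" assume "finite I" and J: "finite J"
  let ?R = "fst ` J \<times> {..<M}"
  let ?B = "\<lambda>(k :: 'k, q) (k', r). if k = k' then B q r else 0"
  show "form_bound (\<lambda>i j. \<Sum>s\<in>?R. T i s * ?B s j) (D * \<beta>)"
    by (rule form_bound_compose[OF T form_bound_amplify[OF B]]) (use J in simp)
  fix i j assume "i \<in> I" and j: "j \<in> J"
  have "(\<Sum>s\<in>?R. T i s * ?B s j) = (\<Sum>k\<in>fst ` J. \<Sum>q<M. if k = fst j then T i (k, q) * B q (snd j) else 0)"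
    unfolding sum.cartesian_product' by (intro sum.cong refl) (auto simp: case_prod_beta)
  also have "\<dots> = (\<Sum>k\<in>fst ` J. if k = fst j then (\<Sum>q<M. T i (k, q) * B q (snd j)) else 0)"
    by (intro sum.cong refl) simp
  also have "\<dots> = (\<Sum>q<M. T i (fst j, q) * B q (snd j))"
    using J j by (simp add: sum.delta)
  finally show "(\<Sum>s\<in>?R. T i s * ?B s j) = (case j of (k, r) \<Rightarrow> \<Sum>q<M. T i (k, q) * B q r)"
    by (simp add: case_prod_beta)
qed

lemma cb_form_compose_right:
  assumes t: "cb_form Y C t" and B: "form_bound B 1"
  shows "cb_form Y C (\<lambda>p r v. \<Sum>q<M. t p q v * B q r)"
  unfolding cb_form_def
proof (intro allI ballI impI)
  fix k :: nat and x assume "1 \<le> k" "x \<in> os_mat Y k"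
  then have fb: "form_bound (\<lambda>(i, p) (j, q). t p q (x i j)) (C * os_norm Y k x)" using t by (simp add: cb_form_def)
  have "(\<lambda>(i, p) (j, r). \<Sum>q<M. t p q (x i j) * B q r) =
    (\<lambda>i (j, r). \<Sum>q<M. (case i of (i, p) \<Rightarrow> \<lambda>(j, q). t p q (x i j)) (j, q) * B q r)"
    by (auto simp: fun_eq_iff)
  then show "form_bound (\<lambda>(i, p) (j, r). \<Sum>q<M. t p q (x i j) * B q r) (C * os_norm Y k x)"
    using form_bound_amplified_compose[OF fb B, of M] by simp
qed

lemma functional_on_sum:
  assumes "\<And>s. s \<in> S \<Longrightarrow> functional_on Y (\<phi> s)"
  shows "functional_on Y (\<lambda>v. \<Sum>s\<in>S. \<phi> s v * c s)"
  using assms unfolding functional_on_def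
  by (simp add: sum.distrib[symmetric] distrib_right sum_distrib_left mult.assoc)

lemma cb_form_value:
  assumes "cb_form Y C t" "v \<in> os_carrier Y"
  shows "form_bound (\<lambda>p q. t p q v) (C * os_norm1 Y v)"
proof -
  have "single_entry v \<in> os_mat Y 1" using assms(2) by (auto simp: os_mat_def single_entry_def)
  then have "form_bound (\<lambda>(i, p) (j, q). t p q (single_entry v i j)) (C * os_norm1 Y v)"
    using assms(1) unfolding cb_form_def os_norm1_def by blast
  from form_bound_reindex[OF this, of "Pair 0" "Pair 0"] show ?thesis by (simp add: single_entry_def inj_def)
qed

lemma form_bound_single_row:
  fixes f :: "'b \<Rightarrow> complex" and p :: 'a
  assumes "\<And>J. finite J \<Longrightarrow> fin_norm J f \<le> B"
  shows "form_bound (\<lambda>i j. if i = p then f j else 0) B"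
proof (rule form_boundI_apply)
  fix I :: "'a set" and J :: "'b set" and \<xi> :: "'b \<Rightarrow> complex" assume *: "finite I" "finite J"
  have B: "0 \<le> B" using assms[of "{}"] by simp
  have "L2_set (\<lambda>i. cmod (\<Sum>j\<in>J. (if i = p then f j else 0) * \<xi> j)) I
     = L2_set (\<lambda>i. if i = p then cmod (\<Sum>j\<in>J. f j * \<xi> j) else 0) I"
    by (intro L2_set_cong) auto
  also have "\<dots> \<le> cmod (\<Sum>j\<in>J. f j * \<xi> j)"
  proof -
    have "(\<Sum>i\<in>I. (if i = p then cmod (\<Sum>j\<in>J. f j * \<xi> j) else 0)\<^sup>2) =
      (\<Sum>i\<in>I. if i = p then (cmod (\<Sum>j\<in>J. f j * \<xi> j))\<^sup>2 else 0)"
      by (intro sum.cong) auto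
    also have "\<dots> \<le> (cmod (\<Sum>j\<in>J. f j * \<xi> j))\<^sup>2" using * by (simp add: sum.delta)
    finally show ?thesis unfolding L2_set_def by (intro real_le_lsqrt) auto
  qed
  also have "\<dots> \<le> fin_norm J f * fin_norm J \<xi>" by (rule cmod_sum_mult_le_L2)
  also have "\<dots> \<le> B * fin_norm J \<xi>" by (intro mult_right_mono assms * L2_set_nonneg)
  finally show "L2_set (\<lambda>i. cmod (\<Sum>j\<in>J. (if i = p then f j else 0) * \<xi> j)) I \<le> B * fin_norm J \<xi>" .
qed

lemma row_tail:
  fixes f :: "nat \<Rightarrow> complex"
  assumes "\<And>J. finite J \<Longrightarrow> fin_norm J f \<le> C" and e: "e > 0"
  shows "\<exists>M0. \<forall>M\<ge>M0. \<forall>J. finite J \<longrightarrow> L2_set (\<lambda>j. cmod (if M \<le> j then f j else 0)) J \<le> e"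
proof -
  have "summable (\<lambda>j. (cmod (f j))\<^sup>2)"
  proof (rule summableI_nonneg_bounded)
    show "(\<Sum>j<m. (cmod (f j))\<^sup>2) \<le> C\<^sup>2" for m
      using assms(1)[of "{..<m}"] unfolding L2_set_def by (intro sqrt_le_D) simp
  qed simp
  then obtain M0 where M0: "\<And>m n. m \<ge> M0 \<Longrightarrow> norm (\<Sum>j=m..<n. (cmod (f j))\<^sup>2) < e\<^sup>2"
    unfolding summable_Cauchy using e by (meson zero_less_power)
  have "L2_set (\<lambda>j. cmod (if M \<le> j then f j else 0)) J \<le> e" if M: "M \<ge> M0" and J: "finite J" for M J
  proof -
    obtain n where n: "J \<subseteq> {..<n}" using J finite_nat_iff_bounded by blast
    have "(\<Sum>j\<in>J. (cmod (if M \<le> j then f j else 0))\<^sup>2) \<le> (\<Sum>j<n. (cmod (if M \<le> j then f j else 0))\<^sup>2)"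
      by (rule sum_mono2) (use n in auto)
    also have "\<dots> = (\<Sum>j=M..<n. (cmod (f j))\<^sup>2)"
      by (rule sum.mono_neutral_cong_right) auto
    also have "\<dots> \<le> e\<^sup>2" using M0[OF M, of n] by (simp add: sum_nonneg)
    finally show ?thesis unfolding L2_set_def using e by (intro real_le_lsqrt) auto
  qed
  then show ?thesis by blast
qed

text \<open>Each of the finitely many rows is square summable, and its tail has a small norm.\<close>

lemma finite_rows_tail:
  fixes A :: "nat \<Rightarrow> nat \<Rightarrow> complex"
  assumes A: "form_bound A C" and rows: "\<And>i j. n \<le> i \<Longrightarrow> A i j = 0" and e: "e > 0"
  shows "\<exists>M0. \<forall>M\<ge>M0. form_bound (\<lambda>i j. if M \<le> j then A i j else 0) e"
proof -
  define d where "d = e / (real n + 1)"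
  have d: "d > 0" using e by (simp add: d_def)
  have "\<exists>M0. \<forall>M\<ge>M0. form_bound (\<lambda>i j. if i = p then (if M \<le> j then A p j else 0) else 0) d" for p
  proof -
    have "L2_set (\<lambda>j. cmod (A p j)) J \<le> C" if J: "finite J" for J
      using form_bound_apply[OF form_bound_transpose[THEN iffD2, OF A], of J "{p}" "\<lambda>_. 1"] J by simp
    then obtain M0 where "\<And>M J. M \<ge> M0 \<Longrightarrow> finite J \<Longrightarrow> L2_set (\<lambda>j. cmod (if M \<le> j then A p j else 0)) J \<le> d"
      using row_tail[of "A p" C d] d by blast
    then show ?thesis by (intro exI[of _ M0] allI impI form_bound_single_row) 
  qed
  then have "\<forall>p. \<exists>M0. \<forall>M\<ge>M0. form_bound (\<lambda>i j. if i = p then (if M \<le> j then A p j else 0) else 0) d" ..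
  from choice[OF this] obtain M0
    where M0: "\<forall>p. \<forall>M\<ge>M0 p. form_bound (\<lambda>i j. if i = p then (if M \<le> j then A p j else 0) else 0) d" ..
  have "form_bound (\<lambda>i j. if M \<le> j then A i j else 0) e" if M: "M \<ge> (\<Sum>p<n. M0 p)" for M
  proof -
    have "M0 p \<le> M" if "p < n" for p
      using M member_le_sum[of p "{..<n}" M0] that by simp
    then have "form_bound (\<lambda>i j. \<Sum>p<n. if i = p then (if M \<le> j then A p j else 0) else 0) (\<Sum>p<n. d)"
      by (intro form_bound_sum M0[rule_format]) auto
    moreover have "(\<Sum>p<n. if i = p then (if M \<le> j then A p j else 0) else 0) = (if M \<le> j then A i j else 0)" for i j
      using rows by (simp add: sum.delta')
    moreover have "(\<Sum>p<n. d) \<le> e" using e by (simp add: d_def field_simps)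
    ultimately show ?thesis by (auto intro: form_bound_mono)
  qed
  then show ?thesis by blast
qed

text \<open>
  Finitely many matrices with \<open>n\<close> rows are, up to a small error, supported on finitely many columns,
  and their rows then span a space whose dimension is at most the number of rows altogether. The partial
  isometry \<open>u\<close> onto that span compresses them without loss.
\<close>

lemma compress_rows:
  fixes A :: "'s \<Rightarrow> nat \<Rightarrow> nat \<Rightarrow> complex"
  assumes S: "finite S" and A: "\<And>s. s \<in> S \<Longrightarrow> \<exists>C. form_bound (A s) C"
    and rows: "\<And>s i j. s \<in> S \<Longrightarrow> n \<le> i \<Longrightarrow> A s i j = 0" and e: "e > 0"
  shows "\<exists>M u. form_bound u 1 \<and>
    (\<forall>s\<in>S. form_bound (\<lambda>i q. A s i q - (\<Sum>r<card S * n. (\<Sum>l<M. A s i l * cnj (u r l)) * u r q)) e)"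
proof -
  obtain y where y: "bij_betw y {..<card S} S"
    using ex_bij_betw_nat_finite[OF S] by (auto simp: atLeast0LessThan)
  let ?N = "card S * n"
  have "\<exists>M0. \<forall>M\<ge>M0. form_bound (\<lambda>i j. if M \<le> j then A s i j else 0) e" if s: "s \<in> S" for s
  proof -
    obtain C where "form_bound (A s) C" using A[OF s] ..
    then show ?thesis by (rule finite_rows_tail[OF _ rows[OF s] e])
  qed
  then have "\<forall>s\<in>S. \<exists>M0. \<forall>M\<ge>M0. form_bound (\<lambda>i j. if M \<le> j then A s i j else 0) e" ..
  from bchoice[OF this] obtain M0
    where M0: "\<forall>s\<in>S. \<forall>M\<ge>M0 s. form_bound (\<lambda>i j. if M \<le> j then A s i j else 0) e" ..
  define M where "M = (\<Sum>s\<in>S. M0 s)"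
  have tail: "form_bound (\<lambda>i j. if M \<le> j then A s i j else 0) e" if s: "s \<in> S" for s
    by (rule M0[rule_format, OF s]) (use member_le_sum[OF s, of M0] S in \<open>simp add: M_def\<close>)
  \<comment> \<open>The rows of all the matrices are numbered consecutively: row \<open>i\<close> of \<open>A (y j)\<close> is number \<open>j * n + i\<close>.\<close>
  obtain w f where orth: "\<forall>r<?N. \<forall>s<?N. r \<noteq> s \<longrightarrow> (\<Sum>l<M. w r l * cnj (w s l)) = 0"
    and unit: "\<forall>r<?N. (\<Sum>l<M. w r l * cnj (w r l)) = 1 \<or> (\<forall>l\<in>{..<M}. w r l = 0)"
    and vw: "\<forall>j<?N. \<forall>q\<in>{..<M}. A (y (j div n)) (j mod n) q =
      (\<Sum>r<?N. (\<Sum>l<M. A (y (j div n)) (j mod n) l * cnj (w r l)) * w r q)"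
    and "\<forall>r<?N. \<forall>q\<in>{..<M}. w r q = (\<Sum>j<?N. f r j * A (y (j div n)) (j mod n) q)"
    using finite_gram_schmidt[OF finite_lessThan[of M], where N = ?N and v = "\<lambda>j q. A (y (j div n)) (j mod n) q"]
    by (elim exE conjE) (rule that; assumption)
  define u where "u r l = (if r < ?N \<and> l \<in> {..<M} then w r l else 0)" for r l
  have "form_bound u 1" unfolding u_def by (rule form_bound_orthonormal) (use orth unit in auto)
  moreover have "form_bound (\<lambda>i q. A s i q - (\<Sum>r<?N. (\<Sum>l<M. A s i l * cnj (u r l)) * u r q)) e" if s: "s \<in> S" for s
  proof -
    have "A s i q - (\<Sum>r<?N. (\<Sum>l<M. A s i l * cnj (u r l)) * u r q) = (if M \<le> q then A s i q else 0)" for i q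
    proof (cases "q < M \<and> i < n")
      case True
      have "s \<in> y ` {..<card S}" using y s by (simp add: bij_betw_def)
      then obtain j where j: "j < card S" "y j = s" by auto
      have "j * n + i < ?N"
      proof -
        have "j * n + i < Suc j * n" using True by simp
        also have "\<dots> \<le> ?N" using j(1) by (intro mult_le_mono1) simp
        finally show ?thesis .
      qed
      moreover have "(j * n + i) div n = j" "(j * n + i) mod n = i" using True by auto
      ultimately have "A s i q = (\<Sum>r<?N. (\<Sum>l<M. A s i l * cnj (w r l)) * w r q)"
        using vw[rule_format, of "j * n + i" q] True j(2) by simp
      then show ?thesis using True by (simp add: u_def)
    next
      case False
      then show ?thesis using rows[OF s] by (auto simp: u_def not_less)
    qed
    then show ?thesis using tail[OF s] by simp
  qed
  ultimately show ?thesis by blast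
qed

text \<open>\<open>P\<close> and \<open>Q\<close> mark the rows and columns that have to vanish.\<close>

definition cb_map ::
  "('y::ab_group_add) opspace \<Rightarrow> real \<Rightarrow> (nat \<Rightarrow> bool) \<Rightarrow> (nat \<Rightarrow> bool) \<Rightarrow> (nat \<Rightarrow> nat \<Rightarrow> 'y \<Rightarrow> complex) \<Rightarrow> bool" where
  "cb_map Y C P Q t \<longleftrightarrow> cb_form Y C t \<and> (\<forall>p q. functional_on Y (t p q)) \<and>
     (\<forall>p q v. P p \<or> Q q \<longrightarrow> t p q v = 0)"

definition pointwise_null :: "'y set \<Rightarrow> (nat \<Rightarrow> nat \<Rightarrow> nat \<Rightarrow> 'y \<Rightarrow> complex) \<Rightarrow> bool" where
  "pointwise_null X t \<longleftrightarrow> (\<forall>v\<in>X. \<forall>e>0. \<forall>\<^sub>F m in sequentially. form_bound (\<lambda>p q. t m p q v) e)"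

text \<open>Every bounded sequence \<open>t\<close> of maps that tends to zero on \<open>X\<close> can, late in the sequence, be
  approximated on a finite set by maps with the same bound that vanish on \<open>X\<close>.\<close>

definition correctable ::
  "('y::ab_group_add) opspace \<Rightarrow> real \<Rightarrow> 'y set \<Rightarrow> (nat \<Rightarrow> bool) \<Rightarrow> (nat \<Rightarrow> bool) \<Rightarrow> bool" where
  "correctable Y C X P Q \<longleftrightarrow> (\<forall>t S \<delta>. (\<forall>m. cb_map Y C P Q (t m)) \<longrightarrow> pointwise_null X t \<longrightarrow>
     finite S \<longrightarrow> S \<subseteq> os_carrier Y \<longrightarrow> \<delta> > 0 \<longrightarrow>
     (\<forall>\<^sub>F m in sequentially. \<exists>g. cb_map Y C P Q g \<and> (\<forall>v\<in>X. \<forall>p q. g p q v = 0) \<and>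
        (\<forall>v\<in>S. form_bound (\<lambda>p q. t m p q v - g p q v) \<delta>)))"

text \<open>Suppose that the approximation fails for infinitely many \<open>m\<close>. For these, compress \<open>t m\<close> by a
  partial isometry \<open>u m\<close> to a map \<open>h m\<close> into matrices of fixed size \<open>n \<times> N\<close>, almost without loss on
  \<open>S\<close>. The entries of \<open>h m\<close> are bounded, so there is a cluster point \<open>g\<close>; it vanishes on \<open>X\<close>, where
  \<open>h m\<close> tends to zero. If \<open>h m\<close> is close to \<open>g\<close> on \<open>S\<close>, then \<open>g\<close> followed by \<open>u m\<close> is an
  approximation of \<open>t m\<close> after all.\<close>

theorem correctable_rows:
  fixes Y :: "'y::ab_group_add opspace"
  assumes Y0: "0 \<in> os_carrier Y"
    and Ysub: "\<And>v w. v \<in> os_carrier Y \<Longrightarrow> w \<in> os_carrier Y \<Longrightarrow> v + w \<in> os_carrier Y"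
      "\<And>c v. v \<in> os_carrier Y \<Longrightarrow> os_scale Y c v \<in> os_carrier Y"
    and X: "X \<subseteq> os_carrier Y"
  shows "correctable Y C X (\<lambda>p. n \<le> p) (\<lambda>_. False)"
  unfolding correctable_def
proof (intro allI impI)
  fix t :: "nat \<Rightarrow> nat \<Rightarrow> nat \<Rightarrow> 'y \<Rightarrow> complex" and S and \<delta> :: real
  let ?P = "\<lambda>m. \<exists>g. cb_map Y C (\<lambda>p. n \<le> p) (\<lambda>_. False) g \<and> (\<forall>v\<in>X. \<forall>p q. g p q v = 0) \<and>
    (\<forall>v\<in>S. form_bound (\<lambda>p q. t m p q v - g p q v) \<delta>)"
  assume t: "\<forall>m. cb_map Y C (\<lambda>p. n \<le> p) (\<lambda>_. False) (t m)" and null: "pointwise_null X t"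
    and S: "finite S" "S \<subseteq> os_carrier Y" and \<delta>: "\<delta> > 0"
  have lin: "functional_on Y (t m p q)" and cb: "cb_form Y C (t m)"
    and rows: "n \<le> p \<Longrightarrow> t m p q v = 0" for m p q v
    using t unfolding cb_map_def by blast+
  show "eventually ?P sequentially"
proof (rule ccontr)
  assume "\<not> eventually ?P sequentially"
  then have freq: "\<exists>\<^sub>F m in sequentially. \<not> ?P m" by (simp add: frequently_def)
  \<comment> \<open>Convergence along \<open>F\<close> means convergence along the indices for which the approximation fails.\<close>
  define F where "F = inf sequentially (principal {m. \<not> ?P m})"
  have F: "F \<noteq> bot"
  proof
    assume "F = bot"
    then have "eventually (\<lambda>m. False) F" by simp
    then have "eventually (\<lambda>m. ?P m) sequentially" unfolding F_def eventually_inf_principal by simp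
    then show False using freq by (simp add: frequently_def)
  qed
  define N where "N = card S * n"
  have "\<forall>m. \<exists>M u. form_bound u 1 \<and>
    (\<forall>v\<in>S. form_bound (\<lambda>p q. t m p q v - (\<Sum>r<N. (\<Sum>l<M. t m p l v * cnj (u r l)) * u r q)) (\<delta> / 2))"
    unfolding N_def
    by (rule allI, rule compress_rows[OF S(1)]) (use S(2) cb_form_value[OF cb] rows \<delta> in auto)
  from choice[OF this] obtain M where "\<forall>m. \<exists>u. form_bound u 1 \<and>
    (\<forall>v\<in>S. form_bound (\<lambda>p q. t m p q v - (\<Sum>r<N. (\<Sum>l<M m. t m p l v * cnj (u r l)) * u r q)) (\<delta> / 2))" ..
  from choice[OF this] obtain u where Mu: "\<forall>m. form_bound (u m) 1 \<and>
    (\<forall>v\<in>S. form_bound (\<lambda>p q. t m p q v - (\<Sum>r<N. (\<Sum>l<M m. t m p l v * cnj (u m r l)) * u m r q)) (\<delta> / 2))" ..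
  have u: "form_bound (u m) 1" for m using Mu by blast
  have err: "form_bound (\<lambda>p q. t m p q v - (\<Sum>r<N. (\<Sum>l<M m. t m p l v * cnj (u m r l)) * u m r q)) (\<delta> / 2)"
    if "v \<in> S" for m v using Mu that by blast
  define h where "h m p r v = (\<Sum>l<M m. t m p l v * cnj (u m r l))" for m p r v
  have u': "form_bound (\<lambda>l r. cnj (u m r l)) 1" for m
    using form_bound_transpose[THEN iffD2, OF form_bound_cnj[OF u]] .
  have h_cb: "cb_form Y C (h m)" for m
    unfolding h_def by (rule cb_form_compose_right[OF cb u'])
  have h_lin: "functional_on Y (h m p r)" for m p r
    unfolding h_def by (rule functional_on_sum) (rule lin)
  define H where "H m x = (case x of (p, r, v) \<Rightarrow> if v \<in> os_carrier Y then h m p r v else 0)" for m x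
  have bnd: "cmod (H m x) \<le> (case x of (p, r, v) \<Rightarrow> if v \<in> os_carrier Y then C * os_norm1 Y v else 0)" for m x
  proof (cases x)
    case (fields p r v)
    show ?thesis
    proof (cases "v \<in> os_carrier Y")
      case True
      then show ?thesis using form_bound_entry[OF cb_form_value[OF h_cb True], of m p r] fields by (simp add: H_def)
    qed (simp add: H_def fields)
  qed
  obtain G \<phi> where G: "G \<noteq> bot" "G \<le> F" and lim: "\<And>x. ((\<lambda>m. H m x) \<longlongrightarrow> \<phi> x) G"
    by (rule bounded_family_cluster[where H = H, OF F bnd]) (rule that; assumption)
  have ev_G: "eventually P G" if "eventually P sequentially" for P
    using G(2) that by (auto simp: F_def le_inf_iff intro: filter_leD)
  define g where "g p r v = \<phi> (p, r, v)" for p r v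
  have hg: "((\<lambda>m. h m p r v) \<longlongrightarrow> g p r v) G" if "v \<in> os_carrier Y" for p r v
    using lim[of "(p, r, v)"] that by (simp add: H_def g_def)
  have g_unique: "g p r v = c" if "((\<lambda>m. h m p r v) \<longlongrightarrow> c) G" "v \<in> os_carrier Y" for p r v c
    using tendsto_unique[OF G(1) hg[OF that(2)] that(1)] .
  have g_cb: "cb_form Y C g"
    unfolding cb_form_def
  proof (intro allI impI ballI)
    fix k :: nat and x assume k: "1 \<le> k" and x: "x \<in> os_mat Y k"
    have xc: "x i j \<in> os_carrier Y" for i j
      using x Y0 by (cases "i < k \<and> j < k") (auto simp: os_mat_def split: if_splits)
    show "form_bound (\<lambda>(i, p) (j, q). g p q (x i j)) (C * os_norm Y k x)"
    proof (rule form_bound_limit[OF G(1)])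
      show "((\<lambda>m. (case i of (i, p) \<Rightarrow> \<lambda>(j, q). h m p q (x i j)) j) \<longlongrightarrow> (case i of (i, p) \<Rightarrow> \<lambda>(j, q). g p q (x i j)) j) G" for i j
        by (cases i; cases j) (simp add: hg[OF xc])
      show "\<forall>\<^sub>F m in G. form_bound (\<lambda>(i, p) (j, q). h m p q (x i j)) (C * os_norm Y k x)"
        using h_cb k x unfolding cb_form_def by simp
    qed simp
  qed
  have g_X: "g p r v = 0" if v: "v \<in> X" for p r v
  proof (rule g_unique)
    show "((\<lambda>m. h m p r v) \<longlongrightarrow> 0) G"
    proof (rule tendstoI)
      fix e :: real assume e: "e > 0"
      have "\<forall>\<^sub>F m in G. form_bound (\<lambda>p q. t m p q v) (e / 2)" by (rule ev_G) (use null v e in \<open>simp add: pointwise_null_def\<close>)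
      then show "\<forall>\<^sub>F m in G. dist (h m p r v) 0 < e"
      proof eventually_elim
        case (elim m)
        have "form_bound (\<lambda>p r. h m p r v) (e / 2 * 1)"
          unfolding h_def by (rule form_bound_compose[OF elim u']) simp
        from form_bound_entry[OF this, of p r] show ?case using e by simp
      qed
    qed
  qed (use v X in auto)
  have g_rows: "g p r v = 0" if "n \<le> p" for p r v
  proof -
    have "H m (p, r, v) = 0" for m using rows[OF that] by (simp add: H_def h_def)
    then show ?thesis using tendsto_unique[OF G(1) lim[of "(p, r, v)"], of 0] by (simp add: g_def)
  qed
  define c where "c = real n * real N + 1"
  have c: "c > 0" by (simp add: c_def add_nonneg_pos)
  define \<eta> where "\<eta> = \<delta> / 2 / c"
  have \<eta>: "\<eta> > 0" using \<delta> c by (simp add: \<eta>_def)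
  have "\<forall>\<^sub>F m in G. \<forall>v\<in>S. \<forall>p\<in>{..<n}. \<forall>r\<in>{..<N}. dist (h m p r v) (g p r v) < \<eta>"
    by (intro eventually_ball_finite ballI S(1) finite_lessThan tendstoD[OF hg] \<eta>) (use S in auto)
  moreover have "\<forall>\<^sub>F m in G. \<not> ?P m"
    using G(2) unfolding F_def le_inf_iff le_principal by simp
  ultimately have "\<forall>\<^sub>F m in G. (\<forall>v\<in>S. \<forall>p\<in>{..<n}. \<forall>r\<in>{..<N}. dist (h m p r v) (g p r v) < \<eta>) \<and> \<not> ?P m"
    by (rule eventually_conj)
  then obtain m where close: "\<And>v p r. v \<in> S \<Longrightarrow> p < n \<Longrightarrow> r < N \<Longrightarrow> dist (h m p r v) (g p r v) < \<eta>"
    and notP: "\<not> ?P m"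
    using eventually_happens'[OF G(1)] by fastforce
  define g' where "g' p q v = (\<Sum>r<N. g p r v * u m r q)" for p q v
  have "form_bound (\<lambda>p q. t m p q v - g' p q v) \<delta>" if v: "v \<in> S" for v
  proof -
    let ?d = "\<lambda>p r. if p < n \<and> r < N then h m p r v - g p r v else 0"
    have "form_bound ?d (of_nat (card {..<n}) * of_nat (card {..<N}) * \<eta>)"
    proof (rule form_bound_finite_entries)
      show "cmod (?d p r) \<le> \<eta>" for p r
        using close[OF v, of p r] \<eta> by (auto simp: dist_norm)
    qed auto
    from form_bound_compose[OF this u, of "{..<N}" m]
    have "form_bound (\<lambda>p q. \<Sum>r<N. ?d p r * u m r q) (real n * real N * \<eta>)" by simp
    moreover have "real n * real N * \<eta> \<le> \<delta> / 2"
    proof -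
      have "real n * real N * \<eta> \<le> c * \<eta>" using \<eta> by (simp add: c_def distrib_right)
      also have "\<dots> = \<delta> / 2" using c by (simp add: \<eta>_def)
      finally show ?thesis .
    qed
    ultimately have "form_bound (\<lambda>p q. \<Sum>r<N. ?d p r * u m r q) (\<delta> / 2)" by (rule form_bound_mono)
    moreover have "(\<Sum>r<N. ?d p r * u m r q) = (\<Sum>r<N. h m p r v * u m r q) - g' p q v" for p q
    proof -
      have "?d p r = h m p r v - g p r v" if "r < N" for r
        using that rows[of n] g_rows by (auto simp: h_def rows)
      then show ?thesis unfolding g'_def sum_subtractf[symmetric] by (intro sum.cong refl) (simp add: left_diff_distrib)
    qed
    ultimately have "form_bound (\<lambda>p q. (\<Sum>r<N. h m p r v * u m r q) - g' p q v) (\<delta> / 2)" by simp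
    from form_bound_add[OF err[OF v, of m, folded h_def] this]
    show ?thesis by simp
  qed
  moreover have "cb_form Y C g'"
    unfolding g'_def by (rule cb_form_compose_right[OF g_cb u])
  moreover have "functional_on Y (g' p q)" for p q
    unfolding g'_def
  proof (rule functional_on_sum)
    fix r
    have lin_h: "h m p r (v + w) = h m p r v + h m p r w" "h m p r (os_scale Y c v) = c * h m p r v"
      if "v \<in> os_carrier Y" "w \<in> os_carrier Y" for m v w c
      using h_lin[of m p r] that unfolding functional_on_def by auto
    show "functional_on Y (g p r)"
      unfolding functional_on_def
    proof (intro conjI ballI allI)
      fix v w assume v: "v \<in> os_carrier Y" and w: "w \<in> os_carrier Y"
      show "g p r (v + w) = g p r v + g p r w"
        by (rule g_unique) (use tendsto_add[OF hg[OF v] hg[OF w]] Ysub v w in \<open>auto simp: lin_h\<close>)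
    next
      fix c v assume v: "v \<in> os_carrier Y"
      show "g p r (os_scale Y c v) = c * g p r v"
        by (rule g_unique) (use tendsto_mult[OF tendsto_const hg[OF v]] Ysub v in \<open>auto simp: lin_h(2)[OF v v]\<close>)
    qed
  qed
  moreover have "g' p q v = 0" if "n \<le> p" for p q v using g_rows[OF that] by (simp add: g'_def)
  moreover have "g' p q v = 0" if "v \<in> X" for p q v using g_X[OF that] by (simp add: g'_def)
  ultimately have "?P m" unfolding cb_map_def by blast
  then show False using notP by contradiction
qed
qed

section \<open>The separable extension property\<close>

text \<open>Transposing all matrices interchanges the roles of rows and columns.\<close>

definition opposite :: "'y opspace \<Rightarrow> 'y opspace" where
  "opposite Y = Y\<lparr>os_norm := \<lambda>k x. os_norm Y k (\<lambda>i j. x j i)\<rparr>"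

lemma opposite_simps [simp]:
  "os_carrier (opposite Y) = os_carrier Y" "os_scale (opposite Y) = os_scale Y"
  "opposite (opposite Y) = Y"
  by (simp_all add: opposite_def)

lemma functional_on_opposite [simp]: "functional_on (opposite Y) = functional_on Y"
  by (simp add: functional_on_def fun_eq_iff)

lemma cb_form_opposite:
  assumes "cb_form Y C t" shows "cb_form (opposite Y) C (\<lambda>p q. t q p)"
  unfolding cb_form_def
proof (intro allI impI ballI)
  fix k :: nat and x assume k: "1 \<le> k" and x: "x \<in> os_mat (opposite Y) k"
  have "(\<lambda>i j. x j i) \<in> os_mat Y k" using x by (auto simp: os_mat_def opposite_def split: if_splits)
  then have "form_bound (\<lambda>(i, p) (j, q). t p q (x j i)) (C * os_norm Y k (\<lambda>i j. x j i))"
    using assms k by (simp add: cb_form_def)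
  from form_bound_transpose[THEN iffD2, OF this]
  have "form_bound (\<lambda>j i. (case i of (i, p) \<Rightarrow> \<lambda>(j, q). t p q (x j i)) j) (C * os_norm Y k (\<lambda>i j. x j i))" .
  moreover have "(\<lambda>j i. (case i of (i, p) \<Rightarrow> \<lambda>(j, q). t p q (x j i)) j) = (\<lambda>(i, p) (j, q). t q p (x i j))"
    by (auto simp: fun_eq_iff)
  ultimately show "form_bound (\<lambda>(i, p) (j, q). t q p (x i j)) (C * os_norm (opposite Y) k x)"
    by (simp add: opposite_def)
qed

theorem correctable_cols:
  fixes Y :: "'y::ab_group_add opspace"
  assumes "0 \<in> os_carrier Y"
    and "\<And>v w. v \<in> os_carrier Y \<Longrightarrow> w \<in> os_carrier Y \<Longrightarrow> v + w \<in> os_carrier Y"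
      "\<And>c v. v \<in> os_carrier Y \<Longrightarrow> os_scale Y c v \<in> os_carrier Y"
    and "X \<subseteq> os_carrier Y"
  shows "correctable Y C X (\<lambda>_. False) (\<lambda>q. n \<le> q)"
  unfolding correctable_def
proof (intro allI impI)
  fix t :: "nat \<Rightarrow> nat \<Rightarrow> nat \<Rightarrow> 'y \<Rightarrow> complex" and S and \<delta> :: real
  assume t: "\<forall>m. cb_map Y C (\<lambda>_. False) (\<lambda>q. n \<le> q) (t m)" and null: "pointwise_null X t"
    and S: "finite S" "S \<subseteq> os_carrier Y" and \<delta>: "\<delta> > 0"
  have flip: "cb_map (opposite Z) C Q P (\<lambda>p q. g q p)" if "cb_map Z C P Q g" for Z :: "'y opspace" and P Q g
    using that cb_form_opposite[of Z C g] by (auto simp: cb_map_def)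
  have "correctable (opposite Y) C X (\<lambda>p. n \<le> p) (\<lambda>_. False)"
    by (rule correctable_rows) (use assms in auto)
  moreover have "\<forall>m. cb_map (opposite Y) C (\<lambda>p. n \<le> p) (\<lambda>_. False) (\<lambda>p q. t m q p)"
    using t flip by blast
  moreover have "pointwise_null X (\<lambda>m p q. t m q p)"
    using null form_bound_transpose[THEN iffD2] unfolding pointwise_null_def
    by (blast intro: eventually_mono)
  ultimately have "\<forall>\<^sub>F m in sequentially. \<exists>g. cb_map (opposite Y) C (\<lambda>p. n \<le> p) (\<lambda>_. False) g \<and>
    (\<forall>v\<in>X. \<forall>p q. g p q v = 0) \<and> (\<forall>v\<in>S. form_bound (\<lambda>p q. t m q p v - g p q v) \<delta>)"
    using S \<delta> unfolding correctable_def by simp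
  then show "\<forall>\<^sub>F m in sequentially. \<exists>g. cb_map Y C (\<lambda>_. False) (\<lambda>q. n \<le> q) g \<and>
    (\<forall>v\<in>X. \<forall>p q. g p q v = 0) \<and> (\<forall>v\<in>S. form_bound (\<lambda>p q. t m p q v - g p q v) \<delta>)"
  proof eventually_elim
    case (elim m)
    then obtain g where g: "cb_map (opposite Y) C (\<lambda>p. n \<le> p) (\<lambda>_. False) g"
      "\<And>v p q. v \<in> X \<Longrightarrow> g p q v = 0"
      "\<And>v. v \<in> S \<Longrightarrow> form_bound (\<lambda>p q. t m q p v - g p q v) \<delta>" by auto
    have "cb_map Y C (\<lambda>_. False) (\<lambda>q. n \<le> q) (\<lambda>p q. g q p)" using flip[OF g(1)] by simp
    moreover have "form_bound (\<lambda>p q. t m p q v - g q p v) \<delta>" if "v \<in> S" for v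
      using form_bound_transpose[THEN iffD2, OF g(3)[OF that]] .
    ultimately show ?case using g(2) by (intro exI[of _ "\<lambda>p q. g q p"]) simp
  qed
qed

text \<open>Enumerate \<open>D\<close>. At \<open>m\<close>, take the largest \<open>d \<le> m\<close> for which the first elements of \<open>D\<close> up to \<open>d\<close> admit
  an approximation up to \<open>1 / (d + 1)\<close>; these \<open>d\<close> tend to infinity.\<close>

lemma diagonal_choice:
  fixes R :: "nat \<Rightarrow> 'g \<Rightarrow> 'y \<Rightarrow> real \<Rightarrow> bool"
  assumes D: "countable D" and A0: "A g0"
    and ev: "\<And>S \<delta>. finite S \<Longrightarrow> S \<subseteq> D \<Longrightarrow> \<delta> > 0 \<Longrightarrow> eventually (\<lambda>m. \<exists>g. A g \<and> (\<forall>v\<in>S. R m g v \<delta>)) sequentially"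
    and mono: "\<And>m g v \<delta> e. R m g v \<delta> \<Longrightarrow> \<delta> \<le> e \<Longrightarrow> R m g v e"
  obtains g where "\<And>m. A (g m)" "\<And>v e. v \<in> D \<Longrightarrow> e > 0 \<Longrightarrow> eventually (\<lambda>m. R m (g m) v e) sequentially"
proof (cases "D = {}")
  case True
  then show ?thesis using that[of "\<lambda>_. g0"] A0 by simp
next
  case False
  define y where "y = from_nat_into D"
  have y: "range y = D" unfolding y_def using D False by (rule range_from_nat_into[rotated])
  define Q where "Q d m g \<longleftrightarrow> A g \<and> (\<forall>v\<in>y ` {..d}. R m g v (1 / (real d + 1)))" for d m g
  define E where "E m = {d. d \<le> m \<and> (\<exists>g. Q d m g)}" for m
  have finE: "finite (E m)" for m by (rule finite_subset[of _ "{..m}"]) (auto simp: E_def)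
  define g where "g m = (if E m = {} then g0 else (SOME g. Q (Max (E m)) m g))" for m
  have gQ: "Q (Max (E m)) m (g m)" if "E m \<noteq> {}" for m
  proof -
    have "Max (E m) \<in> E m" using finE that by (rule Max_in)
    then have "\<exists>g. Q (Max (E m)) m g" by (simp add: E_def)
    then show ?thesis using that unfolding g_def by (simp add: someI_ex)
  qed
  show thesis
  proof (rule that)
    show "A (g m)" for m
      using gQ[of m] A0 by (cases "E m = {}") (auto simp: Q_def g_def)
    fix v and e :: real assume v: "v \<in> D" and e: "e > 0"
    obtain j where j: "v = y j" using v y by auto
    obtain i :: nat where i: "1 / e < real i" using reals_Archimedean2 by blast
    define d where "d = max i j"
    have "eventually (\<lambda>m. \<exists>g. A g \<and> (\<forall>v\<in>y ` {..d}. R m g v (1 / (real d + 1)))) sequentially"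
      by (rule ev) (use y in auto)
    then have "eventually (\<lambda>m. \<exists>g. Q d m g) sequentially" by (simp add: Q_def)
    moreover have "eventually (\<lambda>m. d \<le> m) sequentially" by (rule eventually_ge_at_top)
    ultimately show "eventually (\<lambda>m. R m (g m) v e) sequentially"
    proof eventually_elim
      case (elim m)
      then have dE: "d \<in> E m" by (simp add: E_def)
      then have ge: "d \<le> Max (E m)" using finE by simp
      then have "v \<in> y ` {..Max (E m)}" using j by (auto simp: d_def)
      then have "R m (g m) v (1 / (real (Max (E m)) + 1))" using gQ[of m] dE unfolding Q_def by blast
      moreover have "1 / (real (Max (E m)) + 1) \<le> e"
      proof -
        have "1 / e < real (Max (E m)) + 1" using i ge by (simp add: d_def)
        then show ?thesis using e by (simp add: field_simps)
      qed
      ultimately show ?case by (rule mono)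
    qed
  qed
qed

lemma functional_on_diff:
  "functional_on Y \<phi> \<Longrightarrow> functional_on Y \<psi> \<Longrightarrow> functional_on Y (\<lambda>v. \<phi> v - \<psi> v)"
  by (simp add: functional_on_def algebra_simps)

lemma cb_form_diff:
  assumes "cb_form Y C t" "cb_form Y D g" shows "cb_form Y (C + D) (\<lambda>p q v. t p q v - g p q v)"
  unfolding cb_form_def
proof (intro allI impI ballI)
  fix k :: nat and x assume "1 \<le> k" "x \<in> os_mat Y k"
  then have "form_bound (\<lambda>(i, p) (j, q). t p q (x i j)) (C * os_norm Y k x)"
    "form_bound (\<lambda>(i, p) (j, q). g p q (x i j)) (D * os_norm Y k x)" using assms by (auto simp: cb_form_def)
  from form_bound_diff[OF this]
  show "form_bound (\<lambda>(i, p) (j, q). t p q (x i j) - g p q (x i j)) ((C + D) * os_norm Y k x)"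
    by (simp add: block_eq distrib_right)
qed

lemma cb_form_restrict:
  assumes "cb_form Y C t" shows "cb_form Y C (\<lambda>p q v. if P p \<or> Q q then 0 else t p q v)"
  unfolding cb_form_def
proof (intro allI impI ballI)
  fix k :: nat and x assume "1 \<le> k" "x \<in> os_mat Y k"
  then have "form_bound (\<lambda>(i, p) (j, q). t p q (x i j)) (C * os_norm Y k x)" using assms by (auto simp: cb_form_def)
  from form_bound_restrict[OF this, of "\<lambda>i. \<not> P (snd i)" "\<lambda>i. \<not> Q (snd i)"]
  have "form_bound (\<lambda>i j. if \<not> P (snd i) \<and> \<not> Q (snd j) then t (snd i) (snd j) (x (fst i) (fst j)) else 0) (C * os_norm Y k x)"
    by (simp add: block_eq cong: if_cong)
  moreover have "(\<lambda>i j. if \<not> P (snd i) \<and> \<not> Q (snd j) then t (snd i) (snd j) (x (fst i) (fst j)) else 0)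
    = (\<lambda>(i, p) (j, q). if P p \<or> Q q then 0 else t p q (x i j))"
    by (auto simp: fun_eq_iff)
  ultimately show "form_bound (\<lambda>(i, p) (j, q). if P p \<or> Q q then 0 else t p q (x i j)) (C * os_norm Y k x)"
    by simp
qed

lemma separable_dense:
  assumes "matrix_normed_space Y" "separable_space (os_topology Y)"
  obtains D where "countable D" "D \<subseteq> os_carrier Y"
    "\<And>v e. v \<in> os_carrier Y \<Longrightarrow> e > 0 \<Longrightarrow> \<exists>y\<in>D. os_norm1 Y (v - y) < e"
proof -
  interpret matrix_normed_space Y by fact
  interpret Metric_space "os_carrier Y" "os_dist Y" by (rule Metric_space_os_dist)
  obtain D where D: "countable D" "D \<subseteq> os_carrier Y" "mtopology closure_of D = os_carrier Y"
    using assms(2) unfolding separable_space_def by auto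
  have "\<exists>y\<in>D. os_norm1 Y (v - y) < e" if v: "v \<in> os_carrier Y" and e: "e > 0" for v e
  proof -
    have "v \<in> mtopology closure_of D" using v D(3) by simp
    then obtain y where "y \<in> D" "y \<in> mball v e" using e unfolding metric_closure_of by blast
    then show ?thesis using v D(2) by (auto simp: mball_def os_dist_def)
  qed
  then show thesis using that D by blast
qed

text \<open>Extend every \<open>t m\<close> to \<open>a m\<close> with the same bound and subtract a correction \<open>g m\<close>. By the choice of
  \<open>g m\<close> the difference tends to zero on a dense set, and since it is uniformly bounded it does so
  everywhere.\<close>

lemma (in Ruan_space) corrected_extension:
  assumes sep: "separable_space (os_topology E)" and X: "subspace X" "X \<subseteq> os_carrier E" and C: "0 \<le> C"
    and lin: "\<And>m p q. functional_on (E\<lparr>os_carrier := X\<rparr>) (t m p q)"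
    and cb: "\<And>m. cb_form (E\<lparr>os_carrier := X\<rparr>) C (t m)"
    and pat: "\<And>m p q v. v \<in> X \<Longrightarrow> P p \<or> Q q \<Longrightarrow> t m p q v = 0"
    and null: "pointwise_null X t" and correct: "correctable E C X P Q"
  obtains b where "\<And>m. cb_map E (2 * C) P Q (b m)" "\<And>m p q v. v \<in> X \<Longrightarrow> b m p q v = t m p q v"
    "pointwise_null (os_carrier E) b"
proof -
  have "\<forall>m. \<exists>t'. cb_form E C t' \<and> (\<forall>p q. functional_on E (t' p q)) \<and> (\<forall>p q. \<forall>v\<in>X. t' p q v = t m p q v)"
    using cb_form_extension[OF X C cb lin] by metis
  from choice[OF this] obtain t' where t': "\<forall>m. cb_form E C (t' m) \<and> (\<forall>p q. functional_on E (t' m p q)) \<and>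
    (\<forall>p q. \<forall>v\<in>X. t' m p q v = t m p q v)" ..
  define a where "a m p q v = (if P p \<or> Q q then 0 else t' m p q v)" for m p q v
  have a: "cb_map E C P Q (a m)" for m
    unfolding cb_map_def
  proof (intro conjI allI impI)
    show "cb_form E C (a m)" using cb_form_restrict[of E C "t' m" P Q] t' by (simp add: a_def[abs_def])
    show "functional_on E (a m p q)" for p q
      using t' by (cases "P p \<or> Q q") (auto simp: a_def functional_on_def)
  qed (simp add: a_def)
  have a_X: "a m p q v = t m p q v" if "v \<in> X" for m p q v
    using t' pat[OF that] that by (auto simp: a_def)
  have a_null: "pointwise_null X a" using null by (simp add: pointwise_null_def a_X)
  obtain D where D: "countable D" "D \<subseteq> os_carrier E"
    "\<And>v e. v \<in> os_carrier E \<Longrightarrow> e > 0 \<Longrightarrow> \<exists>y\<in>D. os_norm1 E (v - y) < e"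
    using separable_dense[OF matrix_normed_space_axioms sep] by blast
  define A where "A g \<longleftrightarrow> cb_map E C P Q g \<and> (\<forall>v\<in>X. \<forall>p q. g p q v = 0)" for g
  have A0: "A (\<lambda>p q v. 0)"
  proof -
    have "form_bound (\<lambda>(i :: nat \<times> nat) (j :: nat \<times> nat). 0) (C * os_norm E k x)"
      if "1 \<le> k" "x \<in> os_mat E k" for k x
      using form_bound_mono[OF form_bound_0 mult_nonneg_nonneg[OF C norm_nonneg[OF that]]] .
    then show ?thesis unfolding A_def cb_map_def cb_form_def block_eq by (simp add: functional_on_def)
  qed
  have ev: "\<forall>\<^sub>F m in sequentially. \<exists>g. A g \<and> (\<forall>v\<in>S. form_bound (\<lambda>p q. a m p q v - g p q v) \<delta>)"
    if "finite S" "S \<subseteq> D" "\<delta> > 0" for S \<delta>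
    using correct a a_null that D(2) unfolding correctable_def A_def conj_assoc by (meson subset_trans)
  obtain g where g: "\<And>m. A (g m)"
    and g_close: "\<And>v e. v \<in> D \<Longrightarrow> e > 0 \<Longrightarrow> \<forall>\<^sub>F m in sequentially. form_bound (\<lambda>p q. a m p q v - g m p q v) e"
    by (rule diagonal_choice[OF D(1) A0 ev form_bound_mono]) blast+
  define b where "b m p q v = a m p q v - g m p q v" for m p q v
  have b_cb: "cb_form E (2 * C) (b m)" and b_lin: "functional_on E (b m p q)" for m p q
    using cb_form_diff[of E C "a m" C "g m"] functional_on_diff[of E "a m p q" "g m p q"] g[of m] a[of m]
    by (simp_all add: b_def[abs_def] A_def cb_map_def)
  show thesis
  proof (rule that)
    show "cb_map E (2 * C) P Q (b m)" for m
      using b_cb b_lin g[of m] a[of m] by (auto simp: cb_map_def A_def b_def)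
    show "b m p q v = t m p q v" if "v \<in> X" for m p q v
      using a_X[OF that] g[of m] that by (auto simp: b_def A_def)
    show "pointwise_null (os_carrier E) b"
      unfolding pointwise_null_def
    proof (intro ballI allI impI)
      fix v and e :: real assume v: "v \<in> os_carrier E" and e: "e > 0"
      obtain y where y: "y \<in> D" "os_norm1 E (v - y) < e / 2 / (2 * C + 1)"
        using D(3)[OF v, of "e / 2 / (2 * C + 1)"] e C by auto
      have yc: "y \<in> os_carrier E" using y(1) D(2) by blast
      have dc: "v - y \<in> os_carrier E" by (intro subspace_diff carrier v yc)
      have "2 * C * os_norm1 E (v - y) \<le> (2 * C + 1) * os_norm1 E (v - y)"
        using norm1_nonneg[OF dc] by (simp add: distrib_right)
      also have "\<dots> \<le> (2 * C + 1) * (e / 2 / (2 * C + 1))" using y(2) C by (intro mult_left_mono) auto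
      also have "\<dots> = e / 2"
      proof -
        have "2 * C + 1 \<noteq> 0" using C by simp
        then have "(2 * C + 1) * (d / (2 * C + 1)) = d" for d
          by (metis nonzero_mult_div_cancel_left times_divide_eq_right)
        then show ?thesis by blast
      qed
      finally have small: "2 * C * os_norm1 E (v - y) \<le> e / 2" .
      have "\<forall>\<^sub>F m in sequentially. form_bound (\<lambda>p q. b m p q y) (e / 2)"
        unfolding b_def by (rule g_close[OF y(1)]) (use e in simp)
      then show "\<forall>\<^sub>F m in sequentially. form_bound (\<lambda>p q. b m p q v) e"
      proof eventually_elim
        case (elim m)
        have "form_bound (\<lambda>p q. b m p q y + b m p q (v - y)) (e / 2 + e / 2)"
          by (rule form_bound_add[OF elim form_bound_mono[OF cb_form_value[OF b_cb dc] small]])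
        moreover have "b m p q y + b m p q (v - y) = b m p q v" for p q
        proof -
          have "b m p q (y + (v - y)) = b m p q y + b m p q (v - y)"
            using b_lin[of m p q] yc dc unfolding functional_on_def by blast
          then show ?thesis by simp
        qed
        ultimately show ?case by simp
      qed
    qed
  qed
qed

lemma completely_bounded_image:
  assumes "matrix_normed_space E" "matrix_normed_space F" "os_linear E F T"
  shows "T 0 = 0" "x \<in> os_mat E k \<Longrightarrow> (\<lambda>i j. T (x i j)) \<in> os_mat F k"
proof -
  interpret E: matrix_normed_space E by fact
  interpret F: matrix_normed_space F by fact
  have "T (os_scale E 0 0) = os_scale F 0 (T 0)"
    using assms(3) E.subspace_0[OF E.carrier] unfolding os_linear_def by blast
  then show T0: "T 0 = 0" by simp
  show "(\<lambda>i j. T (x i j)) \<in> os_mat F k" if "x \<in> os_mat E k"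
    by (rule F.matI) (use that assms(3) in \<open>auto simp: E.mat_entry E.mat_outside T0 os_linear_def\<close>)
qed

lemma cb_norm_bounds:
  assumes E: "matrix_normed_space E" and F: "matrix_normed_space F" and T: "completely_bounded E F T"
  shows "0 \<le> cb_norm E F T"
    and "1 \<le> k \<Longrightarrow> x \<in> os_mat E k \<Longrightarrow> os_norm F k (\<lambda>i j. T (x i j)) \<le> cb_norm E F T * os_norm E k x"
proof -
  interpret E: matrix_normed_space E by fact
  interpret F: matrix_normed_space F by fact
  have lin: "os_linear E F T" using T by (simp add: completely_bounded_def)
  obtain C where C: "\<And>k x. 1 \<le> k \<Longrightarrow> x \<in> os_mat E k \<Longrightarrow> os_norm F k (\<lambda>i j. T (x i j)) \<le> C * os_norm E k x"
    using T unfolding completely_bounded_def by blast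
  let ?S = "{os_norm F k (\<lambda>i j. T (x i j)) | k x. 1 \<le> k \<and> x \<in> os_mat E k \<and> os_norm E k x \<le> 1}"
  have bdd: "bdd_above ?S"
  proof (rule bdd_aboveI[of _ "\<bar>C\<bar>"])
    fix r assume "r \<in> ?S"
    then obtain k x where r: "r = os_norm F k (\<lambda>i j. T (x i j))" "1 \<le> k" "x \<in> os_mat E k" "os_norm E k x \<le> 1" by blast
    have "C * os_norm E k x \<le> \<bar>C\<bar> * 1"
      using r(4) E.norm_nonneg[OF r(2,3)] by (intro mult_mono) auto
    then show "r \<le> \<bar>C\<bar>" using C[OF r(2,3)] r(1) by simp
  qed
  have le: "os_norm F k (\<lambda>i j. T (x i j)) \<le> cb_norm E F T"
    if "1 \<le> k" "x \<in> os_mat E k" "os_norm E k x \<le> 1" for k x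
    unfolding cb_norm_def by (rule cSup_upper[OF _ bdd]) (use that in blast)
  show "0 \<le> cb_norm E F T"
    using le[OF order_refl E.mat_0] completely_bounded_image(1)[OF E F lin] E.norm_zero[of 1] F.norm_zero[of 1] by simp
  show "os_norm F k (\<lambda>i j. T (x i j)) \<le> cb_norm E F T * os_norm E k x" if k: "1 \<le> k" and x: "x \<in> os_mat E k" for k x
  proof (cases "os_norm E k x = 0")
    case True
    then show ?thesis using C[OF k x] by simp
  next
    case False
    define \<nu> where "\<nu> = os_norm E k x"
    have \<nu>: "\<nu> > 0" using False E.norm_nonneg[OF k x] by (simp add: \<nu>_def)
    let ?y = "\<lambda>i j. os_scale E (of_real (1 / \<nu>)) (x i j)"
    have "os_norm E k ?y \<le> 1" using E.norm_scale[OF k x, of "of_real (1 / \<nu>)"] \<nu> by (simp add: norm_divide flip: \<nu>_def)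
    from le[OF k E.mat_scale[OF x] this]
    have "os_norm F k (\<lambda>i j. T (?y i j)) \<le> cb_norm E F T" .
    moreover have "T (?y i j) = os_scale F (of_real (1 / \<nu>)) (T (x i j))" for i j
      using lin E.mat_entry[OF x] unfolding os_linear_def by blast
    ultimately have "(1 / \<nu>) * os_norm F k (\<lambda>i j. T (x i j)) \<le> cb_norm E F T"
      using F.norm_scale[OF k completely_bounded_image(2)[OF E F lin x], of "of_real (1 / \<nu>)"] \<nu>
      by (simp add: norm_divide)
    then show ?thesis using \<nu> by (simp add: field_simps flip: \<nu>_def)
  qed
qed

lemma cb_norm_le:
  assumes E: "matrix_normed_space E" and C: "0 \<le> C"
    and le: "\<And>k x. 1 \<le> k \<Longrightarrow> x \<in> os_mat E k \<Longrightarrow> os_norm F k (\<lambda>i j. T (x i j)) \<le> C * os_norm E k x"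
  shows "cb_norm E F T \<le> C"
  unfolding cb_norm_def
proof (rule cSup_least)
  interpret E: matrix_normed_space E by fact
  show "{os_norm F k (\<lambda>i j. T (x i j)) | k x. 1 \<le> k \<and> x \<in> os_mat E k \<and> os_norm E k x \<le> 1} \<noteq> {}"
    using E.mat_0[of 1] E.norm_zero[of 1] by fastforce
  fix r assume "r \<in> {os_norm F k (\<lambda>i j. T (x i j)) | k x. 1 \<le> k \<and> x \<in> os_mat E k \<and> os_norm E k x \<le> 1}"
  then obtain k x where r: "r = os_norm F k (\<lambda>i j. T (x i j))" "1 \<le> k" "x \<in> os_mat E k" "os_norm E k x \<le> 1" by blast
  have "C * os_norm E k x \<le> C * 1" by (intro mult_left_mono r C)
  then show "r \<le> C" using le[OF r(2,3)] r(1) by simp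
qed

abbreviation row_col :: "nat \<Rightarrow> ((nat \<Rightarrow> nat \<Rightarrow> complex) \<times> (nat \<Rightarrow> nat \<Rightarrow> complex)) opspace" where
  "row_col n \<equiv> M_inf_fin n \<oplus>\<^sub>\<infinity> M_fin_inf n"

lemma operator_space_row_col: "operator_space (row_col n)"
  by (intro operator_space_sum) (simp_all add: M_inf_fin_pattern M_fin_inf_pattern
    cols.operator_space_pattern rows.operator_space_pattern)

lemma row_col_carrier:
  "v \<in> os_carrier (row_col n) \<longleftrightarrow> bounded_mat (fst v) \<and> (\<forall>i j. n \<le> j \<longrightarrow> fst v i j = 0) \<and>
     bounded_mat (snd v) \<and> (\<forall>i j. n \<le> i \<longrightarrow> snd v i j = 0)"
  by (auto simp: os_sum_def M_inf_fin_pattern M_fin_inf_pattern cols.carrier_iff rows.carrier_iff mem_Times_iff)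

lemma row_col_norm_le_iff:
  assumes "x \<in> os_mat (row_col n) k"
  shows "os_norm (row_col n) k x \<le> C \<longleftrightarrow>
    form_bound (block (\<lambda>i j. fst (x i j))) C \<and> form_bound (block (\<lambda>i j. snd (x i j))) C"
proof -
  have 1: "(\<lambda>i j. fst (x i j)) \<in> os_mat (M_inf_fin n) k" "(\<lambda>i j. snd (x i j)) \<in> os_mat (M_fin_inf n) k"
    using assms by (auto simp: os_mat_def os_sum_def mem_Times_iff split: if_splits)
  show ?thesis
    using cols.norm_le_iff[OF 1(1)[unfolded M_inf_fin_pattern], of C] rows.norm_le_iff[OF 1(2)[unfolded M_fin_inf_pattern], of C]
    by (simp add: os_sum_def M_inf_fin_pattern M_fin_inf_pattern)
qed

lemma row_col_norm1_le_iff: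
  assumes "v \<in> os_carrier (row_col n)"
  shows "os_norm1 (row_col n) v \<le> C \<longleftrightarrow> form_bound (fst v) C \<and> form_bound (snd v) C"
proof -
  interpret Ruan_space "row_col n" by (rule Ruan_space.intro[OF operator_space_row_col])
  have 1: "fst (single_entry v i j) = single_entry (fst v) i j" "snd (single_entry v i j) = single_entry (snd v) i j" for i j
    by (simp_all add: single_entry_def)
  show ?thesis
    unfolding os_norm1_def row_col_norm_le_iff[OF single_in[OF assms]] 1 form_bound_block_single_entry ..
qed

theorem corollary2p7:
  fixes n :: nat and \<epsilon> :: real
  assumes "\<epsilon> > 0"
  shows "has_CSEP TYPE('y::ab_group_add) (2 + \<epsilon>) (os_c0 (M_inf_fin n \<oplus>\<^sub>\<infinity> M_fin_inf n))"
  unfolding has_CSEP_def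
proof (intro conjI allI impI)
  let ?W = "row_col n" and ?Z = "os_c0 (row_col n)"
  show Z: "operator_space ?Z" by (rule operator_space_c0[OF operator_space_row_col])
  fix Y :: "'y opspace" and X T
  assume H: "operator_space Y \<and> separable_space (os_topology Y) \<and> module.subspace (os_scale Y) X \<and>
    closedin (os_topology Y) X \<and> completely_bounded (Y\<lparr>os_carrier := X\<rparr>) ?Z T"
  let ?X = "Y\<lparr>os_carrier := X\<rparr>"
  interpret Y: Ruan_space Y by (rule Ruan_space.intro) (use H in blast)
  interpret Z: Ruan_space ?Z by (rule Ruan_space.intro[OF Z])
  interpret W: Ruan_space ?W by (rule Ruan_space.intro[OF operator_space_row_col])
  interpret MY: Metric_space "os_carrier Y" "os_dist Y" by (rule Y.Metric_space_os_dist)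
  have X: "Y.subspace X" "X \<subseteq> os_carrier Y" using H closedin_subset[of "os_topology Y" X] by auto
  have sep: "separable_space (os_topology Y)" and cbT: "completely_bounded ?X ?Z T" using H by blast+
  have XM: "matrix_normed_space ?X" by (rule Y.subspace_matrix_normed[OF X])
  define C where "C = cb_norm ?X ?Z T"
  have C: "0 \<le> C" unfolding C_def by (rule cb_norm_bounds[OF XM Z.matrix_normed_space_axioms cbT])
  have linT: "os_linear ?X ?Z T" using cbT by (simp add: completely_bounded_def)
  have T_in: "T v \<in> os_carrier ?Z" if "v \<in> X" for v using linT that by (simp add: os_linear_def)
  have T_carrier: "T v m \<in> os_carrier ?W" if "v \<in> X" for v m using T_in[OF that] by (simp add: os_c0_def)
  have T_add: "T (v + w) m = T v m + T w m" if "v \<in> X" "w \<in> X" for v w m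
    using linT that by (simp add: os_linear_def)
  have T_scale: "T (os_scale Y c v) m = os_scale ?W c (T v m)" if "v \<in> X" for v c m
    using linT that by (simp add: os_linear_def os_c0_def)
  have scaleW: "fst (os_scale ?W c w) p q = c * fst w p q" "snd (os_scale ?W c w) p q = c * snd w p q" for c w p q
    by (simp_all add: os_sum_def M_inf_fin_def M_fin_inf_def compact_ops_def case_prod_beta)
  have T_null: "eventually (\<lambda>m. form_bound (fst (T v m)) e \<and> form_bound (snd (T v m)) e) sequentially"
    if v: "v \<in> X" and e: "e > 0" for v e
  proof -
    have "(\<lambda>m. os_norm1 ?W (T v m)) \<longlonglongrightarrow> 0" using T_in[OF v] by (simp add: os_c0_def)
    then have "eventually (\<lambda>m. os_norm1 ?W (T v m) < e) sequentially" using e by (rule order_tendstoD)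
    then show ?thesis
      by eventually_elim (use row_col_norm1_le_iff[OF T_carrier[OF v]] in force)
  qed
  have T_block: "form_bound (block (\<lambda>i j. fst (T (x i j) m))) (C * os_norm Y k x) \<and>
     form_bound (block (\<lambda>i j. snd (T (x i j) m))) (C * os_norm Y k x)" if k: "1 \<le> k" and x: "x \<in> os_mat ?X k" for k x m
  proof -
    have Tx: "(\<lambda>i j. T (x i j)) \<in> os_mat ?Z k"
      by (rule completely_bounded_image(2)[OF XM Z.matrix_normed_space_axioms linT x])
    then have Txm: "(\<lambda>i j. T (x i j) m) \<in> os_mat ?W k" by (auto simp: os_mat_def os_c0_def split: if_splits)
    have "os_norm ?Z k (\<lambda>i j. T (x i j)) \<le> C * os_norm Y k x"
      using cb_norm_bounds(2)[OF XM Z.matrix_normed_space_axioms cbT k x] by (simp add: C_def)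
    then show ?thesis
      using os_c0_norm_le_iff[OF operator_space_row_col Tx k] row_col_norm_le_iff[OF Txm] by blast
  qed
  have null: "pointwise_null X (\<lambda>m p q v. fst (T v m) p q)" "pointwise_null X (\<lambda>m p q v. snd (T v m) p q)"
    using T_null unfolding pointwise_null_def by (auto simp: eventually_conj_iff)
  have correct: "correctable Y C X (\<lambda>_. False) (\<lambda>q. n \<le> q)" "correctable Y C X (\<lambda>p. n \<le> p) (\<lambda>_. False)"
    by (rule correctable_cols correctable_rows;
      use X(2) Y.carrier in \<open>simp add: Y.subspace_0 Y.subspace_add Y.subspace_scale\<close>)+
  obtain b1 where b1: "\<And>m. cb_map Y (2 * C) (\<lambda>_. False) (\<lambda>q. n \<le> q) (b1 m)"
    "\<And>m p q v. v \<in> X \<Longrightarrow> b1 m p q v = fst (T v m) p q" "pointwise_null (os_carrier Y) b1"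
  proof (rule Y.corrected_extension[OF sep X C _ _ _ null(1) correct(1)])
    show "functional_on ?X (\<lambda>v. fst (T v m) p q)" for m p q
      by (simp add: functional_on_def T_add T_scale scaleW)
    show "cb_form ?X C (\<lambda>p q v. fst (T v m) p q)" for m
      using T_block by (simp add: cb_form_def)
    show "fst (T v m) p q = 0" if "v \<in> X" "False \<or> n \<le> q" for m p q v
      using T_carrier[OF that(1), of m] that(2) by (simp add: row_col_carrier)
  qed (rule that; assumption)
  obtain b2 where b2: "\<And>m. cb_map Y (2 * C) (\<lambda>p. n \<le> p) (\<lambda>_. False) (b2 m)"
    "\<And>m p q v. v \<in> X \<Longrightarrow> b2 m p q v = snd (T v m) p q" "pointwise_null (os_carrier Y) b2"
  proof (rule Y.corrected_extension[OF sep X C _ _ _ null(2) correct(2)])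
    show "functional_on ?X (\<lambda>v. snd (T v m) p q)" for m p q
      by (simp add: functional_on_def T_add T_scale scaleW)
    show "cb_form ?X C (\<lambda>p q v. snd (T v m) p q)" for m
      using T_block by (simp add: cb_form_def)
    show "snd (T v m) p q = 0" if "v \<in> X" "n \<le> p \<or> False" for m p q v
      using T_carrier[OF that(1), of m] that(2) by (simp add: row_col_carrier)
  qed (rule that; assumption)
  have b_cb: "cb_form Y (2 * C) (b1 m)" "cb_form Y (2 * C) (b2 m)"
    and b_lin: "functional_on Y (b1 m p q)" "functional_on Y (b2 m p q)"
    and b_pat: "n \<le> q \<Longrightarrow> b1 m p q v = 0" "n \<le> p \<Longrightarrow> b2 m p q v = 0" for m p q v
    using b1(1)[of m] b2(1)[of m] by (auto simp: cb_map_def)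
  define T' where "T' v = (\<lambda>m. (\<lambda>p q. b1 m p q v, \<lambda>p q. b2 m p q v))" for v
  have T'_carrier: "T' v m \<in> os_carrier ?W" if "v \<in> os_carrier Y" for v m
    using cb_form_value[OF b_cb(1) that] cb_form_value[OF b_cb(2) that] b_pat
    by (auto simp: row_col_carrier T'_def bounded_mat_iff)
  have T'_in: "T' v \<in> os_carrier ?Z" if v: "v \<in> os_carrier Y" for v
  proof -
    have "(\<lambda>m. os_norm1 ?W (T' v m)) \<longlonglongrightarrow> 0"
    proof (rule tendstoI)
      fix e :: real assume e: "e > 0"
      then have e2: "e / 2 > 0" by simp
      have "\<forall>\<^sub>F m in sequentially. form_bound (\<lambda>p q. b1 m p q v) (e / 2)"
        "\<forall>\<^sub>F m in sequentially. form_bound (\<lambda>p q. b2 m p q v) (e / 2)"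
        using b1(3) b2(3) v e2 unfolding pointwise_null_def by blast+
      then show "eventually (\<lambda>m. dist (os_norm1 ?W (T' v m)) 0 < e) sequentially"
      proof eventually_elim
        case (elim m)
        then have "os_norm1 ?W (T' v m) \<le> e / 2"
          unfolding row_col_norm1_le_iff[OF T'_carrier[OF v]] by (simp add: T'_def)
        then show ?case using W.norm1_nonneg[OF T'_carrier[OF v, of m]] e by simp
      qed
    qed
    then show ?thesis using T'_carrier[OF v] by (simp add: os_c0_def)
  qed
  have linT': "os_linear Y ?Z T'"
    unfolding os_linear_def
  proof (intro conjI ballI allI T'_in)
    fix v w assume "v \<in> os_carrier Y" "w \<in> os_carrier Y"
    then show "T' (v + w) = T' v + T' w"
      using b_lin by (simp add: T'_def functional_on_def fun_eq_iff)
  next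
    fix c v assume "v \<in> os_carrier Y"
    then show "T' (os_scale Y c v) = os_scale ?Z c (T' v)"
      using b_lin
      by (simp add: T'_def functional_on_def fun_eq_iff os_c0_def os_sum_def M_inf_fin_def M_fin_inf_def compact_ops_def)
  qed
  have T'_le: "os_norm ?Z k (\<lambda>i j. T' (x i j)) \<le> (2 * C) * os_norm Y k x" if k: "1 \<le> k" and x: "x \<in> os_mat Y k" for k x
  proof -
    have T'x: "(\<lambda>i j. T' (x i j)) \<in> os_mat ?Z k"
      by (rule completely_bounded_image(2)[OF Y.matrix_normed_space_axioms Z.matrix_normed_space_axioms linT' x])
    then have T'xm: "(\<lambda>i j. T' (x i j) m) \<in> os_mat ?W k" for m by (auto simp: os_mat_def os_c0_def split: if_splits)
    show ?thesis
      unfolding os_c0_norm_le_iff[OF operator_space_row_col T'x k] row_col_norm_le_iff[OF T'xm]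
      using b_cb k x by (simp add: T'_def cb_form_def)
  qed
  show "\<exists>T'. completely_bounded Y ?Z T' \<and> (\<forall>v\<in>X. T' v = T v) \<and> cb_norm Y ?Z T' \<le> (2 + \<epsilon>) * cb_norm ?X ?Z T"
  proof (intro exI conjI ballI)
    show "completely_bounded Y ?Z T'" unfolding completely_bounded_def using linT' T'_le by blast
    show "T' v = T v" if "v \<in> X" for v
      using b1(2)[OF that] b2(2)[OF that] by (simp add: T'_def fun_eq_iff prod_eq_iff)
    have "cb_norm Y ?Z T' \<le> 2 * C"
      by (rule cb_norm_le[OF Y.matrix_normed_space_axioms _ T'_le]) (use C in auto)
    also have "\<dots> \<le> (2 + \<epsilon>) * C" using assms C by (intro mult_right_mono) auto
    finally show "cb_norm Y ?Z T' \<le> (2 + \<epsilon>) * cb_norm ?X ?Z T" by (simp add: C_def)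
  qed
qed

end
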